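(* Let $(u,B)$ be a weak solution of the ideal MHD equations on $\mathbb{T}^3\times(0,T)$ (in the sense given in the context) whose initial data satisfy $\mathrm{div}\,u_0=\mathrm{div}\,B_0=0$, and suppose that $(u,B)$ arises as a vanishing viscosity and resistivity weak-$*$ limit in $L^\infty((0,T);L^2(\mathbb{T}^3))$ of a sequence of Leray–Hopf weak solutions of the viscous and resistive MHD equations (with viscosities and resistivities tending to $0$) with divergence-free initial data for the magnetic field. Then $\nabla\cdot B=0$ in the weak sense, i.e. $\int_0^T\int_{\mathbb{T}^3}B\cdot\nabla\Phi\,dx\,dt=0$ for all $\Phi\in\mathcal{D}(\mathbb{T}^3\times(0,T);\mathbb{R})$.
   Context: $\mathbb{T}^3$ is the three-dimensional torus, $T>0$, $\mathcal{D}$ denotes $C_c^\infty$. $(a\otimes b)_{ij}=a_ib_j$, $(\nabla\psi)_{ij}=\partial_i\psi_j$, $M:N=\sum_{i,j}M_{ij}N_{ij}$, $\mathrm{div}\,B=\nabla\cdot B$ (not assumed to vanish). Weak solution of the ideal MHD equations: a pair $(u,B)$ with $u,B,\mathrm{div}\,B\in L^\infty((0,T);L^2(\mathbb{T}^3))$ such that for all divergence-free $\psi_1\in\mathcal{D}(\mathbb{T}^3\times(0,T);\mathbb{R}^3)$, all $\psi_2\in\mathcal{D}(\mathbb{T}^3\times(0,T);\mathbb{R}^3)$ (not necessarily divergence-free) and all $\varphi\in\mathcal{D}(\mathbb{T}^3\times(0,T);\mathbb{R})$ $$\int_0^T\!\!\int_{\mathbb{T}^3}\big[u\cdot\partial_t\psi_1+u\otimes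 u:\nabla\psi_1-B\otimes B:\nabla\psi_1-(\mathrm{div}\,B)\,B\cdot\psi_1\big]dx\,dt=0,$$ $$\int_0^T\!\!\int_{\mathbb{T}^3}\big[B\cdot\partial_t\psi_2+u\otimes B:\nabla\psi_2-B\otimes u:\nabla\psi_2-(\mathrm{div}\,B)\,u\cdot\psi_2\big]dx\,dt=0,$$ $$\int_0^T\!\!\int_{\mathbb{T}^3}u\cdot\nabla\varphi\,dx\,dt=0.$$ Leray–Hopf weak solution of the viscous and resistive MHD equations with viscosity $\nu_1>0$ and resistivity $\nu_2>0$: a pair $(u,B)$ with $u,B,\mathrm{div}\,B\in L^\infty((0,T);L^2(\mathbb{T}^3))\cap L^2((0,T);H^1(\mathbb{T}^3))$ satisfying, for the same classes of test functions, the three identities above with the additional terms $-\nu_1\nabla u:\nabla\psi_1$ in the first integrand and $-\nu_2\nabla B:\nabla\psi_2$ in the second, and attaining its initial data (in $L^2(\mathbb{T}^3)$, with the initial velocity weakly divergence-free) strongly in $L^2(\mathbb{T}^3)$. *)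

theory Defs
  imports "HOL-Analysis.Analysis"
begin

text \<open>
  The torus is \<open>\<real>\<^sup>3\<close> modulo the integer lattice: functions on it are 1-periodic functions on
  \<open>real^3\<close>, integrated over the unit cube. Functions on \<open>(0,T)\<close> times the torus take pairs
  \<open>(t, x)\<close>; only their values for \<open>0 < t < T\<close> matter.

  Elements of Lebesgue spaces are given by Borel representatives. Every class of Lebesgue
  measurable functions has one, and all conditions on such functions below are insensitive to
  a change of representative.
\<close>

abbreviation cube :: "(real^3) set" where
  "cube \<equiv> cbox 0 1"

abbreviation Q :: "real \<Rightarrow> (real \<times> (real^3)) set" where
  "Q T \<equiv> {0<..<T} \<times> cube"

definition periodic :: "(real^3 \<Rightarrow> 'b) \<Rightarrow> bool" where
  "periodic f \<longleftrightarrow> (\<forall>x i. f (x + axis i 1) = f x)"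

definition tensor :: "real^3 \<Rightarrow> real^3 \<Rightarrow> real^3^3" where
  "tensor a b = (\<chi> i j. a $ i * b $ j)"

definition frob :: "real^3^3 \<Rightarrow> real^3^3 \<Rightarrow> real" where
  "frob M N = (\<Sum>i\<in>UNIV. \<Sum>j\<in>UNIV. M $ i $ j * N $ i $ j)"


section \<open>Smooth functions and test functions\<close>

text \<open>On a finite-dimensional domain, \<open>Ck k\<close> is the class of \<open>k\<close> times continuously
  differentiable functions: all iterated directional derivatives up to order \<open>k\<close> exist and are
  continuous.\<close>

primrec Ck :: "nat \<Rightarrow> ('a::real_normed_vector \<Rightarrow> 'b::real_normed_vector) \<Rightarrow> bool" where
  "Ck 0 f \<longleftrightarrow> continuous_on UNIV f"
| "Ck (Suc k) f \<longleftrightarrow>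
     (\<forall>x. f differentiable (at x)) \<and> (\<forall>v. Ck k (\<lambda>x. frechet_derivative f (at x) v))"

definition smooth :: "('a::real_normed_vector \<Rightarrow> 'b::real_normed_vector) \<Rightarrow> bool" where
  "smooth f \<longleftrightarrow> (\<forall>k. Ck k f)"

definition grad :: "(real^3 \<Rightarrow> 'b::real_normed_vector) \<Rightarrow> real^3 \<Rightarrow> 'b^3" where
  "grad f x = (\<chi> i. frechet_derivative f (at x) (axis i 1))"

definition grad_x :: "(real \<times> (real^3) \<Rightarrow> 'b::real_normed_vector) \<Rightarrow> real \<times> (real^3) \<Rightarrow> 'b^3" where
  "grad_x \<psi> = (\<lambda>(t, x). grad (\<lambda>y. \<psi> (t, y)) x)"

definition deriv_t :: "(real \<times> (real^3) \<Rightarrow> 'b::real_normed_vector) \<Rightarrow> real \<times> (real^3) \<Rightarrow> 'b" where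
  "deriv_t \<psi> = (\<lambda>(t, x). vector_derivative (\<lambda>s. \<psi> (s, x)) (at t))"

definition smooth_torus :: "(real^3 \<Rightarrow> 'b::real_normed_vector) \<Rightarrow> bool" where
  "smooth_torus \<phi> \<longleftrightarrow> smooth \<phi> \<and> periodic \<phi>"

text \<open>Test functions with compact support in \<open>(0,T)\<close> times the torus, extended by zero to all
  times.\<close>

definition test_fun :: "real \<Rightarrow> (real \<times> (real^3) \<Rightarrow> 'b::real_normed_vector) \<Rightarrow> bool" where
  "test_fun T \<psi> \<longleftrightarrow>
     smooth \<psi> \<and> (\<forall>t. periodic (\<lambda>x. \<psi> (t, x))) \<and>
     (\<exists>a b. 0 < a \<and> a < b \<and> b < T \<and> (\<forall>t x. t \<notin> {a..b} \<longrightarrow> \<psi> (t, x) = 0))"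

definition div_free_test :: "real \<Rightarrow> (real \<times> (real^3) \<Rightarrow> real^3) \<Rightarrow> bool" where
  "div_free_test T \<psi> \<longleftrightarrow> test_fun T \<psi> \<and> (\<forall>z. (\<Sum>i\<in>UNIV. grad_x \<psi> z $ i $ i) = 0)"


section \<open>Function spaces\<close>

definition L2_torus :: "(real^3 \<Rightarrow> 'b::euclidean_space) \<Rightarrow> bool" where
  "L2_torus h \<longleftrightarrow> periodic h \<and> h \<in> borel_measurable borel \<and>
     set_integrable lborel cube (\<lambda>x. (norm (h x))\<^sup>2)"

text \<open>Only meaningful for square integrable \<open>h\<close>.\<close>

definition L2_norm :: "(real^3 \<Rightarrow> 'b::euclidean_space) \<Rightarrow> real" where
  "L2_norm h = sqrt (LINT x:cube|lborel. (norm (h x))\<^sup>2)"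

text \<open>Strongly measurable maps from \<open>(0,T)\<close> to \<open>L\<^sup>2\<close> of the torus; by separability these are
  given by the jointly measurable functions with almost all time slices in \<open>L\<^sup>2\<close>.\<close>

definition meas_L2 :: "real \<Rightarrow> (real \<times> (real^3) \<Rightarrow> 'b::euclidean_space) \<Rightarrow> bool" where
  "meas_L2 T f \<longleftrightarrow>
     set_borel_measurable borel ({0<..<T} \<times> UNIV) f \<and>
     (\<forall>t\<in>{0<..<T}. periodic (\<lambda>x. f (t, x))) \<and>
     (AE t in lborel. t \<in> {0<..<T} \<longrightarrow> L2_torus (\<lambda>x. f (t, x)))"

definition L1_L2 :: "real \<Rightarrow> (real \<times> (real^3) \<Rightarrow> 'b::euclidean_space) \<Rightarrow> bool" where
  "L1_L2 T f \<longleftrightarrow> meas_L2 T f \<and>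
     set_integrable lborel {0<..<T} (\<lambda>t. L2_norm (\<lambda>x. f (t, x)))"

definition L2_L2 :: "real \<Rightarrow> (real \<times> (real^3) \<Rightarrow> 'b::euclidean_space) \<Rightarrow> bool" where
  "L2_L2 T f \<longleftrightarrow> meas_L2 T f \<and>
     set_integrable lborel {0<..<T} (\<lambda>t. (L2_norm (\<lambda>x. f (t, x)))\<^sup>2)"

definition Linf_L2 :: "real \<Rightarrow> (real \<times> (real^3) \<Rightarrow> 'b::euclidean_space) \<Rightarrow> bool" where
  "Linf_L2 T f \<longleftrightarrow> meas_L2 T f \<and>
     (\<exists>C. AE t in lborel. t \<in> {0<..<T} \<longrightarrow> L2_norm (\<lambda>x. f (t, x)) \<le> C)"

text \<open>Weak gradient (row \<open>i\<close> is the weak derivative in direction \<open>i\<close>) and weak divergence on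
  the torus.\<close>

definition weak_grad :: "(real^3 \<Rightarrow> 'b::euclidean_space) \<Rightarrow> (real^3 \<Rightarrow> 'b^3) \<Rightarrow> bool" where
  "weak_grad f G \<longleftrightarrow>
     (\<forall>\<phi>::real^3 \<Rightarrow> real. smooth_torus \<phi> \<longrightarrow>
        (\<forall>i. (LINT x:cube|lborel. (grad \<phi> x $ i) *\<^sub>R f x) = - (LINT x:cube|lborel. \<phi> x *\<^sub>R (G x $ i))))"

definition weak_div :: "(real^3 \<Rightarrow> real^3) \<Rightarrow> (real^3 \<Rightarrow> real) \<Rightarrow> bool" where
  "weak_div f d \<longleftrightarrow>
     (\<forall>\<phi>::real^3 \<Rightarrow> real. smooth_torus \<phi> \<longrightarrow>
        (LINT x:cube|lborel. f x \<bullet> grad \<phi> x) = - (LINT x:cube|lborel. d x * \<phi> x))"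

definition weakly_div_free :: "(real^3 \<Rightarrow> real^3) \<Rightarrow> bool" where
  "weakly_div_free f \<longleftrightarrow> weak_div f (\<lambda>_. 0)"

text \<open>\<open>G\<close> is the spatial gradient of \<open>f\<close>, and \<open>f\<close> belongs to \<open>L\<^sup>2((0,T); H\<^sup>1)\<close>.\<close>

definition L2_H1 ::
    "real \<Rightarrow> (real \<times> (real^3) \<Rightarrow> 'b::euclidean_space) \<Rightarrow> (real \<times> (real^3) \<Rightarrow> 'b^3) \<Rightarrow> bool" where
  "L2_H1 T f G \<longleftrightarrow> L2_L2 T f \<and> L2_L2 T G \<and>
     (AE t in lborel. t \<in> {0<..<T} \<longrightarrow> weak_grad (\<lambda>x. f (t, x)) (\<lambda>x. G (t, x)))"

definition has_div :: "real \<Rightarrow> (real \<times> (real^3) \<Rightarrow> real^3) \<Rightarrow> (real \<times> (real^3) \<Rightarrow> real) \<Rightarrow> bool" where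
  "has_div T B D \<longleftrightarrow>
     (AE t in lborel. t \<in> {0<..<T} \<longrightarrow> weak_div (\<lambda>x. B (t, x)) (\<lambda>x. D (t, x)))"

text \<open>Weak-* convergence in \<open>L\<^sup>\<infinity>((0,T); L\<^sup>2)\<close>, the dual of \<open>L\<^sup>1((0,T); L\<^sup>2)\<close>.\<close>

definition weakstar_lim ::
    "real \<Rightarrow> (nat \<Rightarrow> real \<times> (real^3) \<Rightarrow> real^3) \<Rightarrow> (real \<times> (real^3) \<Rightarrow> real^3) \<Rightarrow> bool" where
  "weakstar_lim T f l \<longleftrightarrow>
     (\<forall>n. Linf_L2 T (f n)) \<and> Linf_L2 T l \<and>
     (\<forall>g::real \<times> (real^3) \<Rightarrow> real^3. L1_L2 T g \<longrightarrow>
        (\<lambda>n. LINT z:Q T|lborel. f n z \<bullet> g z) \<longlonglongrightarrow> (LINT z:Q T|lborel. l z \<bullet> g z))"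

text \<open>Limit as \<open>t \<rightarrow> 0+\<close> outside a null set of times, as appropriate for functions of time that
  are defined almost everywhere only.\<close>

definition ess_lim0 :: "real \<Rightarrow> (real \<Rightarrow> real) \<Rightarrow> real \<Rightarrow> bool" where
  "ess_lim0 T h l \<longleftrightarrow>
     (\<forall>e>0. \<exists>d>0. AE t in lborel. 0 < t \<and> t < d \<and> t < T \<longrightarrow> \<bar>h t - l\<bar> < e)"

definition attains_strongly :: "real \<Rightarrow> (real \<times> (real^3) \<Rightarrow> real^3) \<Rightarrow> (real^3 \<Rightarrow> real^3) \<Rightarrow> bool" where
  "attains_strongly T f f0 \<longleftrightarrow> L2_torus f0 \<and> ess_lim0 T (\<lambda>t. L2_norm (\<lambda>x. f (t, x) - f0 x)) 0"

text \<open>Weak solutions of the ideal equations attain their initial data only weakly in \<open>L\<^sup>2\<close>.\<close>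

definition attains_weakly :: "real \<Rightarrow> (real \<times> (real^3) \<Rightarrow> real^3) \<Rightarrow> (real^3 \<Rightarrow> real^3) \<Rightarrow> bool" where
  "attains_weakly T f f0 \<longleftrightarrow> L2_torus f0 \<and>
     (\<forall>w::real^3 \<Rightarrow> real^3. L2_torus w \<longrightarrow>
        ess_lim0 T (\<lambda>t. LINT x:cube|lborel. f (t, x) \<bullet> w x) (LINT x:cube|lborel. f0 x \<bullet> w x))"


section \<open>Weak solutions\<close>

text \<open>The divergence of \<open>B\<close> and, in the viscous case, the gradients are unique up to null sets,
  so quantifying them existentially amounts to requiring that they exist in the stated spaces.\<close>

definition ideal_mhd_weak_solution ::
    "real \<Rightarrow> (real \<times> (real^3) \<Rightarrow> real^3) \<Rightarrow> (real \<times> (real^3) \<Rightarrow> real^3) \<Rightarrow> bool" where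
  "ideal_mhd_weak_solution T u B \<longleftrightarrow>
     (\<exists>D. Linf_L2 T u \<and> Linf_L2 T B \<and> Linf_L2 T D \<and> has_div T B D \<and>
       (\<forall>\<psi>. div_free_test T \<psi> \<longrightarrow>
          (LINT z:Q T|lborel. u z \<bullet> deriv_t \<psi> z
             + frob (tensor (u z) (u z)) (grad_x \<psi> z)
             - frob (tensor (B z) (B z)) (grad_x \<psi> z)
             - D z * (B z \<bullet> \<psi> z)) = 0) \<and>
       (\<forall>\<psi>::real \<times> (real^3) \<Rightarrow> real^3. test_fun T \<psi> \<longrightarrow>
          (LINT z:Q T|lborel. B z \<bullet> deriv_t \<psi> z
             + frob (tensor (u z) (B z)) (grad_x \<psi> z)
             - frob (tensor (B z) (u z)) (grad_x \<psi> z)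
             - D z * (u z \<bullet> \<psi> z)) = 0) \<and>
       (\<forall>\<phi>::real \<times> (real^3) \<Rightarrow> real. test_fun T \<phi> \<longrightarrow>
          (LINT z:Q T|lborel. u z \<bullet> grad_x \<phi> z) = 0))"

definition leray_hopf_mhd_solution ::
    "real \<Rightarrow> real \<Rightarrow> real \<Rightarrow> (real \<times> (real^3) \<Rightarrow> real^3) \<Rightarrow> (real \<times> (real^3) \<Rightarrow> real^3) \<Rightarrow>
     (real^3 \<Rightarrow> real^3) \<Rightarrow> (real^3 \<Rightarrow> real^3) \<Rightarrow> bool" where
  "leray_hopf_mhd_solution T \<nu>1 \<nu>2 u B u0 B0 \<longleftrightarrow>
     (\<exists>D Gu GB GD.
       Linf_L2 T u \<and> Linf_L2 T B \<and> Linf_L2 T D \<and> has_div T B D \<and>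
       L2_H1 T u Gu \<and> L2_H1 T B GB \<and> L2_H1 T D GD \<and>
       (\<forall>\<psi>. div_free_test T \<psi> \<longrightarrow>
          (LINT z:Q T|lborel. u z \<bullet> deriv_t \<psi> z
             + frob (tensor (u z) (u z)) (grad_x \<psi> z)
             - frob (tensor (B z) (B z)) (grad_x \<psi> z)
             - D z * (B z \<bullet> \<psi> z)
             - \<nu>1 * frob (Gu z) (grad_x \<psi> z)) = 0) \<and>
       (\<forall>\<psi>::real \<times> (real^3) \<Rightarrow> real^3. test_fun T \<psi> \<longrightarrow>
          (LINT z:Q T|lborel. B z \<bullet> deriv_t \<psi> z
             + frob (tensor (u z) (B z)) (grad_x \<psi> z)
             - frob (tensor (B z) (u z)) (grad_x \<psi> z)
             - D z * (u z \<bullet> \<psi> z)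
             - \<nu>2 * frob (GB z) (grad_x \<psi> z)) = 0) \<and>
       (\<forall>\<phi>::real \<times> (real^3) \<Rightarrow> real. test_fun T \<phi> \<longrightarrow>
          (LINT z:Q T|lborel. u z \<bullet> grad_x \<phi> z) = 0)) \<and>
     weakly_div_free u0 \<and> attains_strongly T u u0 \<and> attains_strongly T B B0"

end

theory Submission
  imports Defs "HOL-Real_Asymp.Real_Asymp"
begin

text \<open>The divergence \<open>D\<close> of the magnetic field of each approximating solution vanishes, and this property
  passes to the weak-* limit because it is linear in \<open>B\<close>.

  To see that \<open>D\<close> vanishes, test the induction equation with the gradient of a scalar function. Its
  Hessian is symmetric, so the two tensor terms cancel, and what remains is the weak form of
  \<open>\<partial>\<^sub>t D + div (u D) = \<nu> \<Delta> D\<close>. As \<open>div B\<close> is initially zero and \<open>B\<close> attains its initial data, \<open>D\<close> starts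
  from zero in the weak sense. It remains to prove uniqueness for this linear equation
  (\<open>advection_diffusion_unique\<close>), where \<open>D\<close> lies in \<open>L\<^sup>\<infinity>(L\<^sup>2)\<close> and in \<open>L\<^sup>2(H\<^sup>1)\<close>, whereas \<open>u\<close> is merely a
  weakly divergence-free field in \<open>L\<^sup>\<infinity>(L\<^sup>2)\<close>. Testing with \<open>D\<close> itself is not possible, since \<open>u \<cdot> \<nabla>D\<close>
  is only integrable. This calls for renormalisation: smooth the equation in space by a kernel,
  multiply by \<open>\<beta>'(D\<^sub>N)\<close>, where \<open>D\<^sub>N\<close> is the smoothed divergence and \<open>\<beta>(s) = sqrt (1 + s\<^sup>2)\<close> has a bounded
  derivative, and integrate. The viscous term has a sign because \<open>\<beta>\<close> is convex
  (\<open>dissipation_nonneg\<close>). The transport term would vanish if smoothing commuted with the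
  multiplication by \<open>u\<close>; the commutator \<open>(u \<cdot> \<nabla>D)\<^sub>N - u \<cdot> \<nabla>D\<^sub>N\<close> equals the integral of
  \<open>K\<^sub>N(x - y) (u(y) - u(x)) \<cdot> \<nabla>D(y)\<close> and tends to zero in \<open>L\<^sup>1\<close> because translations are continuous
  in \<open>L\<^sup>2\<close> (\<open>transport_error\<close>, \<open>defect_tendsto\<close>). So \<open>\<beta>(D\<^sub>N) - 1\<close> tends to zero in mean, and \<open>D = 0\<close>.

  The kernel \<open>K\<^sub>N\<close> is a trigonometric polynomial. Therefore every smoothed function is a finite
  combination of sines and cosines, whose coefficients are functions of time; spatial
  derivatives never have to be exchanged with an integral, waves suffice as test functions in
  space, and the smoothed equation amounts to finitely many ordinary differential equations. In
  time the coefficients are only weakly differentiable. The lemma of du Bois-Reymond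
  (\<open>weak_derivative_primitive\<close>) turns them into Lipschitz functions, for which a chain rule
  (\<open>chain_rule_primitive\<close>) is available.\<close>

section \<open>The torus as a finite measure space\<close>

abbreviation torus :: "(real^3) measure" where
  "torus \<equiv> restrict_space lborel cube"

lemma set_lint_torus: "(LINT x:cube|lborel. f x) = (\<integral>x. f x \<partial>torus)"
  for f :: "real^3 \<Rightarrow> 'b::{banach, second_countable_topology}"
  by (simp add: set_lebesgue_integral_def integral_restrict_space)

lemma set_integrable_torus: "set_integrable lborel cube f \<longleftrightarrow> integrable torus f"
  for f :: "real^3 \<Rightarrow> 'b::{banach, second_countable_topology}"
  by (simp add: set_integrable_def integrable_restrict_space)

lemma borel_measurable_torus [measurable (raw)]:
  "f \<in> borel_measurable borel \<Longrightarrow> f \<in> borel_measurable torus"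
  by (rule measurable_restrict_space1) simp

lemma borel_torus_id: "(\<lambda>x. x) \<in> torus \<rightarrow>\<^sub>M borel"
  by (rule measurable_restrict_space1) simp

lemma space_torus [simp]: "space torus = cube"
  by (simp add: space_restrict_space)

lemma emeasure_torus [simp]: "emeasure torus cube = 1"
proof -
  have "(\<Prod>b\<in>Basis. (1::real^3) \<bullet> b) = 1"
    by (rule prod.neutral) (auto simp: Basis_vec_def inner_axis)
  then show ?thesis
    by (auto simp: emeasure_restrict_space emeasure_lborel_cbox_eq Basis_vec_def inner_axis)
qed

interpretation torus: finite_measure torus
  by standard simp

lemma measure_torus [simp]: "measure torus cube = 1"
  by (simp add: measure_def)

definition intvec :: "int^3 \<Rightarrow> real^3" where
  "intvec z = (\<chi> i. of_int (z $ i))"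

lemma intvec_nth [simp]: "intvec z $ i = of_int (z $ i)"
  by (simp add: intvec_def)

lemma periodic_intvec:
  assumes "periodic f"
  shows "f (x + intvec z) = f x"
proof -
  have step: "f (x + axis i 1) = f x" for x i
    using assms by (auto simp: periodic_def)
  have nat: "f (x + axis i (real n)) = f x" for x i n
  proof (induction n arbitrary: x)
    case (Suc n)
    have "x + axis i (real (Suc n)) = (x + axis i (real n)) + axis i 1"
      by (simp add: axis_def vec_eq_iff)
    then show ?case using Suc step by metis
  qed (simp add: axis_def vec_eq_iff flip: zero_vec_def)
  have int: "f (x + axis i (of_int m)) = f x" for x i m
  proof (cases "m \<ge> 0")
    case True
    then show ?thesis using nat[of x i "nat m"] by simp
  next
    case False
    have "f ((x + axis i (of_int m)) + axis i (real (nat (- m)))) = f (x + axis i (of_int m))"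
      by (rule nat)
    moreover have "(x + axis i (of_int m)) + axis i (real (nat (- m))) = x"
      using False by (simp add: axis_def vec_eq_iff)
    ultimately show ?thesis by simp
  qed
  have "x + intvec z = x + axis 1 (of_int (z$1)) + axis 2 (of_int (z$2)) + axis 3 (of_int (z$3))"
    by (simp add: vec_eq_iff forall_3 axis_def)
  then have "f (x + intvec z) = f (x + axis 1 (of_int (z$1)) + axis 2 (of_int (z$2)) + axis 3 (of_int (z$3)))"
    by (rule arg_cong)
  then show ?thesis by (simp only: int)
qed

text \<open>The half-open cube meets each orbit of the integer lattice exactly once; the closed cube has
  the same integrals.\<close>

definition halfcube :: "(real^3) set" where
  "halfcube = {x. \<forall>i. 0 \<le> x $ i \<and> x $ i < 1}"

lemma halfcube_sets [measurable]: "halfcube \<in> sets borel"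
proof -
  have "halfcube = {x\<in>space borel. \<forall>i\<in>UNIV. 0 \<le> x $ i \<and> x $ i < 1}"
    by (auto simp: halfcube_def)
  also have "\<dots> \<in> sets borel" by measurable
  finally show ?thesis .
qed

lemma AE_halfcube: "AE x in lborel. x \<in> cube \<longleftrightarrow> x \<in> halfcube"
proof -
  have "AE x::real^3 in lborel. x $ i \<noteq> 1" for i
  proof -
    have "negligible {x::real^3. x $ i = 1}"
      using negligible_standard_hyperplane[of "axis i 1 :: real^3" 1]
      by (simp add: inner_axis axis_in_Basis_iff)
    moreover have "{x::real^3. x $ i = 1} \<in> sets borel" by measurable
    ultimately have "{x::real^3. x $ i = 1} \<in> null_sets lborel"
      by (auto simp: null_sets_def negligible_iff_emeasure0)
    then show ?thesis by (rule AE_I') auto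
  qed
  then have "AE x::real^3 in lborel. \<forall>i\<in>UNIV. x $ i \<noteq> 1"
    by (subst AE_ball_countable) (auto intro: countable_finite)
  then show ?thesis
    by eventually_elim (auto simp: halfcube_def mem_box_cart less_le)
qed

lemma nn_integral_torus_halfcube:
  "(\<integral>\<^sup>+x. f x \<partial>torus) = (\<integral>\<^sup>+x. indicator halfcube x * f x \<partial>lborel)"
proof -
  have "(\<integral>\<^sup>+x. f x \<partial>torus) = (\<integral>\<^sup>+x. indicator cube x * f x \<partial>lborel)"
    by (simp add: nn_integral_restrict_space mult.commute)
  also have "\<dots> = (\<integral>\<^sup>+x. indicator halfcube x * f x \<partial>lborel)"
    by (rule nn_integral_cong_AE) (use AE_halfcube in eventually_elim, auto split: split_indicator)
  finally show ?thesis .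
qed

lemma nn_integral_lborel_isometry:
  fixes f :: "real^3 \<Rightarrow> ennreal"
  assumes [measurable]: "f \<in> borel_measurable borel" and s: "\<bar>s\<bar> = (1::real)"
  shows "(\<integral>\<^sup>+x. f (h + s *\<^sub>R x) \<partial>lborel) = (\<integral>\<^sup>+x. f x \<partial>lborel)"
proof -
  have "lborel = density (distr lborel borel (\<lambda>x::real^3. h + s *\<^sub>R x)) (\<lambda>_. \<bar>s\<bar>^DIM(real^3))"
    using s by (intro lborel_affine) auto
  then have eq: "lborel = distr lborel borel (\<lambda>x::real^3. h + s *\<^sub>R x)"
    by (simp add: s density_1)
  show ?thesis
    by (subst (2) eq) (simp add: nn_integral_distr)
qed

text \<open>Each coordinate of \<open>z\<close> is determined by a floor. The sign \<open>s\<close> allows translations and reflections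
  to be treated together.\<close>

lemma halfcube_tiling:
  assumes s: "\<bar>s\<bar> = (1::real)"
  shows "(\<integral>\<^sup>+z. indicator halfcube (w + s *\<^sub>R intvec z) \<partial>count_space UNIV) = 1"
proof -
  define z0 :: "int^3" where "z0 = (\<chi> i. - (of_int \<lfloor>w $ i\<rfloor>) * (if s = 1 then 1 else - 1))"
  have s2: "s = 1 \<or> s = -1" using s by linarith
  have "w + s *\<^sub>R intvec z \<in> halfcube \<longleftrightarrow> z = z0" for z
  proof -
    have "0 \<le> r + of_int m \<and> r + of_int m < 1 \<longleftrightarrow> m = - \<lfloor>r\<rfloor>" for r :: real and m
      by linarith
    note a = this
    have "0 \<le> r - of_int m \<and> r - of_int m < 1 \<longleftrightarrow> m = \<lfloor>r\<rfloor>" for r :: real and m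
      by linarith
    note b = this
    show ?thesis
    proof (cases "s = 1")
      case True
      then show ?thesis by (simp add: halfcube_def z0_def vec_eq_iff a)
    next
      case False
      then have "s = -1" using s2 by simp
      then show ?thesis by (simp add: halfcube_def z0_def vec_eq_iff b[simplified])
    qed
  qed
  then have "(\<lambda>z. indicator halfcube (w + s *\<^sub>R intvec z) :: ennreal) = indicator {z0}"
    by (auto simp: fun_eq_iff split: split_indicator)
  then show ?thesis by simp
qed

text \<open>The unfolding argument: insert the sum over all tiles, which is 1, exchange it with the
  integral, and move every tile back to the half-open cube by periodicity. Then the moved copies
  of the original domain tile the cube, and their sum is 1 again.\<close>

lemma nn_integral_torus_isometry:
  fixes f :: "real^3 \<Rightarrow> ennreal"
  assumes f [measurable]: "f \<in> borel_measurable borel" and per: "periodic f"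
    and s: "\<bar>s\<bar> = (1::real)"
  shows "(\<integral>\<^sup>+x. f (h + s *\<^sub>R x) \<partial>torus) = (\<integral>\<^sup>+x. f x \<partial>torus)"
proof -
  let ?H = "\<lambda>x. indicator halfcube x :: ennreal"
  have [measurable]: "(\<lambda>x. ?H (g x)) \<in> borel_measurable borel" if [measurable]: "g \<in> borel_measurable borel" for g :: "real^3 \<Rightarrow> real^3"
    by measurable
  have s2: "s * s = 1" using s by (metis abs_mult_self_eq mult_1)
  have cc: "countable (UNIV :: (int^3) set)" by (rule countableI_type)
  have "(\<integral>\<^sup>+x. f (h + s *\<^sub>R x) \<partial>torus) = (\<integral>\<^sup>+x. ?H x * f (h + s *\<^sub>R x) \<partial>lborel)"
    by (rule nn_integral_torus_halfcube)
  also have "\<dots> = (\<integral>\<^sup>+x. (\<lambda>y. ?H (s *\<^sub>R (y - h)) * f y) (h + s *\<^sub>R x) \<partial>lborel)"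
    by (simp add: s2)
  also have "\<dots> = (\<integral>\<^sup>+y. ?H (s *\<^sub>R (y - h)) * f y \<partial>lborel)"
    by (rule nn_integral_lborel_isometry) (use s in auto)
  also have "\<dots> = (\<integral>\<^sup>+y. (\<integral>\<^sup>+z. ?H (y + (-1) *\<^sub>R intvec z) \<partial>count_space UNIV) * (?H (s *\<^sub>R (y - h)) * f y) \<partial>lborel)"
    by (subst halfcube_tiling) auto
  also have "\<dots> = (\<integral>\<^sup>+y. (\<integral>\<^sup>+z. ?H (y - intvec z) * (?H (s *\<^sub>R (y - h)) * f y) \<partial>count_space UNIV) \<partial>lborel)"
    by (subst nn_integral_multc[symmetric]) auto
  also have "\<dots> = (\<integral>\<^sup>+z. (\<integral>\<^sup>+y. ?H (y - intvec z) * (?H (s *\<^sub>R (y - h)) * f y) \<partial>lborel) \<partial>count_space UNIV)"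
    by (rule nn_integral_count_space_nn_integral[OF cc]) measurable
  also have "\<dots> = (\<integral>\<^sup>+z. (\<integral>\<^sup>+y. ?H y * (?H (s *\<^sub>R (y - h) + s *\<^sub>R intvec z) * f y) \<partial>lborel) \<partial>count_space UNIV)"
  proof (rule nn_integral_cong)
    fix z
    have "(\<integral>\<^sup>+y. ?H (y - intvec z) * (?H (s *\<^sub>R (y - h)) * f y) \<partial>lborel)
        = (\<integral>\<^sup>+y. (\<lambda>y. ?H (y - intvec z) * (?H (s *\<^sub>R (y - h)) * f y)) (intvec z + 1 *\<^sub>R y) \<partial>lborel)"
      by (rule nn_integral_lborel_isometry[symmetric]) auto
    also have "\<dots> = (\<integral>\<^sup>+y. ?H y * (?H (s *\<^sub>R (y - h) + s *\<^sub>R intvec z) * f y) \<partial>lborel)"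
      using periodic_intvec[OF per, of _ z]
      by (intro nn_integral_cong) (simp add: algebra_simps)
    finally show "(\<integral>\<^sup>+y. ?H (y - intvec z) * (?H (s *\<^sub>R (y - h)) * f y) \<partial>lborel) = \<dots>" .
  qed
  also have "\<dots> = (\<integral>\<^sup>+y. (\<integral>\<^sup>+z. ?H y * (?H (s *\<^sub>R (y - h) + s *\<^sub>R intvec z) * f y) \<partial>count_space UNIV) \<partial>lborel)"
    by (rule nn_integral_count_space_nn_integral[OF cc, symmetric]) measurable
  also have "\<dots> = (\<integral>\<^sup>+y. ?H y * ((\<integral>\<^sup>+z. ?H (s *\<^sub>R (y - h) + s *\<^sub>R intvec z) \<partial>count_space UNIV) * f y) \<partial>lborel)"
    by (simp add: nn_integral_cmult nn_integral_multc)
  also have "\<dots> = (\<integral>\<^sup>+y. ?H y * f y \<partial>lborel)"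
    by (simp add: halfcube_tiling[OF s])
  also have "\<dots> = (\<integral>\<^sup>+x. f x \<partial>torus)"
    by (rule nn_integral_torus_halfcube[symmetric])
  finally show ?thesis .
qed

lemma periodicI_comp: "periodic f \<Longrightarrow> periodic (\<lambda>x. g (f x))"
  by (auto simp: periodic_def)

text \<open>The Bochner integral and integrability are determined by the nonnegative integrals of \<open>f\<close>,
  \<open>- f\<close> and \<open>\<bar>f\<bar>\<close>.\<close>

lemma integral_torus_isometry:
  fixes f :: "real^3 \<Rightarrow> real"
  assumes f [measurable]: "f \<in> borel_measurable borel" and per: "periodic f"
    and s: "\<bar>s\<bar> = (1::real)"
  shows "integrable torus (\<lambda>x. f (h + s *\<^sub>R x)) \<longleftrightarrow> integrable torus f" (is "?A \<longleftrightarrow> ?B")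
    and "(\<integral>x. f (h + s *\<^sub>R x) \<partial>torus) = (\<integral>x. f x \<partial>torus)"
proof -
  have nn: "(\<integral>\<^sup>+x. ennreal (g (f (h + s *\<^sub>R x))) \<partial>torus) = (\<integral>\<^sup>+x. ennreal (g (f x)) \<partial>torus)"
    if [measurable]: "g \<in> borel_measurable borel" for g :: "real \<Rightarrow> real"
    using nn_integral_torus_isometry[OF _ periodicI_comp[OF per, of "\<lambda>y. ennreal (g y)"] s, of h] by simp
  show AB: "?A \<longleftrightarrow> ?B"
    using nn[of norm] by (simp add: integrable_iff_bounded)
  show "(\<integral>x. f (h + s *\<^sub>R x) \<partial>torus) = (\<integral>x. f x \<partial>torus)"
  proof (cases ?B)
    case True
    then show ?thesis
      using AB nn[of "\<lambda>x. x"] nn[of uminus] by (simp add: real_lebesgue_integral_def)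
  next
    case False
    then show ?thesis using AB by (simp add: not_integrable_integral_eq)
  qed
qed

lemma nn_integral_torus_conv:
  fixes f :: "real^3 \<Rightarrow> ennreal"
  assumes "f \<in> borel_measurable borel" "periodic f"
  shows "(\<integral>\<^sup>+y. f (x - y) \<partial>torus) = (\<integral>\<^sup>+x. f x \<partial>torus)"
  using nn_integral_torus_isometry[OF assms, of "-1" x] by simp

section \<open>Trigonometric waves\<close>

text \<open>Phase \<open>0\<close> gives the cosine and phase \<open>- pi / 2\<close> the sine of a frequency. With arbitrary phases,
  derivatives and products of waves are again waves up to constants and sums.\<close>

definition wave :: "(int^3) \<times> real \<Rightarrow> real^3 \<Rightarrow> real" where
  "wave m x = cos (2 * pi * (intvec (fst m) \<bullet> x) + snd m)"

definition grad_wave :: "(int^3) \<times> real \<Rightarrow> real^3 \<Rightarrow> real^3" where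
  "grad_wave m x = (- 2 * pi * sin (2 * pi * (intvec (fst m) \<bullet> x) + snd m)) *\<^sub>R intvec (fst m)"

lemma continuous_wave [continuous_intros]: "continuous_on S (wave m)"
  unfolding wave_def by (intro continuous_intros)

lemma continuous_grad_wave [continuous_intros]: "continuous_on S (grad_wave m)"
  unfolding grad_wave_def by (intro continuous_intros)

lemma wave_borel [measurable]: "wave m \<in> borel_measurable borel"
  by (intro borel_measurable_continuous_onI continuous_wave)

lemma grad_wave_borel [measurable]: "grad_wave m \<in> borel_measurable borel"
  by (intro borel_measurable_continuous_onI continuous_grad_wave)

lemma wave_le_1: "\<bar>wave m x\<bar> \<le> 1"
  by (simp add: wave_def)

lemma norm_grad_wave_le: "norm (grad_wave m x) \<le> 2 * pi * norm (intvec (fst m))"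
  by (simp add: grad_wave_def abs_mult mult_left_le_one_le mult_right_mono)

lemma cos_add_2pi_int: "cos (2 * pi * of_int n + x) = cos x" "sin (2 * pi * of_int n + x) = sin x"
  by (simp_all add: cos_add sin_add)

lemma wave_axis_shift: "2 * pi * (intvec k \<bullet> (x + axis i 1)) + a = 2 * pi * of_int (k $ i) + (2 * pi * (intvec k \<bullet> x) + a)"
  by (simp add: inner_axis inner_right_distrib algebra_simps)

lemma periodic_wave: "periodic (wave m)"
  unfolding periodic_def wave_def wave_axis_shift cos_add_2pi_int by simp

lemma periodic_grad_wave: "periodic (grad_wave m)"
  unfolding periodic_def grad_wave_def wave_axis_shift cos_add_2pi_int by simp

lemma wave_has_derivative: "(wave m has_derivative (\<lambda>h. grad_wave m x \<bullet> h)) (at x within S)"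
  unfolding wave_def grad_wave_def
  by (auto intro!: derivative_eq_intros)

lemma wave_mult:
  "wave (k, a) x * wave (l, b) x = (wave (k + l, a + b) x + wave (k - l, a - b) x) / 2"
proof -
  have 1: "intvec (k + l) = intvec k + intvec l" "intvec (k - l) = intvec k - intvec l"
    by (simp_all add: vec_eq_iff)
  show ?thesis
    by (simp add: wave_def 1 cos_times_cos inner_add_left inner_diff_left algebra_simps)
qed

text \<open>The addition theorem separates the variables. It is the reason why convolution with a
  cosine polynomial has finite rank.\<close>

lemma wave_diff:
  "wave (k, 0) (x - y) = (\<Sum>a\<in>{0, - pi / 2}. wave (k, a) x * wave (k, a) y)"
  by (simp add: wave_def inner_diff_right right_diff_distrib cos_diff cos_add sin_add)

section \<open>A smoothing kernel made of finitely many waves\<close>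

definition cospoly :: "(real^3 \<Rightarrow> real) \<Rightarrow> bool" where
  "cospoly f \<longleftrightarrow> (\<exists>S c. finite S \<and> f = (\<lambda>x. \<Sum>k\<in>S. c k * wave (k, 0) x))"

lemma cospoly_wave: "cospoly (wave (k, 0))"
  unfolding cospoly_def by (rule exI[of _ "{k}"], rule exI[of _ "\<lambda>_. 1"]) simp

lemma cospoly_scale:
  assumes "cospoly f" shows "cospoly (\<lambda>x. r * f x)"
proof -
  obtain S c where "finite S" "f = (\<lambda>x. \<Sum>k\<in>S. c k * wave (k, 0) x)"
    using assms unfolding cospoly_def by blast
  then show ?thesis
    unfolding cospoly_def
    by (intro exI[of _ S] exI[of _ "\<lambda>k. r * c k"]) (simp add: sum_distrib_left mult.assoc)
qed

lemma cospoly_add: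
  assumes "cospoly f" "cospoly g" shows "cospoly (\<lambda>x. f x + g x)"
proof -
  obtain S c where S: "finite S" "f = (\<lambda>x. \<Sum>k\<in>S. c k * wave (k, 0) x)"
    using assms unfolding cospoly_def by blast
  obtain R d where R: "finite R" "g = (\<lambda>x. \<Sum>k\<in>R. d k * wave (k, 0) x)"
    using assms unfolding cospoly_def by blast
  let ?c = "\<lambda>k. (if k \<in> S then c k else 0) + (if k \<in> R then d k else 0)"
  have "f x + g x = (\<Sum>k\<in>S \<union> R. ?c k * wave (k, 0) x)" for x
  proof -
    have "f x = (\<Sum>k\<in>S \<union> R. (if k \<in> S then c k else 0) * wave (k, 0) x)"
      unfolding S(2) by (rule sum.mono_neutral_cong_left) (use S R in auto)
    moreover have "g x = (\<Sum>k\<in>S \<union> R. (if k \<in> R then d k else 0) * wave (k, 0) x)"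
      unfolding R(2) by (rule sum.mono_neutral_cong_left) (use S R in auto)
    ultimately show ?thesis by (simp add: sum.distrib distrib_right)
  qed
  then show ?thesis unfolding cospoly_def
    by (intro exI[of _ "S \<union> R"] exI[of _ ?c]) (use S R in auto)
qed

lemma cospoly_sum: "finite A \<Longrightarrow> A \<noteq> {} \<Longrightarrow> (\<And>i. i \<in> A \<Longrightarrow> cospoly (f i)) \<Longrightarrow> cospoly (\<lambda>x. \<Sum>i\<in>A. f i x)"
  by (induction A rule: finite_ne_induct) (auto intro: cospoly_add)

lemma cospoly_mult_wave:
  assumes "cospoly f" shows "cospoly (\<lambda>x. wave (l, 0) x * f x)"
proof (cases "f = (\<lambda>x. 0)")
  case True
  then show ?thesis unfolding cospoly_def by (intro exI[of _ "{}"]) auto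
next
  case False
  obtain S c where S: "finite S" "f = (\<lambda>x. \<Sum>k\<in>S. c k * wave (k, 0) x)"
    using assms unfolding cospoly_def by blast
  with False have "S \<noteq> {}" by auto
  have "wave (l, 0) x * f x = (\<Sum>k\<in>S. (c k / 2) * (wave (l + k, 0) x + wave (l - k, 0) x))" for x
  proof -
    have "wave (l, 0) x * f x = (\<Sum>k\<in>S. c k * (wave (l, 0) x * wave (k, 0) x))"
      by (simp add: S sum_distrib_left mult.left_commute)
    then show ?thesis by (simp add: wave_mult)
  qed
  moreover have "cospoly (\<lambda>x. (\<Sum>k\<in>S. (c k / 2) * (wave (l + k, 0) x + wave (l - k, 0) x)))"
    using S \<open>S \<noteq> {}\<close> by (intro cospoly_sum cospoly_scale cospoly_add cospoly_wave)
  ultimately show ?thesis by simp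
qed

text \<open>Bounded by \<open>1\<close>, and equal to \<open>1\<close> only on the integer lattice: the normalised powers form a
  nonnegative approximate identity of trigonometric polynomials.\<close>

definition peak :: "real^3 \<Rightarrow> real" where
  "peak h = (\<Sum>i\<in>UNIV. 1 + cos (2 * pi * h $ i)) / 6"

definition cos_kernel :: "nat \<Rightarrow> real^3 \<Rightarrow> real" where
  "cos_kernel N h = peak h ^ N / (\<integral>x. peak x ^ N \<partial>torus)"

lemma peak_wave: "peak x = 1/2 * wave (0, 0) x + (\<Sum>i\<in>UNIV. 1/6 * wave (axis i 1, 0) x)"
proof -
  have "intvec (axis i 1) = axis i 1" for i by (simp add: vec_eq_iff axis_def)
  moreover have "intvec 0 = 0" by (simp add: vec_eq_iff)
  ultimately show ?thesis
    by (simp add: peak_def wave_def inner_axis' sum_3 field_simps)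
qed

lemma cospoly_peak_power: "cospoly (\<lambda>x. peak x ^ N)"
proof (induction N)
  case 0
  have "(\<lambda>x. peak x ^ 0) = wave (0, 0)" 
    by (auto simp: wave_def intvec_def fun_eq_iff zero_vec_def[symmetric])
  then show ?case by (simp add: cospoly_wave)
next
  case (Suc N)
  have eq: "(\<lambda>x. peak x ^ Suc N) = (\<lambda>x. 1/2 * (wave (0, 0) x * peak x ^ N)
      + (\<Sum>i\<in>UNIV. 1/6 * (wave (axis i 1, 0) x * peak x ^ N)))"
    unfolding power_Suc by (subst peak_wave) (simp add: distrib_right sum_distrib_right fun_eq_iff)
  show ?case
    unfolding eq by (intro cospoly_add cospoly_scale cospoly_sum cospoly_mult_wave Suc) auto
qed

lemma continuous_peak [continuous_intros]: "continuous_on S peak"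
  unfolding peak_def by (intro continuous_intros) auto

lemma peak_borel [measurable]: "peak \<in> borel_measurable borel"
  by (intro borel_measurable_continuous_onI continuous_peak)

lemma peak_bounds: "0 \<le> peak h" "peak h \<le> 1"
proof -
  have "0 \<le> 1 + cos (2 * pi * h $ i)" for i using cos_ge_minus_one[of "2 * pi * h $ i"] by linarith
  then show "0 \<le> peak h" by (simp add: peak_def sum_nonneg)
  have "(\<Sum>i\<in>UNIV. 1 + cos (2 * pi * h $ i)) \<le> (\<Sum>i\<in>(UNIV::3 set). 2)"
    by (intro sum_mono) (use cos_le_one in auto)
  then show "peak h \<le> 1" by (simp add: peak_def)
qed

lemma peak_eq_1D:
  assumes "peak h = 1"
  shows "\<exists>z. h = intvec z"
proof -
  have "(\<Sum>i\<in>UNIV. 1 - cos (2 * pi * h $ i)) = 0"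
    using assms by (simp add: peak_def sum.distrib sum_subtractf)
  then have "\<forall>i. cos (2 * pi * h $ i) = 1"
    by (subst (asm) sum_nonneg_eq_0_iff) auto
  then have "\<forall>i. \<exists>n::int. h $ i = of_int n"
    by (auto simp: cos_one_2pi_int)
  then obtain z where "\<forall>i. h $ i = of_int (z i)" by metis
  then show ?thesis by (intro exI[of _ "\<chi> i. z i"]) (simp add: vec_eq_iff)
qed

lemma periodic_peak: "periodic peak"
proof -
  have "cos (2 * pi * (x $ j + axis i 1 $ j)) = cos (2 * pi * x $ j)" for x :: "real^3" and i j
    by (auto simp: axis_def distrib_left cos_add)
  then show ?thesis by (simp add: periodic_def peak_def)
qed

lemma integrable_torus_bounded:
  fixes f :: "real^3 \<Rightarrow> 'b::{banach, second_countable_topology}"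
  assumes [measurable]: "f \<in> borel_measurable borel" and "\<And>x. norm (f x) \<le> C"
  shows "integrable torus f"
  by (rule torus.integrable_const_bound[where B = C]) (use assms in auto)

lemma integrable_peak: "integrable torus (\<lambda>x. peak x ^ N)"
  by (rule integrable_torus_bounded[where C = 1]) (auto simp: peak_bounds power_le_one)

text \<open>The function exceeds \<open>q\<close> on a small box at the origin, which bounds the normalising constants
  from below.\<close>

lemma peak_superlevel:
  assumes "0 \<le> q" "q < 1"
  obtains m where "m > 0" "\<And>N. m * q ^ N \<le> (\<integral>x. peak x ^ N \<partial>torus)"
proof -
  have "isCont peak 0" using continuous_peak[of UNIV] by (simp add: continuous_on_eq_continuous_at)
  moreover have "peak 0 = 1" by (simp add: peak_def)
  ultimately have "\<forall>\<^sub>F x in nhds 0. q < peak x"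
    using assms(2) by (metis isContD order_tendstoD(1) tendsto_at_iff_tendsto_nhds)
  then obtain d where d: "d > 0" "\<And>x. dist x 0 < d \<Longrightarrow> q < peak x"
    by (auto simp: eventually_nhds_metric)
  define r where "r = min (1/2) (d / 4)"
  have r: "r > 0" "r \<le> 1/2" using d by (auto simp: r_def)
  define B where "B = cbox 0 (vec r :: real^3)"
  have "B \<subseteq> cube"
  proof
    fix x assume "x \<in> B"
    then have "0 \<le> x $ i \<and> x $ i \<le> r" for i by (simp add: B_def mem_box_cart)
    moreover have "r \<le> 1" using r by simp
    ultimately show "x \<in> cube" by (auto simp: mem_box_cart intro: order_trans)
  qed
  moreover have "B \<in> sets borel" by (simp add: B_def)
  ultimately have B: "B \<subseteq> cube" "B \<in> sets borel" by blast+
  have Bq: "q < peak x" if "x \<in> B" for x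
  proof -
    have "norm x \<le> (\<Sum>i\<in>UNIV. \<bar>x $ i\<bar>)" by (rule norm_le_l1_cart)
    also have "\<dots> \<le> (\<Sum>i\<in>(UNIV::3 set). r)"
      using that by (intro sum_mono) (auto simp: B_def mem_box_cart)
    also have "\<dots> = 3 * r" by simp
    also have "\<dots> < d" using d by (simp add: r_def)
    finally show ?thesis using d by simp
  qed
  have "measure torus B = measure lborel B"
    using B by (simp add: measure_restrict_space)
  also have "\<dots> > 0"
    using r by (auto simp: B_def content_pos_lt_eq Basis_vec_def inner_axis)
  finally have "measure torus B > 0" .
  moreover have "measure torus B * q ^ N \<le> (\<integral>x. peak x ^ N \<partial>torus)" for N
  proof -
    have "measure torus B * q ^ N = (\<integral>x. indicator B x * q ^ N \<partial>torus)"
      using B by (simp add: Int_absorb2)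
    also have "\<dots> \<le> (\<integral>x. peak x ^ N \<partial>torus)"
    proof (rule integral_mono)
      show "integrable torus (\<lambda>x. indicator B x * q ^ N)"
        using B assms by (intro integrable_torus_bounded[where C=1]) (auto simp: indicator_def power_le_one)
      show "indicator B x * q ^ N \<le> peak x ^ N" for x
        using Bq[of x] assms by (auto simp: indicator_def peak_bounds intro: power_mono)
    qed (rule integrable_peak)
    finally show ?thesis .
  qed
  ultimately show ?thesis using that by blast
qed

lemma integral_peak_pos: "(\<integral>x. peak x ^ N \<partial>torus) > 0"
proof -
  obtain m :: real where m: "m > 0" "\<And>N. m * (1/2) ^ N \<le> (\<integral>x. peak x ^ N \<partial>torus)"
    by (rule peak_superlevel[of "1/2"]) auto
  have "0 < m * (1/2) ^ N" using m(1) by simp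
  also have "\<dots> \<le> (\<integral>x. peak x ^ N \<partial>torus)" by (rule m(2))
  finally show ?thesis .
qed

lemma kernel_nonneg: "0 \<le> cos_kernel N h"
  using integral_peak_pos[of N] by (simp add: cos_kernel_def peak_bounds)

lemma continuous_kernel [continuous_intros]: "continuous_on S (cos_kernel N)"
  unfolding cos_kernel_def using integral_peak_pos[of N] by (intro continuous_intros) auto

lemma kernel_borel [measurable]: "cos_kernel N \<in> borel_measurable borel"
  by (intro borel_measurable_continuous_onI continuous_kernel)

lemma periodic_kernel: "periodic (cos_kernel N)"
  unfolding cos_kernel_def by (rule periodicI_comp[OF periodic_peak])

lemma kernel_bounded: "cos_kernel N h \<le> 1 / (\<integral>x. peak x ^ N \<partial>torus)"
  using integral_peak_pos[of N] by (simp add: cos_kernel_def divide_right_mono peak_bounds power_le_one)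

lemma integrable_kernel: "integrable torus (cos_kernel N)"
  using kernel_bounded kernel_nonneg
  by (intro integrable_torus_bounded[where C = "1 / (\<integral>x. peak x ^ N \<partial>torus)"]) auto

lemma integral_kernel: "(\<integral>x. cos_kernel N x \<partial>torus) = 1"
  using integral_peak_pos[of N] by (simp add: cos_kernel_def)

lemma kernel_minus: "cos_kernel N (x - y) = cos_kernel N (y - x)"
proof -
  have "cos (2 * pi * (y - x) $ i) = cos (2 * pi * (x - y) $ i)" for i
    by (subst cos_minus[symmetric]) (simp add: algebra_simps)
  then show ?thesis by (simp add: cos_kernel_def peak_def)
qed

lemma kernel_expansion:
  "\<exists>M c. finite M \<and> M \<subseteq> UNIV \<times> {0, - pi / 2} \<and>
     (\<forall>x y. cos_kernel N (x - y) = (\<Sum>m\<in>M. c m * wave m x * wave m y))"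
proof -
  have "cospoly (\<lambda>x. 1 / (\<integral>x. peak x ^ N \<partial>torus) * peak x ^ N)"
    by (intro cospoly_scale cospoly_peak_power)
  then obtain S c where S: "finite S" "cos_kernel N = (\<lambda>x. \<Sum>k\<in>S. c k * wave (k, 0) x)"
    by (auto simp: cospoly_def cos_kernel_def[abs_def])
  have "cos_kernel N (x - y) = (\<Sum>m\<in>S \<times> {0, - pi / 2}. c (fst m) * wave m x * wave m y)" for x y
    unfolding S(2) wave_diff sum_distrib_left sum.cartesian_product
    by (intro sum.cong) (auto simp: mult.assoc)
  then show ?thesis
    using S by (intro exI[of _ "S \<times> {0, - pi / 2}"] exI[of _ "\<lambda>m. c (fst m)"]) auto
qed

text \<open>Away from the lattice the function \<open>peak\<close> is at most some \<open>q < 1\<close>, while the normalising constant is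
  at least a multiple of \<open>q' ^ N\<close> for a number \<open>q'\<close> between \<open>q\<close> and \<open>1\<close>. So the kernel tends to zero
  uniformly away from the lattice, and near the lattice \<open>w\<close> is small by periodicity.\<close>

lemma kernel_concentrates:
  fixes w :: "real^3 \<Rightarrow> real"
  assumes [measurable]: "w \<in> borel_measurable borel" and per: "periodic w"
    and bd: "\<And>h. 0 \<le> w h" "\<And>h. w h \<le> C"
    and lim: "(w \<longlongrightarrow> 0) (nhds 0)"
  shows "(\<lambda>N. \<integral>h. cos_kernel N h * w h \<partial>torus) \<longlonglongrightarrow> 0"
proof (rule LIMSEQ_I)
  fix r :: real assume r: "r > 0"
  have C: "C \<ge> 0" using bd[of 0] by linarith
  have "\<forall>\<^sub>F h in nhds 0. w h < r / 2"
    using lim r by (intro order_tendstoD) auto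
  then obtain d where d: "d > 0" "\<And>h. dist h 0 < d \<Longrightarrow> w h < r / 2"
    by (auto simp: eventually_nhds_metric)
  define U where "U = (\<Union>z. ball (intvec z) d)"
  have wU: "w h < r / 2" if hU: "h \<in> U" for h
  proof -
    obtain z where "h \<in> ball (intvec z) d" using hU unfolding U_def by blast
    then have "dist (intvec z) h < d" by simp
    then have "w (h - intvec z) < r / 2" by (intro d) (simp add: dist_norm norm_minus_commute)
    then show ?thesis using periodic_intvec[OF per, of "h - intvec z" z] by simp
  qed
  define X where "X = cube - U"
  have "open U" by (auto simp: U_def)
  then have "compact X" by (simp add: X_def compact_diff)
  have X1: "peak h < 1" if "h \<in> X" for h
  proof -
    have "peak h \<noteq> 1"
    proof
      assume "peak h = 1"
      then obtain z where "h = intvec z" using peak_eq_1D by blast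
      then have "h \<in> U" using d unfolding U_def by (auto intro!: exI[of _ z])
      then show False using that by (simp add: X_def)
    qed
    then show ?thesis using peak_bounds(2)[of h] by linarith
  qed
  obtain q where q: "0 \<le> q" "q < 1" "\<And>h. h \<in> X \<Longrightarrow> peak h \<le> q"
  proof (cases "X = {}")
    case True then show ?thesis using that[of 0] by auto
  next
    case False
    then obtain x where "x \<in> X" "\<forall>y\<in>X. peak y \<le> peak x"
      using continuous_attains_sup[OF \<open>compact X\<close> False continuous_peak] by blast
    then show ?thesis using that[of "peak x"] X1 peak_bounds by auto
  qed
  \<comment> \<open>Any number strictly between \<open>q\<close> and \<open>1\<close> would do.\<close>
  define q' where "q' = (1 + q) / 2"
  have q': "0 < q'" "q' < 1" "q < q'" using q by (auto simp: q'_def)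
  obtain m where m: "m > 0" "\<And>N. m * q' ^ N \<le> (\<integral>x. peak x ^ N \<partial>torus)"
    using peak_superlevel[OF less_imp_le[OF q'(1)] q'(2)] by blast
  have KX: "cos_kernel N h \<le> (q / q') ^ N / m" if "h \<in> X" for N h
  proof -
    have "cos_kernel N h \<le> q ^ N / (m * q' ^ N)"
      unfolding cos_kernel_def using q m q' that peak_bounds(1)[of h]
      by (intro frac_le power_mono) (auto intro: q)
    then show ?thesis by (simp add: power_divide mult.commute)
  qed
  have main: "(\<integral>h. cos_kernel N h * w h \<partial>torus) \<le> r / 2 + C * ((q / q') ^ N / m)" for N
  proof -
    have "(\<integral>h. cos_kernel N h * w h \<partial>torus) \<le> (\<integral>h. r / 2 * cos_kernel N h + C * ((q / q') ^ N / m) \<partial>torus)"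
    proof (rule integral_mono)
      have "norm (cos_kernel N h * w h) \<le> 1 / (\<integral>x. peak x ^ N \<partial>torus) * C" for h
        using kernel_bounded[of N h] kernel_nonneg[of N h] bd[of h] less_imp_le[OF integral_peak_pos[of N]]
        by (simp only: real_norm_def abs_mult abs_of_nonneg) (intro mult_mono, auto)
      then show "integrable torus (\<lambda>h. cos_kernel N h * w h)"
        by (intro integrable_torus_bounded) auto
      show "integrable torus (\<lambda>h. r / 2 * cos_kernel N h + C * ((q / q') ^ N / m))"
        using integrable_kernel[of N] by auto
      fix h assume "h \<in> space torus"
      then consider "h \<in> U" | "h \<in> X" by (auto simp: X_def)
      then show "cos_kernel N h * w h \<le> r / 2 * cos_kernel N h + C * ((q / q') ^ N / m)"
      proof cases
        case 1
        have "cos_kernel N h * w h \<le> cos_kernel N h * (r / 2)"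
          using wU[OF 1] kernel_nonneg by (intro mult_left_mono) auto
        moreover have "C * ((q / q') ^ N / m) \<ge> 0" using C q q' m by auto
        ultimately show ?thesis by (simp add: mult.commute)
      next
        case 2
        have "cos_kernel N h * w h \<le> ((q / q') ^ N / m) * C"
          using KX[OF 2] bd[of h] kernel_nonneg[of N h] q(1) q'(1) m(1) by (intro mult_mono) auto
        moreover have "r / 2 * cos_kernel N h \<ge> 0" using r kernel_nonneg by auto
        ultimately show ?thesis by (simp add: mult.commute)
      qed
    qed
    also have "\<dots> = r / 2 + C * ((q / q') ^ N / m)"
      using integrable_kernel[of N] by (simp add: integral_kernel)
    finally show ?thesis .
  qed
  have "(\<lambda>N. C * ((q / q') ^ N / m)) \<longlonglongrightarrow> C * (0 / m)"
    using q q' m by (intro tendsto_intros LIMSEQ_realpow_zero) auto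
  then have "\<forall>\<^sub>F N in sequentially. C * ((q / q') ^ N / m) < r / 2"
    using r by (intro order_tendstoD) auto
  then obtain N0 where N0: "\<And>N. N \<ge> N0 \<Longrightarrow> C * ((q / q') ^ N / m) < r / 2"
    by (auto simp: eventually_sequentially)
  show "\<exists>N0. \<forall>N\<ge>N0. norm ((\<integral>h. cos_kernel N h * w h \<partial>torus) - 0) < r"
  proof (intro exI[of _ N0] allI impI)
    fix N assume "N \<ge> N0"
    have "0 \<le> (\<integral>h. cos_kernel N h * w h \<partial>torus)"
      using kernel_nonneg bd by (intro integral_nonneg_AE AE_I2) auto
    then show "norm ((\<integral>h. cos_kernel N h * w h \<partial>torus) - 0) < r"
      using main[of N] N0[OF \<open>N \<ge> N0\<close>]
      by (simp only: real_norm_def diff_zero abs_of_nonneg)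
  qed
qed

section \<open>Square integrable functions on the torus\<close>

lemma Cauchy_Schwarz_integral:
  fixes f g :: "'a \<Rightarrow> real"
  assumes [measurable]: "f \<in> borel_measurable M" "g \<in> borel_measurable M"
    and f2: "integrable M (\<lambda>x. (f x)\<^sup>2)" and g2: "integrable M (\<lambda>x. (g x)\<^sup>2)"
  shows "integrable M (\<lambda>x. f x * g x)"
    and "(\<integral>x. \<bar>f x * g x\<bar> \<partial>M) \<le> sqrt (\<integral>x. (f x)\<^sup>2 \<partial>M) * sqrt (\<integral>x. (g x)\<^sup>2 \<partial>M)"
proof -
  show int: "integrable M (\<lambda>x. f x * g x)"
  proof (rule Bochner_Integration.integrable_bound)
    show "integrable M (\<lambda>x. (f x)\<^sup>2 + (g x)\<^sup>2)" using f2 g2 by simp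
    have "\<bar>a * b\<bar> \<le> a\<^sup>2 + b\<^sup>2" for a b :: real
    proof -
      have "2 * \<bar>a * b\<bar> \<le> a\<^sup>2 + b\<^sup>2"
        using sum_squares_bound[of "\<bar>a\<bar>" "\<bar>b\<bar>"] by (simp add: abs_mult)
      then show ?thesis using abs_ge_zero[of "a * b"] by linarith
    qed
    then show "AE x in M. norm (f x * g x) \<le> norm ((f x)\<^sup>2 + (g x)\<^sup>2)"
      by (intro AE_I2) (metis abs_of_nonneg real_norm_def sum_power2_ge_zero)
  qed simp
  have sq: "ennreal \<bar>a\<bar> ^ 2 = ennreal (a\<^sup>2)" for a :: real
    by (simp add: ennreal_power)
  have "(\<integral>\<^sup>+x. ennreal \<bar>f x\<bar> * ennreal \<bar>g x\<bar> \<partial>M)\<^sup>2 \<le> (\<integral>\<^sup>+x. ennreal \<bar>f x\<bar> ^ 2 \<partial>M) * (\<integral>\<^sup>+x. ennreal \<bar>g x\<bar> ^ 2 \<partial>M)"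
    by (rule Cauchy_Schwarz_nn_integral) auto
  also have "(\<integral>\<^sup>+x. ennreal \<bar>f x\<bar> * ennreal \<bar>g x\<bar> \<partial>M) = ennreal (\<integral>x. \<bar>f x * g x\<bar> \<partial>M)"
    using integrable_abs[OF int] by (simp add: nn_integral_eq_integral abs_mult flip: ennreal_mult)
  finally have "ennreal ((\<integral>x. \<bar>f x * g x\<bar> \<partial>M)\<^sup>2) \<le> ennreal ((\<integral>x. (f x)\<^sup>2 \<partial>M) * (\<integral>x. (g x)\<^sup>2 \<partial>M))"
    by (simp add: sq nn_integral_eq_integral f2 g2 ennreal_power ennreal_mult)
  then have "(\<integral>x. \<bar>f x * g x\<bar> \<partial>M)\<^sup>2 \<le> (\<integral>x. (f x)\<^sup>2 \<partial>M) * (\<integral>x. (g x)\<^sup>2 \<partial>M)"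
    by (subst (asm) ennreal_le_iff) auto
  then have "(\<integral>x. \<bar>f x * g x\<bar> \<partial>M) \<le> sqrt ((\<integral>x. (f x)\<^sup>2 \<partial>M) * (\<integral>x. (g x)\<^sup>2 \<partial>M))"
    by (rule real_le_rsqrt)
  then show "(\<integral>x. \<bar>f x * g x\<bar> \<partial>M) \<le> sqrt (\<integral>x. (f x)\<^sup>2 \<partial>M) * sqrt (\<integral>x. (g x)\<^sup>2 \<partial>M)"
    by (simp add: real_sqrt_mult)
qed

lemma L2_torus_iff:
  "L2_torus f \<longleftrightarrow> periodic f \<and> f \<in> borel_measurable borel \<and> integrable torus (\<lambda>x. (norm (f x))\<^sup>2)"
  by (simp add: L2_torus_def set_integrable_torus)

lemma L2_norm_torus: "L2_norm f = sqrt (\<integral>x. (norm (f x))\<^sup>2 \<partial>torus)"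
  by (simp add: L2_norm_def set_lint_torus)

lemma L2_norm_nonneg: "0 \<le> L2_norm f"
  by (simp add: L2_norm_torus)

lemma L2_norm_sq: "(L2_norm f)\<^sup>2 = (\<integral>x. (norm (f x))\<^sup>2 \<partial>torus)"
  by (simp add: L2_norm_torus)

lemma L2_torus_product:
  fixes f :: "real^3 \<Rightarrow> 'b::euclidean_space" and g :: "real^3 \<Rightarrow> 'c::euclidean_space"
  assumes f: "L2_torus f" and g: "L2_torus g"
  shows "integrable torus (\<lambda>x. norm (f x) * norm (g x))"
    and "(\<integral>x. norm (f x) * norm (g x) \<partial>torus) \<le> L2_norm f * L2_norm g"
proof -
  have [measurable]: "f \<in> borel_measurable borel" "g \<in> borel_measurable borel"
    using f g by (auto simp: L2_torus_iff)
  note CS = Cauchy_Schwarz_integral[of "\<lambda>x. norm (f x)" torus "\<lambda>x. norm (g x)"]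
  show "integrable torus (\<lambda>x. norm (f x) * norm (g x))"
    using f g by (intro CS) (auto simp: L2_torus_iff)
  have "(\<integral>x. \<bar>norm (f x) * norm (g x)\<bar> \<partial>torus) \<le> L2_norm f * L2_norm g"
    unfolding L2_norm_torus using f g by (intro CS) (auto simp: L2_torus_iff)
  then show "(\<integral>x. norm (f x) * norm (g x) \<partial>torus) \<le> L2_norm f * L2_norm g"
    by simp
qed

lemma L2_torus_bounded_mult:
  fixes f :: "real^3 \<Rightarrow> 'b::euclidean_space" and \<phi> :: "real^3 \<Rightarrow> 'c::euclidean_space"
  assumes f: "L2_torus f" and "g \<in> borel_measurable borel" "\<And>x. norm (g x) \<le> C * norm (f x)" "periodic g"
  shows "L2_torus (g :: real^3 \<Rightarrow> 'c::euclidean_space)"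
proof -
  have [measurable]: "f \<in> borel_measurable borel" "g \<in> borel_measurable borel"
    using assms by (auto simp: L2_torus_iff)
  have "integrable torus (\<lambda>x. (norm (g x))\<^sup>2)"
  proof (rule Bochner_Integration.integrable_bound)
    show "integrable torus (\<lambda>x. C\<^sup>2 * (norm (f x))\<^sup>2)" using f by (simp add: L2_torus_iff)
    have "(norm (g x))\<^sup>2 \<le> C\<^sup>2 * (norm (f x))\<^sup>2" for x
      using power_mono[OF assms(3)[of x], of 2] by (simp add: power_mult_distrib)
    then show "AE x in torus. norm ((norm (g x))\<^sup>2) \<le> norm (C\<^sup>2 * (norm (f x))\<^sup>2)"
      by (intro AE_I2) simp
  qed simp
  then show ?thesis using assms by (simp add: L2_torus_iff)
qed

lemma norm_sq_add_le: "(norm (a + b))\<^sup>2 \<le> 2 * (norm a)\<^sup>2 + 2 * (norm b)\<^sup>2"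
  for a b :: "'b::real_normed_vector"
proof -
  have "(norm (a + b))\<^sup>2 \<le> (norm a + norm b)\<^sup>2"
    by (intro power_mono norm_triangle_ineq) auto
  also have "\<dots> \<le> 2 * (norm a)\<^sup>2 + 2 * (norm b)\<^sup>2"
    using sum_squares_bound[of "norm a" "norm b"] by (simp add: power2_sum)
  finally show ?thesis .
qed

lemma norm_sq_diff_le: "(norm (a - b))\<^sup>2 \<le> 2 * (norm a)\<^sup>2 + 2 * (norm b)\<^sup>2"
  for a b :: "'b::real_normed_vector"
  using norm_sq_add_le[of a "- b"] by simp

lemma L2_torus_add:
  fixes f g :: "real^3 \<Rightarrow> 'b::euclidean_space"
  assumes "L2_torus f" "L2_torus g"
  shows "L2_torus (\<lambda>x. f x + g x)"
proof -
  have [measurable]: "f \<in> borel_measurable borel" "g \<in> borel_measurable borel"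
    using assms by (auto simp: L2_torus_iff)
  have "integrable torus (\<lambda>x. (norm (f x + g x))\<^sup>2)"
  proof (rule Bochner_Integration.integrable_bound)
    show "integrable torus (\<lambda>x. 2 * (norm (f x))\<^sup>2 + 2 * (norm (g x))\<^sup>2)"
      using assms by (simp add: L2_torus_iff)
    show "AE x in torus. norm ((norm (f x + g x))\<^sup>2) \<le> norm (2 * (norm (f x))\<^sup>2 + 2 * (norm (g x))\<^sup>2)"
      using norm_sq_add_le[of "f _" "g _"] by (intro AE_I2) simp
  qed simp
  then show ?thesis using assms by (auto simp: L2_torus_iff periodic_def)
qed

lemma L2_torus_const: "L2_torus (\<lambda>x. c)"
  by (simp add: L2_torus_iff periodic_def)

lemma L2_torus_bounded:
  assumes "g \<in> borel_measurable borel" "\<And>x. norm (g x) \<le> C" "periodic g"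
  shows "L2_torus g"
  using L2_torus_bounded_mult[OF L2_torus_const[of "1::real"], of g C] assms by simp

lemma L2_torus_integrable:
  assumes "L2_torus f" shows "integrable torus f"
proof -
  have [measurable]: "f \<in> borel_measurable borel" using assms by (auto simp: L2_torus_iff)
  have "integrable torus (\<lambda>x. norm (f x) * norm (1::real))"
    by (rule L2_torus_product[OF assms L2_torus_const])
  then show ?thesis by (subst integrable_norm_iff[symmetric]) auto
qed

lemma L2_torus_inner:
  fixes f g :: "real^3 \<Rightarrow> 'b::euclidean_space"
  assumes "L2_torus f" "L2_torus g"
  shows "integrable torus (\<lambda>x. f x \<bullet> g x)"
proof (rule Bochner_Integration.integrable_bound)
  have [measurable]: "f \<in> borel_measurable borel" "g \<in> borel_measurable borel"
    using assms by (auto simp: L2_torus_iff)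
  show "(\<lambda>x. f x \<bullet> g x) \<in> borel_measurable torus" by measurable
  show "AE x in torus. norm (f x \<bullet> g x) \<le> norm (norm (f x) * norm (g x))"
    by (intro AE_I2) (simp add: Cauchy_Schwarz_ineq2)
qed (rule L2_torus_product[OF assms])

lemma L2_torus_bounded_mult':
  fixes f :: "real^3 \<Rightarrow> 'b::euclidean_space" and g :: "real^3 \<Rightarrow> real"
  assumes "L2_torus f" "g \<in> borel_measurable borel" "\<And>x. \<bar>g x\<bar> \<le> C" "periodic g"
  shows "L2_torus (\<lambda>x. g x *\<^sub>R f x)"
proof (rule L2_torus_bounded_mult[OF assms(1)])
  have [measurable]: "f \<in> borel_measurable borel" "g \<in> borel_measurable borel"
    using assms by (auto simp: L2_torus_iff)
  show "(\<lambda>x. g x *\<^sub>R f x) \<in> borel_measurable borel" by measurable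
  show "norm (g x *\<^sub>R f x) \<le> C * norm (f x)" for x by (simp add: assms mult_right_mono)
  show "periodic (\<lambda>x. g x *\<^sub>R f x)" using assms by (auto simp: periodic_def L2_torus_iff)
qed

section \<open>Mean-square continuity of translations\<close>

lemma norm_sq_three:
  fixes a b c d :: "'b::real_normed_vector"
  shows "(norm (a - d))\<^sup>2 \<le> 3 * (norm (a - b))\<^sup>2 + 3 * (norm (b - c))\<^sup>2 + 3 * (norm (c - d))\<^sup>2"
proof -
  have "norm (a - d) \<le> norm (a - b) + norm (b - c) + norm (c - d)"
    using norm_triangle_ineq[of "a - b" "b - d"] norm_triangle_ineq[of "b - c" "c - d"] by simp
  then have "(norm (a - d))\<^sup>2 \<le> (norm (a - b) + norm (b - c) + norm (c - d))\<^sup>2"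
    by (intro power_mono) auto
  also have "\<dots> \<le> 3 * (norm (a - b))\<^sup>2 + 3 * (norm (b - c))\<^sup>2 + 3 * (norm (c - d))\<^sup>2"
    using sum_squares_bound[of "norm (a - b)" "norm (b - c)"] sum_squares_bound[of "norm (a - b)" "norm (c - d)"]
      sum_squares_bound[of "norm (b - c)" "norm (c - d)"]
    by (simp add: power2_eq_square algebra_simps)
  finally show ?thesis .
qed

text \<open>A measurable function is almost everywhere a limit of continuous ones. Projecting these onto
  the ball of radius \<open>C\<close> keeps them continuous, does not move the limit, and makes dominated
  convergence applicable on a box.\<close>

lemma bounded_measurable_approx:
  fixes f :: "real^3 \<Rightarrow> 'b::euclidean_space"
  assumes [measurable]: "f \<in> borel_measurable borel" and bd: "\<And>x. norm (f x) \<le> C"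
    and "e > 0"
  obtains g where "continuous_on UNIV g" "\<And>x. norm (g x) \<le> C"
    "(\<integral>x. indicator (cbox a b) x * (norm (f x - g x))\<^sup>2 \<partial>lborel) < e"
proof -
  have "C \<ge> 0" using bd[of 0] norm_ge_zero order_trans by blast
  have "f measurable_on UNIV"
    by (rule lebesgue_measurable_imp_measurable_on) (auto intro: measurable_completion)
  then obtain N g where N: "negligible N" and g: "\<And>n. continuous_on UNIV (g n)"
    and lim: "\<And>x. x \<notin> N \<Longrightarrow> (\<lambda>n. g n x) \<longlonglongrightarrow> f x"
    unfolding measurable_on_def by auto
  \<comment> \<open>The projection onto the ball is continuous and fixes the values of \<open>f\<close>.\<close>
  let ?P = "closest_point (cball (0::'b) C)"
  have cP: "continuous_on S ?P" for S
    using \<open>C \<ge> 0\<close> by (intro continuous_on_closest_point) auto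
  define G where "G n x = ?P (g n x)" for n x
  have cG: "continuous_on UNIV (G n)" for n
    unfolding G_def by (rule continuous_on_compose2[OF cP[of UNIV] g]) auto
  then have [measurable]: "G n \<in> borel_measurable borel" for n
    by (rule borel_measurable_continuous_onI)
  have GC: "norm (G n x) \<le> C" for n x
    using closest_point_in_set[of "cball 0 C" "g n x"] \<open>C \<ge> 0\<close> by (auto simp: G_def)
  have Pf: "?P (f x) = f x" for x
    by (rule closest_point_self) (use bd in simp)
  have limG: "(\<lambda>n. G n x) \<longlonglongrightarrow> f x" if "x \<notin> N" for x
  proof -
    have "(\<lambda>n. ?P (g n x)) \<longlonglongrightarrow> ?P (f x)"
      using cP[of UNIV] lim[OF that] by (intro isCont_tendsto_compose[of _ ?P]) (auto simp: continuous_on_eq_continuous_at)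
    then show ?thesis by (simp add: G_def Pf)
  qed
  have AEN: "AE x in lborel. x \<notin> N"
  proof -
    have "AE x in lebesgue. x \<notin> N"
      using N by (intro AE_I'[of N]) (auto simp: negligible_iff_null_sets)
    then show ?thesis by (simp add: AE_completion_iff)
  qed
  have "(\<lambda>n. \<integral>x. indicator (cbox a b) x * (norm (f x - G n x))\<^sup>2 \<partial>lborel) \<longlonglongrightarrow> integral\<^sup>L (lborel :: (real^3) measure) (\<lambda>x. 0)"
  proof (rule integral_dominated_convergence[where w = "\<lambda>x. indicator (cbox a b) x * (2 * C)\<^sup>2"])
    show "integrable lborel (\<lambda>x. indicator (cbox a b) x * (2 * C)\<^sup>2 :: real)"
      by (rule integrable_mult_left) (simp add: emeasure_lborel_cbox_eq)
    show "AE x in lborel. (\<lambda>n. indicator (cbox a b) x * (norm (f x - G n x))\<^sup>2) \<longlonglongrightarrow> 0"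
      using AEN
    proof eventually_elim
      fix x assume "x \<notin> N"
      then have "(\<lambda>n. indicator (cbox a b) x * (norm (f x - G n x))\<^sup>2) \<longlonglongrightarrow> indicator (cbox a b) x * (norm (f x - f x))\<^sup>2"
        by (intro tendsto_intros limG)
      then show "(\<lambda>n. indicator (cbox a b) x * (norm (f x - G n x))\<^sup>2) \<longlonglongrightarrow> (0::real)" by simp
    qed
    show "AE x in lborel. norm (indicator (cbox a b) x * (norm (f x - G n x))\<^sup>2) \<le> indicator (cbox a b) x * (2 * C)\<^sup>2" for n
    proof (rule AE_I2)
      fix x
      have "norm (f x - G n x) \<le> 2 * C"
        using norm_triangle_ineq4[of "f x" "G n x"] bd[of x] GC[of n x] by linarith
      then have "(norm (f x - G n x))\<^sup>2 \<le> (2 * C)\<^sup>2" by (intro power_mono) auto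
      then show "norm (indicator (cbox a b) x * (norm (f x - G n x))\<^sup>2) \<le> indicator (cbox a b) x * (2 * C)\<^sup>2"
        by (auto simp: indicator_def)
    qed
  qed auto
  then have "\<forall>\<^sub>F n in sequentially. (\<integral>x. indicator (cbox a b) x * (norm (f x - G n x))\<^sup>2 \<partial>lborel) < e"
    using \<open>e > 0\<close> by (intro order_tendstoD) auto
  then obtain n where "(\<integral>x. indicator (cbox a b) x * (norm (f x - G n x))\<^sup>2 \<partial>lborel) < e"
    by (auto simp: eventually_sequentially)
  then show ?thesis using that[of "G n"] cG GC by blast
qed

lemma integral_lborel_shift:
  fixes f :: "real^3 \<Rightarrow> real"
  assumes [measurable]: "f \<in> borel_measurable borel"
  shows "(\<integral>x. f (x - h) \<partial>lborel) = (\<integral>x. f x \<partial>lborel)"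
proof -
  have "(\<integral>x. f x \<partial>lborel) = (\<integral>x. f x \<partial>distr lborel borel ((+) (- h)))"
    by (simp add: lborel_distr_plus)
  also have "\<dots> = (\<integral>x. f (x - h) \<partial>lborel)"
    by (subst integral_distr) auto
  finally show ?thesis by simp
qed

definition shift_defect :: "(real^3 \<Rightarrow> 'b::euclidean_space) \<Rightarrow> real^3 \<Rightarrow> real" where
  "shift_defect f h = (\<integral>x. (norm (f (x - h) - f x))\<^sup>2 \<partial>torus)"

text \<open>The continuous approximation of \<open>f\<close> need not be periodic. It is therefore chosen on a box that
  contains all translates of the cube by vectors of norm at most \<open>1\<close>.\<close>

lemma shift_defect_bounded_tendsto:
  fixes f :: "real^3 \<Rightarrow> 'b::euclidean_space"
  assumes [measurable]: "f \<in> borel_measurable borel" and bd: "\<And>x. norm (f x) \<le> C"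
  shows "(shift_defect f \<longlongrightarrow> 0) (nhds 0)"
proof (rule tendstoI)
  fix r :: real assume r: "r > 0"
  let ?B = "cbox (vec (-1)) (vec 2) :: (real^3) set"
  obtain g where g: "continuous_on UNIV g" "\<And>x. norm (g x) \<le> C"
    and fg: "(\<integral>x. indicator ?B x * (norm (f x - g x))\<^sup>2 \<partial>lborel) < r / 9"
    using bounded_measurable_approx[of f C "r / 9" "vec (-1)" "vec 2"] bd r by auto
  have [measurable]: "g \<in> borel_measurable borel"
    using g by (intro borel_measurable_continuous_onI)
  have C0: "C \<ge> 0" using bd[of 0] norm_ge_zero order_trans by blast
  have diffC: "(norm (v - w))\<^sup>2 \<le> (2 * C)\<^sup>2" if "norm v \<le> C" "norm w \<le> C" for v w :: 'b
  proof -
    have "norm (v - w) \<le> 2 * C" using norm_triangle_ineq4[of v w] that by linarith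
    then show ?thesis by (intro power_mono) auto
  qed
  have "uniformly_continuous_on ?B g"
    using g by (intro compact_uniformly_continuous continuous_on_subset[OF g(1)]) auto
  then obtain d where d: "d > 0"
    "\<And>x y. x \<in> ?B \<Longrightarrow> y \<in> ?B \<Longrightarrow> dist x y < d \<Longrightarrow> dist (g x) (g y) < sqrt (r / 9)"
    using r unfolding uniformly_continuous_on_def by (metis real_sqrt_gt_0_iff divide_pos_pos zero_less_numeral)
  have intB: "integrable lborel (\<lambda>x. indicator ?B x * (norm (f x - g x))\<^sup>2)"
  proof (rule Bochner_Integration.integrable_bound)
    show "integrable lborel (\<lambda>x. indicator ?B x * (2 * C)\<^sup>2 :: real)"
      by (rule integrable_mult_left) (simp add: emeasure_lborel_cbox_eq)
    show "AE x in lborel. norm (indicator ?B x * (norm (f x - g x))\<^sup>2) \<le> norm (indicator ?B x * (2 * C)\<^sup>2 :: real)"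
      using diffC[OF bd g(2)] by (auto simp: indicator_def)
  qed simp
  have *: "shift_defect f h < r" if h: "norm h < min d 1" for h
  proof -
    have inB: "x \<in> ?B" "x - h \<in> ?B" if "x \<in> cube" for x
    proof -
      have "\<bar>h $ i\<bar> \<le> 1" for i using component_le_norm_cart[of h i] h by linarith
      moreover have "0 \<le> x $ i \<and> x $ i \<le> 1" for i using that by (simp add: mem_box_cart)
      ultimately have "-1 \<le> x $ i - h $ i \<and> x $ i - h $ i \<le> 2 \<and> -1 \<le> x $ i \<and> x $ i \<le> 2" for i
        by (smt (verit))
      then show "x \<in> ?B" "x - h \<in> ?B" by (auto simp: mem_box_cart)
    qed
    have t1: "(\<integral>x. (norm (f (x - h) - g (x - h)))\<^sup>2 \<partial>torus) < r / 9"
    proof -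
      have "(\<integral>x. (norm (f (x - h) - g (x - h)))\<^sup>2 \<partial>torus)
          = (\<integral>x. indicator cube x * (norm (f (x - h) - g (x - h)))\<^sup>2 \<partial>lborel)"
        by (simp add: integral_restrict_space)
      also have "\<dots> \<le> (\<integral>x. indicator ?B (x - h) * (norm (f (x - h) - g (x - h)))\<^sup>2 \<partial>lborel)"
      proof (rule integral_mono')
        show "integrable lborel (\<lambda>x. indicator ?B (x - h) * (norm (f (x - h) - g (x - h)))\<^sup>2)"
        proof -
          have "integrable (distr lborel borel ((+) (- h))) (\<lambda>x. indicator ?B x * (norm (f x - g x))\<^sup>2)"
            using intB by (simp add: lborel_distr_plus)
          then show ?thesis by (subst (asm) integrable_distr_eq) auto
        qed
      qed (use inB in \<open>auto simp: indicator_def\<close>)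
      also have "\<dots> = (\<integral>x. indicator ?B x * (norm (f x - g x))\<^sup>2 \<partial>lborel)"
        using integral_lborel_shift[of "\<lambda>x. indicator ?B x * (norm (f x - g x))\<^sup>2" h] by simp
      finally show ?thesis using fg by linarith
    qed
    have t3: "(\<integral>x. (norm (g x - f x))\<^sup>2 \<partial>torus) < r / 9"
    proof -
      have "(\<integral>x. (norm (g x - f x))\<^sup>2 \<partial>torus) = (\<integral>x. indicator cube x * (norm (f x - g x))\<^sup>2 \<partial>lborel)"
        by (simp add: integral_restrict_space norm_minus_commute)
      also have "\<dots> \<le> (\<integral>x. indicator ?B x * (norm (f x - g x))\<^sup>2 \<partial>lborel)"
        by (rule integral_mono'[OF intB]) (use inB in \<open>auto simp: indicator_def\<close>)
      finally show ?thesis using fg by linarith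
    qed
    have t2: "(\<integral>x. (norm (g (x - h) - g x))\<^sup>2 \<partial>torus) \<le> r / 9"
    proof -
      have "(\<integral>x. (norm (g (x - h) - g x))\<^sup>2 \<partial>torus) \<le> (\<integral>x. r / 9 \<partial>torus)"
      proof (rule integral_mono)
        fix x assume "x \<in> space torus"
        then have "dist (g (x - h)) (g x) < sqrt (r / 9)"
          using h inB by (intro d) (auto simp: dist_norm)
        then have "(norm (g (x - h) - g x))\<^sup>2 \<le> (sqrt (r / 9))\<^sup>2"
          by (intro power_mono) (auto simp: dist_norm)
        then show "(norm (g (x - h) - g x))\<^sup>2 \<le> r / 9" using r by simp
      next
        show "integrable torus (\<lambda>x. (norm (g (x - h) - g x))\<^sup>2)"
          by (rule integrable_torus_bounded[where C="(2*C)\<^sup>2"]) (use diffC[OF g(2) g(2)] in auto)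
      qed simp
      then show ?thesis by simp
    qed
    have "shift_defect f h \<le> (\<integral>x. 3 * (norm (f (x - h) - g (x - h)))\<^sup>2 + 3 * (norm (g (x - h) - g x))\<^sup>2
        + 3 * (norm (g x - f x))\<^sup>2 \<partial>torus)"
      unfolding shift_defect_def
    proof (rule integral_mono)
      show "integrable torus (\<lambda>x. (norm (f (x - h) - f x))\<^sup>2)"
        by (rule integrable_torus_bounded[where C="(2*C)\<^sup>2"]) (use diffC[OF bd bd] in auto)
      show "integrable torus (\<lambda>x. 3 * (norm (f (x - h) - g (x - h)))\<^sup>2 + 3 * (norm (g (x - h) - g x))\<^sup>2
        + 3 * (norm (g x - f x))\<^sup>2)"
        by (intro Bochner_Integration.integrable_add integrable_mult_right)
          (rule integrable_torus_bounded[where C="(2*C)\<^sup>2"]; use diffC[OF bd g(2)] diffC[OF g(2) bd] diffC[OF g(2) g(2)] in force)+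
    qed (rule norm_sq_three)
    also have "\<dots> = 3 * (\<integral>x. (norm (f (x - h) - g (x - h)))\<^sup>2 \<partial>torus) + 3 * (\<integral>x. (norm (g (x - h) - g x))\<^sup>2 \<partial>torus)
        + 3 * (\<integral>x. (norm (g x - f x))\<^sup>2 \<partial>torus)"
    proof -
      have "integrable torus (\<lambda>x. (norm (f (x - h) - g (x - h)))\<^sup>2)"
        "integrable torus (\<lambda>x. (norm (g (x - h) - g x))\<^sup>2)" "integrable torus (\<lambda>x. (norm (g x - f x))\<^sup>2)"
        by (rule integrable_torus_bounded[where C="(2*C)\<^sup>2"]; use diffC[OF bd g(2)] diffC[OF g(2) bd] diffC[OF g(2) g(2)] in force)+
      then show ?thesis by simp
    qed
    also have "\<dots> < r" using t1 t2 t3 by linarith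
    finally show ?thesis .
  qed
  have "\<forall>\<^sub>F h in nhds (0::real^3). norm h < min d 1"
    unfolding eventually_nhds_metric by (rule exI[of _ "min d 1"]) (use d in auto)
  then show "\<forall>\<^sub>F h in nhds 0. dist (shift_defect f h) 0 < r"
    by eventually_elim (use * in \<open>simp add: shift_defect_def\<close>)
qed

lemma integral_torus_shift_diff:
  fixes f :: "real^3 \<Rightarrow> real"
  assumes "f \<in> borel_measurable borel" "periodic f"
  shows "integrable torus (\<lambda>x. f (x - h)) \<longleftrightarrow> integrable torus f"
    "(\<integral>x. f (x - h) \<partial>torus) = (\<integral>x. f x \<partial>torus)"
  using integral_torus_isometry[OF assms, of 1 "- h"] by simp_all

lemma L2_torus_shift:
  fixes f :: "real^3 \<Rightarrow> 'b::euclidean_space"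
  assumes "L2_torus f" shows "L2_torus (\<lambda>x. f (x - h))"
proof -
  have [measurable]: "f \<in> borel_measurable borel" and per: "periodic f"
    using assms by (auto simp: L2_torus_iff)
  have "periodic (\<lambda>x. f (x - h))"
    using per unfolding periodic_def by (metis add_diff_eq diff_add_eq)
  moreover have "integrable torus (\<lambda>x. (norm (f (x - h)))\<^sup>2)"
    using integral_torus_shift_diff(1)[of "\<lambda>x. (norm (f x))\<^sup>2" h] periodicI_comp[of f "\<lambda>v. (norm v)\<^sup>2"] assms
    by (simp add: L2_torus_iff)
  ultimately show ?thesis by (simp add: L2_torus_iff)
qed

lemma L2_torus_diff:
  fixes f g :: "real^3 \<Rightarrow> 'b::euclidean_space"
  assumes "L2_torus f" "L2_torus g"
  shows "L2_torus (\<lambda>x. f x - g x)"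
proof -
  have "L2_torus (\<lambda>x. - g x)"
    using L2_torus_bounded_mult'[OF assms(2), of "\<lambda>_. -1" 1] by (simp add: periodic_def)
  from L2_torus_add[OF assms(1) this] show ?thesis by simp
qed

text \<open>In contrast to a continuous approximation, a truncation keeps the period, so that the error
  is the same for all translates.\<close>

lemma L2_truncation:
  fixes f :: "real^3 \<Rightarrow> 'b::euclidean_space"
  assumes f: "L2_torus f" and "e > 0"
  obtains g C where "g \<in> borel_measurable borel" "periodic g" "\<And>x. norm (g x) \<le> C"
    "(\<integral>x. (norm (f x - g x))\<^sup>2 \<partial>torus) < e"
proof -
  have [measurable]: "f \<in> borel_measurable borel" and per: "periodic f"
    using assms by (auto simp: L2_torus_iff)
  define g where "g n x = (if norm (f x) \<le> real n then f x else 0)" for n x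
  have [measurable]: "g n \<in> borel_measurable borel" for n unfolding g_def by measurable
  have "(\<lambda>n. \<integral>x. (norm (f x - g n x))\<^sup>2 \<partial>torus) \<longlonglongrightarrow> (\<integral>x. 0 \<partial>torus)"
  proof (rule integral_dominated_convergence[where w = "\<lambda>x. (norm (f x))\<^sup>2"])
    show "AE x in torus. (\<lambda>n. (norm (f x - g n x))\<^sup>2) \<longlonglongrightarrow> 0"
    proof (rule AE_I2)
      fix x
      obtain N where N: "norm (f x) \<le> real N" using real_arch_simple by blast
      have "(norm (f x - g n x))\<^sup>2 = 0" if "n \<ge> N" for n
        using N that by (auto simp: g_def)
      then show "(\<lambda>n. (norm (f x - g n x))\<^sup>2) \<longlonglongrightarrow> 0"
        by (intro tendsto_eventually) (auto simp: eventually_sequentially)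
    qed
    show "integrable torus (\<lambda>x. (norm (f x))\<^sup>2)" using f by (simp add: L2_torus_iff)
    show "AE x in torus. norm ((norm (f x - g n x))\<^sup>2) \<le> (norm (f x))\<^sup>2" for n
      by (rule AE_I2) (simp add: g_def)
  qed auto
  then have "\<forall>\<^sub>F n in sequentially. (\<integral>x. (norm (f x - g n x))\<^sup>2 \<partial>torus) < e"
    using \<open>e > 0\<close> by (intro order_tendstoD) auto
  then obtain n where "(\<integral>x. (norm (f x - g n x))\<^sup>2 \<partial>torus) < e"
    by (auto simp: eventually_sequentially)
  moreover have "periodic (g n)" using per by (auto simp: g_def periodic_def)
  moreover have "norm (g n x) \<le> real n" for x by (simp add: g_def)
  ultimately show ?thesis using that[of "g n" "real n"] by auto
qed

lemma shift_defect_tendsto: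
  fixes f :: "real^3 \<Rightarrow> 'b::euclidean_space"
  assumes f: "L2_torus f"
  shows "(shift_defect f \<longlongrightarrow> 0) (nhds 0)"
proof (rule tendstoI)
  fix r :: real assume r: "r > 0"
  obtain g C where g [measurable]: "g \<in> borel_measurable borel" and gp: "periodic g" and gC: "\<And>x. norm (g x) \<le> C"
    and fg: "(\<integral>x. (norm (f x - g x))\<^sup>2 \<partial>torus) < r / 9"
    using L2_truncation[OF f, of "r / 9"] r by auto
  have g2: "L2_torus g" by (rule L2_torus_bounded[OF g gC gp])
  have [measurable]: "f \<in> borel_measurable borel" and per: "periodic f"
    using assms by (auto simp: L2_torus_iff)
  have int: "integrable torus (\<lambda>x. (norm (k x))\<^sup>2)" if "L2_torus k" for k :: "real^3 \<Rightarrow> 'b"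
    using that by (simp add: L2_torus_iff)
  have "\<forall>\<^sub>F h in nhds 0. shift_defect g h < r / 9"
    using shift_defect_bounded_tendsto[OF g gC] r by (intro order_tendstoD) auto
  then show "\<forall>\<^sub>F h in nhds 0. dist (shift_defect f h) 0 < r"
  proof eventually_elim
    case (elim h)
    have s: "L2_torus (\<lambda>x. f x - g x)" "L2_torus (\<lambda>x. g x - f x)" by (intro L2_torus_diff f g2)+
    have i: "integrable torus (\<lambda>x. (norm (f (x - h) - g (x - h)))\<^sup>2)"
      "integrable torus (\<lambda>x. (norm (g (x - h) - g x))\<^sup>2)" "integrable torus (\<lambda>x. (norm (g x - f x))\<^sup>2)"
      "integrable torus (\<lambda>x. (norm (f (x - h) - f x))\<^sup>2)"
      by (intro int L2_torus_diff L2_torus_shift f g2)+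
    have e: "(\<integral>x. (norm (f (x - h) - g (x - h)))\<^sup>2 \<partial>torus) = (\<integral>x. (norm (f x - g x))\<^sup>2 \<partial>torus)"
      by (rule integral_torus_shift_diff(2)[of "\<lambda>x. (norm (f x - g x))\<^sup>2"]) (use s periodicI_comp[of "\<lambda>x. f x - g x" "\<lambda>v. (norm v)\<^sup>2"] in \<open>auto simp: L2_torus_iff\<close>)
    have "shift_defect f h \<le> (\<integral>x. 3 * (norm (f (x - h) - g (x - h)))\<^sup>2 + 3 * (norm (g (x - h) - g x))\<^sup>2
        + 3 * (norm (g x - f x))\<^sup>2 \<partial>torus)"
      unfolding shift_defect_def by (rule integral_mono) (use i norm_sq_three in auto)
    also have "\<dots> = 3 * (\<integral>x. (norm (f x - g x))\<^sup>2 \<partial>torus) + 3 * shift_defect g h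
        + 3 * (\<integral>x. (norm (g x - f x))\<^sup>2 \<partial>torus)"
      using i by (simp add: e shift_defect_def)
    also have "\<dots> < r" using fg elim by (simp add: norm_minus_commute)
    finally show ?case by (simp add: shift_defect_def)
  qed
qed

section \<open>The smoothing defect\<close>

lemma borel_pair_torus:
  assumes "f \<in> borel_measurable (borel \<Otimes>\<^sub>M borel)"
  shows "f \<in> borel_measurable (torus \<Otimes>\<^sub>M torus)"
proof -
  have "(\<lambda>p. (fst p, snd p)) \<in> torus \<Otimes>\<^sub>M torus \<rightarrow>\<^sub>M borel \<Otimes>\<^sub>M borel"
    by (intro measurable_Pair measurable_compose[OF measurable_fst] measurable_compose[OF measurable_snd]
        borel_torus_id)
  then show ?thesis
    using measurable_comp[OF _ assms] by (simp add: comp_def)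
qed

lemma borel_pair_torus_snd:
  assumes "f \<in> borel_measurable (borel \<Otimes>\<^sub>M borel)"
  shows "f \<in> borel_measurable (borel \<Otimes>\<^sub>M torus)"
proof -
  have "(\<lambda>p. (fst p, snd p)) \<in> borel \<Otimes>\<^sub>M torus \<rightarrow>\<^sub>M borel \<Otimes>\<^sub>M borel"
    by (intro measurable_Pair measurable_fst measurable_compose[OF measurable_snd] borel_torus_id)
  then show ?thesis
    using measurable_comp[OF _ assms] by (simp add: comp_def)
qed

interpretation torus2: pair_sigma_finite torus torus ..

lemma nn_integral_torus_swap:
  assumes "f \<in> borel_measurable (borel \<Otimes>\<^sub>M borel)"
  shows "(\<integral>\<^sup>+x. \<integral>\<^sup>+y. f (x, y) \<partial>torus \<partial>torus) = (\<integral>\<^sup>+y. \<integral>\<^sup>+x. f (x, y) \<partial>torus \<partial>torus)"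
  using torus2.Fubini'[of "\<lambda>x y. f (x, y)"] borel_pair_torus[OF assms] by simp

lemma integral_torus_measurable:
  fixes f :: "'a::second_countable_topology \<times> (real^3) \<Rightarrow> 'b::{banach, second_countable_topology}"
  assumes "f \<in> borel_measurable (borel \<Otimes>\<^sub>M borel)"
  shows "(\<lambda>x. \<integral>y. f (x, y) \<partial>torus) \<in> borel_measurable borel"
  using torus.borel_measurable_lebesgue_integral[of "\<lambda>x y. f (x, y)" borel] borel_pair_torus_snd[OF assms] by simp

lemma nn_integral_kernel: "(\<integral>\<^sup>+y. ennreal (cos_kernel N (x - y)) \<partial>torus) = 1"
  "(\<integral>\<^sup>+x. ennreal (cos_kernel N (x - y)) \<partial>torus) = 1"
proof -
  have "(\<integral>\<^sup>+y. ennreal (cos_kernel N y) \<partial>torus) = 1"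
    using integrable_kernel[of N] by (simp add: nn_integral_eq_integral kernel_nonneg integral_kernel)
  then show 1: "(\<integral>\<^sup>+y. ennreal (cos_kernel N (x - y)) \<partial>torus) = 1" for x
    using nn_integral_torus_conv[of "\<lambda>y. ennreal (cos_kernel N y)" x] periodicI_comp[OF periodic_kernel, of ennreal]
    by simp
  show "(\<integral>\<^sup>+x. ennreal (cos_kernel N (x - y)) \<partial>torus) = 1"
    using 1[of y] by (subst kernel_minus)
qed

lemma integral_kernel_diff: "(\<integral>y. cos_kernel N (x - y) \<partial>torus) = 1"
proof -
  have "ennreal (\<integral>y. cos_kernel N (x - y) \<partial>torus) = (\<integral>\<^sup>+y. ennreal (cos_kernel N (x - y)) \<partial>torus)"
    using kernel_bounded kernel_nonneg
    by (intro nn_integral_eq_integral[symmetric] integrable_torus_bounded[where C = "1 / (\<integral>x. peak x ^ N \<partial>torus)"]) auto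
  then show ?thesis by (simp add: nn_integral_kernel ennreal_eq_1)
qed

lemma nn_integral_kernel_double:
  fixes g :: "real^3 \<Rightarrow> ennreal"
  assumes [measurable]: "g \<in> borel_measurable borel"
  shows "(\<integral>\<^sup>+x. \<integral>\<^sup>+y. ennreal (cos_kernel N (x - y)) * g y \<partial>torus \<partial>torus) = (\<integral>\<^sup>+y. g y \<partial>torus)"
    and "(\<integral>\<^sup>+x. \<integral>\<^sup>+y. ennreal (cos_kernel N (x - y)) * g x \<partial>torus \<partial>torus) = (\<integral>\<^sup>+y. g y \<partial>torus)"
proof -
  have "(\<integral>\<^sup>+x. \<integral>\<^sup>+y. ennreal (cos_kernel N (x - y)) * g y \<partial>torus \<partial>torus)
     = (\<integral>\<^sup>+y. \<integral>\<^sup>+x. ennreal (cos_kernel N (x - y)) * g y \<partial>torus \<partial>torus)"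
    using nn_integral_torus_swap[of "\<lambda>(x, y). ennreal (cos_kernel N (x - y)) * g y"] by simp
  then show "(\<integral>\<^sup>+x. \<integral>\<^sup>+y. ennreal (cos_kernel N (x - y)) * g y \<partial>torus \<partial>torus) = (\<integral>\<^sup>+y. g y \<partial>torus)"
    by (simp add: nn_integral_multc nn_integral_kernel)
  show "(\<integral>\<^sup>+x. \<integral>\<^sup>+y. ennreal (cos_kernel N (x - y)) * g x \<partial>torus \<partial>torus) = (\<integral>\<^sup>+y. g y \<partial>torus)"
    by (simp add: nn_integral_multc nn_integral_kernel)
qed

text \<open>The mean of \<open>shift_defect\<close> over the kernel. By \<open>defect_double\<close> it is the mean square of
  \<open>f y - f x\<close> with respect to the density \<open>cos_kernel N (x - y)\<close>.\<close>

definition defect :: "nat \<Rightarrow> (real^3 \<Rightarrow> 'b::euclidean_space) \<Rightarrow> real" where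
  "defect N f = (\<integral>h. cos_kernel N h * shift_defect f h \<partial>torus)"

lemma shift_defect_nonneg: "0 \<le> shift_defect f h"
  by (simp add: shift_defect_def)

lemma kernel_shift_defect_nonneg: "0 \<le> cos_kernel N h * shift_defect f h"
  by (intro mult_nonneg_nonneg kernel_nonneg shift_defect_nonneg)

lemma shift_defect_le:
  assumes "L2_torus f" shows "shift_defect f h \<le> 4 * (L2_norm f)\<^sup>2"
proof -
  have [measurable]: "f \<in> borel_measurable borel" using assms by (simp add: L2_torus_iff)
  have i: "integrable torus (\<lambda>x. (norm (f x))\<^sup>2)" "integrable torus (\<lambda>x. (norm (f (x - h)))\<^sup>2)"
    using assms L2_torus_shift[OF assms, of h] by (simp_all add: L2_torus_iff)
  have "shift_defect f h \<le> (\<integral>x. 2 * (norm (f (x - h)))\<^sup>2 + 2 * (norm (f x))\<^sup>2 \<partial>torus)"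
    unfolding shift_defect_def
    by (rule integral_mono) (use i norm_sq_diff_le L2_torus_diff[OF L2_torus_shift[OF assms, of h] assms] in \<open>auto simp: L2_torus_iff\<close>)
  also have "\<dots> = 2 * (\<integral>x. (norm (f (x - h)))\<^sup>2 \<partial>torus) + 2 * (\<integral>x. (norm (f x))\<^sup>2 \<partial>torus)"
    using i by simp
  also have "(\<integral>x. (norm (f (x - h)))\<^sup>2 \<partial>torus) = (\<integral>x. (norm (f x))\<^sup>2 \<partial>torus)"
    by (rule integral_torus_shift_diff(2)[of "\<lambda>x. (norm (f x))\<^sup>2"])
      (use assms periodicI_comp[of f "\<lambda>v. (norm v)\<^sup>2"] in \<open>auto simp: L2_torus_iff\<close>)
  finally show ?thesis by (simp add: L2_norm_sq)
qed

lemma shift_defect_borel: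
  assumes [measurable]: "f \<in> borel_measurable borel"
  shows "shift_defect f \<in> borel_measurable borel"
  unfolding shift_defect_def[abs_def]
  using integral_torus_measurable[of "\<lambda>(h, x). (norm (f (x - h) - f x))\<^sup>2"] by simp

lemma periodic_shift_defect:
  assumes "periodic f" shows "periodic (shift_defect f)"
proof -
  have "f (x - (h + axis i 1)) = f (x - h)" for x h i
    using assms unfolding periodic_def by (metis diff_add_cancel diff_diff_add)
  then show ?thesis by (simp add: periodic_def shift_defect_def)
qed

lemma defect_tendsto:
  assumes "L2_torus f" shows "(\<lambda>N. defect N f) \<longlonglongrightarrow> 0"
  unfolding defect_def
  using assms shift_defect_le[OF assms] shift_defect_nonneg
  by (intro kernel_concentrates shift_defect_borel periodic_shift_defect shift_defect_tendsto) (auto simp: L2_torus_iff)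

lemma integrable_defect:
  assumes "L2_torus f" shows "integrable torus (\<lambda>h. cos_kernel N h * shift_defect f h)"
proof (rule Bochner_Integration.integrable_bound)
  have [measurable]: "f \<in> borel_measurable borel" using assms by (simp add: L2_torus_iff)
  note shift_defect_borel[measurable]
  show "integrable torus (\<lambda>h. 4 * (L2_norm f)\<^sup>2 * cos_kernel N h)" using integrable_kernel[of N] by simp
  show "(\<lambda>h. cos_kernel N h * shift_defect f h) \<in> borel_measurable torus"
    using shift_defect_borel[of f] by measurable
  show "AE h in torus. norm (cos_kernel N h * shift_defect f h) \<le> norm (4 * (L2_norm f)\<^sup>2 * cos_kernel N h)"
  proof (rule AE_I2)
    fix h
    have "cos_kernel N h * shift_defect f h \<le> cos_kernel N h * (4 * (L2_norm f)\<^sup>2)"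
      by (intro mult_left_mono shift_defect_le assms kernel_nonneg)
    then show "norm (cos_kernel N h * shift_defect f h) \<le> norm (4 * (L2_norm f)\<^sup>2 * cos_kernel N h)"
      using kernel_nonneg[of N h] shift_defect_nonneg[of f h] by (simp add: abs_mult mult_ac)
  qed
qed

lemma defect_nonneg: "0 \<le> defect N f"
  unfolding defect_def by (intro integral_nonneg_AE AE_I2 kernel_shift_defect_nonneg)

lemma defect_le:
  assumes "L2_torus f" shows "defect N f \<le> 4 * (L2_norm f)\<^sup>2"
proof -
  have "defect N f \<le> (\<integral>h. 4 * (L2_norm f)\<^sup>2 * cos_kernel N h \<partial>torus)"
    unfolding defect_def
  proof (rule integral_mono)
    show "cos_kernel N h * shift_defect f h \<le> 4 * (L2_norm f)\<^sup>2 * cos_kernel N h" for h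
      using mult_left_mono[OF shift_defect_le[OF assms, of h] kernel_nonneg[of N h]] by (simp add: mult_ac)
  qed (use integrable_defect[OF assms] integrable_kernel in auto)
  then show ?thesis by (simp add: integral_kernel)
qed

text \<open>Substitute \<open>y = x - h\<close> and exchange the integrals.\<close>

lemma defect_double:
  assumes f: "L2_torus f"
  shows "(\<integral>\<^sup>+x. \<integral>\<^sup>+y. ennreal (cos_kernel N (x - y) * (norm (f y - f x))\<^sup>2) \<partial>torus \<partial>torus) = ennreal (defect N f)"
proof -
  have [measurable]: "f \<in> borel_measurable borel" and per: "periodic f" using f by (auto simp: L2_torus_iff)
  have "(\<integral>\<^sup>+x. \<integral>\<^sup>+y. ennreal (cos_kernel N (x - y) * (norm (f y - f x))\<^sup>2) \<partial>torus \<partial>torus)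
     = (\<integral>\<^sup>+x. \<integral>\<^sup>+h. ennreal (cos_kernel N h * (norm (f (x - h) - f x))\<^sup>2) \<partial>torus \<partial>torus)"
  proof (rule nn_integral_cong)
    fix x
    have "f (x - (h + axis i 1)) = f (x - h)" for h i
      using per unfolding periodic_def by (metis diff_add_cancel diff_diff_add)
    then have "periodic (\<lambda>h. ennreal (cos_kernel N h * (norm (f (x - h) - f x))\<^sup>2))"
      using periodic_kernel[of N] by (simp add: periodic_def)
    from nn_integral_torus_conv[OF _ this, of x]
    show "(\<integral>\<^sup>+y. ennreal (cos_kernel N (x - y) * (norm (f y - f x))\<^sup>2) \<partial>torus)
      = (\<integral>\<^sup>+h. ennreal (cos_kernel N h * (norm (f (x - h) - f x))\<^sup>2) \<partial>torus)"
      by simp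
  qed
  also have "\<dots> = (\<integral>\<^sup>+h. \<integral>\<^sup>+x. ennreal (cos_kernel N h * (norm (f (x - h) - f x))\<^sup>2) \<partial>torus \<partial>torus)"
    using nn_integral_torus_swap[of "\<lambda>(x, h). ennreal (cos_kernel N h * (norm (f (x - h) - f x))\<^sup>2)"] by simp
  also have "\<dots> = (\<integral>\<^sup>+h. ennreal (cos_kernel N h * shift_defect f h) \<partial>torus)"
  proof (rule nn_integral_cong)
    fix h
    have "integrable torus (\<lambda>x. (norm (f (x - h) - f x))\<^sup>2)"
      using L2_torus_diff[OF L2_torus_shift[OF f, of h] f] by (simp add: L2_torus_iff)
    then show "(\<integral>\<^sup>+x. ennreal (cos_kernel N h * (norm (f (x - h) - f x))\<^sup>2) \<partial>torus) = ennreal (cos_kernel N h * shift_defect f h)"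
      by (subst nn_integral_eq_integral) (auto simp: shift_defect_def kernel_nonneg)
  qed
  also have "\<dots> = ennreal (defect N f)"
    unfolding defect_def
    by (intro nn_integral_eq_integral integrable_defect[OF f] AE_I2 kernel_shift_defect_nonneg)
  finally show ?thesis .
qed

lemma ennreal_power2_le_imp_le: "a\<^sup>2 \<le> (ennreal c)\<^sup>2 \<Longrightarrow> 0 \<le> c \<Longrightarrow> a \<le> ennreal c"
  by (cases a rule: ennreal_cases)
    (auto simp: ennreal_power ennreal_le_iff top_power_ennreal top_unique intro: power2_le_imp_le)

text \<open>Cauchy--Schwarz on the product of two tori, with a square root of the kernel in each factor.\<close>

lemma kernel_Cauchy_Schwarz:
  fixes q :: "real^3 \<Rightarrow> real^3 \<Rightarrow> real"
  assumes f: "L2_torus f" and [measurable]: "case_prod q \<in> borel_measurable (borel \<Otimes>\<^sub>M borel)"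
    and q0: "\<And>x y. 0 \<le> q x y" and c0: "0 \<le> c"
    and q2: "(\<integral>\<^sup>+x. \<integral>\<^sup>+y. ennreal (cos_kernel N (x - y)) * ennreal ((q x y)\<^sup>2) \<partial>torus \<partial>torus) \<le> ennreal (c\<^sup>2)"
  shows "(\<integral>\<^sup>+x. \<integral>\<^sup>+y. ennreal (cos_kernel N (x - y) * norm (f y - f x) * q x y) \<partial>torus \<partial>torus) \<le> ennreal (sqrt (defect N f) * c)"
proof -
  have [measurable]: "f \<in> borel_measurable borel" using f by (auto simp: L2_torus_iff)
  let ?P = "torus \<Otimes>\<^sub>M torus"
  define A where "A p = ennreal (sqrt (cos_kernel N (fst p - snd p)) * norm (f (snd p) - f (fst p)))" for p
  define B where "B p = ennreal (sqrt (cos_kernel N (fst p - snd p)) * q (fst p) (snd p))" for p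
  have [measurable]: "(\<lambda>p. q (fst p) (snd p)) \<in> borel_measurable (borel \<Otimes>\<^sub>M borel)"
    using assms(2) by (simp add: case_prod_beta')
  have mA: "A \<in> borel_measurable ?P" unfolding A_def by (intro borel_pair_torus) measurable
  have mB: "B \<in> borel_measurable ?P" unfolding B_def by (intro borel_pair_torus) measurable
  have k2: "sqrt (cos_kernel N z) * sqrt (cos_kernel N z) = cos_kernel N z" for z using kernel_nonneg by simp
  have AB: "A (x, y) * B (x, y) = ennreal (cos_kernel N (x - y) * norm (f y - f x) * q x y)" for x y
    unfolding A_def B_def by (subst ennreal_mult[symmetric]) (use kernel_nonneg q0 k2[of "x-y"] in \<open>auto simp: mult_ac\<close>)
  have A2: "A (x, y) ^ 2 = ennreal (cos_kernel N (x - y) * (norm (f y - f x))\<^sup>2)" for x y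
    unfolding A_def using kernel_nonneg by (subst ennreal_power) (auto simp: power_mult_distrib)
  have B2: "B (x, y) ^ 2 = ennreal (cos_kernel N (x - y)) * ennreal ((q x y)\<^sup>2)" for x y
    unfolding B_def using kernel_nonneg q0 by (subst ennreal_power) (auto simp: power_mult_distrib ennreal_mult)
  have "(\<integral>\<^sup>+p. A p * B p \<partial>?P)\<^sup>2 \<le> (\<integral>\<^sup>+p. A p ^ 2 \<partial>?P) * (\<integral>\<^sup>+p. B p ^ 2 \<partial>?P)"
    by (rule Cauchy_Schwarz_nn_integral[OF mA mB])
  also have "(\<integral>\<^sup>+p. A p * B p \<partial>?P) = (\<integral>\<^sup>+x. \<integral>\<^sup>+y. ennreal (cos_kernel N (x - y) * norm (f y - f x) * q x y) \<partial>torus \<partial>torus)"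
    using mA mB by (subst torus.nn_integral_fst[symmetric]) (auto simp: AB)
  also have "(\<integral>\<^sup>+p. A p ^ 2 \<partial>?P) = ennreal (defect N f)"
    using mA by (subst torus.nn_integral_fst[symmetric]) (auto simp: A2 defect_double[OF f])
  also have "(\<integral>\<^sup>+p. B p ^ 2 \<partial>?P) = (\<integral>\<^sup>+x. \<integral>\<^sup>+y. ennreal (cos_kernel N (x - y)) * ennreal ((q x y)\<^sup>2) \<partial>torus \<partial>torus)"
    using mB by (subst torus.nn_integral_fst[symmetric]) (auto simp: B2)
  also have "ennreal (defect N f) * \<dots> \<le> ennreal (defect N f) * ennreal (c\<^sup>2)"
    by (intro mult_left_mono q2) auto
  also have "\<dots> = (ennreal (sqrt (defect N f) * c))\<^sup>2"
    using c0 defect_nonneg[of N f] by (subst ennreal_power) (auto simp: power_mult_distrib ennreal_mult)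
  finally have "(\<integral>\<^sup>+x. \<integral>\<^sup>+y. ennreal (cos_kernel N (x - y) * norm (f y - f x) * q x y) \<partial>torus \<partial>torus)\<^sup>2
     \<le> (ennreal (sqrt (defect N f) * c))\<^sup>2" .
  then show ?thesis
    by (rule ennreal_power2_le_imp_le) (use c0 defect_nonneg[of N f] in simp)
qed

lemma nn_integral_L2: "L2_torus g \<Longrightarrow> (\<integral>\<^sup>+x. ennreal ((norm (g x))\<^sup>2) \<partial>torus) = ennreal ((L2_norm g)\<^sup>2)"
  by (subst nn_integral_eq_integral) (auto simp: L2_torus_iff L2_norm_sq)

text \<open>The two ways in which the defect enters: with \<open>g y\<close> it bounds the commutator of smoothing and
  transport, with \<open>g x\<close> the error of smoothing against a fixed function.\<close>

lemma defect_pairing: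
  fixes f :: "real^3 \<Rightarrow> 'b::euclidean_space" and g :: "real^3 \<Rightarrow> 'c::euclidean_space"
  assumes f: "L2_torus f" and g: "L2_torus g"
  shows "(\<integral>\<^sup>+x. \<integral>\<^sup>+y. ennreal (cos_kernel N (x - y) * norm (f y - f x) * norm (g y)) \<partial>torus \<partial>torus) \<le> ennreal (sqrt (defect N f) * L2_norm g)"
    and "(\<integral>\<^sup>+x. \<integral>\<^sup>+y. ennreal (cos_kernel N (x - y) * norm (f y - f x) * norm (g x)) \<partial>torus \<partial>torus) \<le> ennreal (sqrt (defect N f) * L2_norm g)"
proof -
  have [measurable]: "g \<in> borel_measurable borel" using g by (auto simp: L2_torus_iff)
  show "(\<integral>\<^sup>+x. \<integral>\<^sup>+y. ennreal (cos_kernel N (x - y) * norm (f y - f x) * norm (g y)) \<partial>torus \<partial>torus) \<le> ennreal (sqrt (defect N f) * L2_norm g)"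
    by (rule kernel_Cauchy_Schwarz[OF f, of "\<lambda>x y. norm (g y)"])
      (auto simp: nn_integral_kernel_double nn_integral_L2[OF g] L2_norm_nonneg)
  show "(\<integral>\<^sup>+x. \<integral>\<^sup>+y. ennreal (cos_kernel N (x - y) * norm (f y - f x) * norm (g x)) \<partial>torus \<partial>torus) \<le> ennreal (sqrt (defect N f) * L2_norm g)"
    by (rule kernel_Cauchy_Schwarz[OF f, of "\<lambda>x y. norm (g x)"])
      (auto simp: nn_integral_kernel_double nn_integral_L2[OF g] L2_norm_nonneg)
qed

section \<open>Smoothing by the kernel\<close>

text \<open>A fixed choice of the finite expansion of the kernel: its waves and their coefficients.\<close>

definition kernel_modes :: "nat \<Rightarrow> ((int^3) \<times> real) set \<times> ((int^3) \<times> real \<Rightarrow> real)" where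
  "kernel_modes N = (SOME p. finite (fst p) \<and> fst p \<subseteq> UNIV \<times> {0, - pi / 2} \<and>
     (\<forall>x y. cos_kernel N (x - y) = (\<Sum>m\<in>fst p. snd p m * wave m x * wave m y)))"

definition modes :: "nat \<Rightarrow> ((int^3) \<times> real) set" where
  "modes N = fst (kernel_modes N)"

definition coef :: "nat \<Rightarrow> (int^3) \<times> real \<Rightarrow> real" where
  "coef N = snd (kernel_modes N)"

lemma modes_coef:
  shows finite_modes: "finite (modes N)"
    and modes_subset: "modes N \<subseteq> UNIV \<times> {0, - pi / 2}"
    and kernel_diff_modes: "cos_kernel N (x - y) = (\<Sum>m\<in>modes N. coef N m * wave m x * wave m y)"
proof -
  let ?P = "\<lambda>p. finite (fst p) \<and> fst p \<subseteq> UNIV \<times> {0, - pi / 2} \<and>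
     (\<forall>x y. cos_kernel N (x - y) = (\<Sum>m\<in>fst p. snd p m * wave m x * wave m y))"
  have P: "?P (kernel_modes N)"
    unfolding kernel_modes_def
  proof (rule someI_ex)
    obtain M c where "finite M" "M \<subseteq> UNIV \<times> {0, - pi / 2}"
      "\<forall>x y. cos_kernel N (x - y) = (\<Sum>m\<in>M. c m * wave m x * wave m y)"
      using kernel_expansion[of N] by (elim exE conjE)
    then show "\<exists>p. ?P p" by (intro exI[of _ "(M, c)"]) simp
  qed
  show "finite (modes N)" "modes N \<subseteq> UNIV \<times> {0, - pi / 2}"
    using P[THEN conjunct1] P[THEN conjunct2, THEN conjunct1] by (simp_all add: modes_def)
  show "cos_kernel N (x - y) = (\<Sum>m\<in>modes N. coef N m * wave m x * wave m y)"
    using P unfolding modes_def coef_def by (elim conjE allE)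
qed

definition mol :: "nat \<Rightarrow> (real^3 \<Rightarrow> 'b::euclidean_space) \<Rightarrow> real^3 \<Rightarrow> 'b" where
  "mol N f x = (\<integral>y. cos_kernel N (x - y) *\<^sub>R f y \<partial>torus)"

lemma integrable_mult_bounded:
  fixes f :: "real^3 \<Rightarrow> 'b::euclidean_space" and g :: "real^3 \<Rightarrow> real"
  assumes f: "integrable torus f" and [measurable]: "g \<in> borel_measurable borel" and C: "\<And>x. \<bar>g x\<bar> \<le> C"
  shows "integrable torus (\<lambda>x. g x *\<^sub>R f x)"
proof (rule Bochner_Integration.integrable_bound)
  show "integrable torus (\<lambda>x. C * norm (f x))" using f by simp
  show "(\<lambda>x. g x *\<^sub>R f x) \<in> borel_measurable torus" using f by measurable
  have "C \<ge> 0" using C[of 0] by linarith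
  then show "AE x in torus. norm (g x *\<^sub>R f x) \<le> norm (C * norm (f x))"
    using C by (auto intro!: AE_I2 mult_right_mono simp: abs_mult)
qed

lemma integrable_wave_mult:
  fixes f :: "real^3 \<Rightarrow> 'b::euclidean_space"
  shows "integrable torus f \<Longrightarrow> integrable torus (\<lambda>x. wave m x *\<^sub>R f x)"
  by (rule integrable_mult_bounded[where C=1]) (auto simp: wave_le_1)

lemma integrable_grad_wave_mult:
  fixes f :: "real^3 \<Rightarrow> real"
  assumes "integrable torus f"
  shows "integrable torus (\<lambda>x. f x *\<^sub>R grad_wave m x)"
proof (rule Bochner_Integration.integrable_bound)
  show "integrable torus (\<lambda>x. 2 * pi * norm (intvec (fst m)) * f x)" using assms by simp
  show "(\<lambda>x. f x *\<^sub>R grad_wave m x) \<in> borel_measurable torus" using assms by measurable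
  have "norm (f x *\<^sub>R grad_wave m x) \<le> norm (2 * pi * norm (intvec (fst m)) * f x)" for x
    using mult_left_mono[OF norm_grad_wave_le[of m x], of "\<bar>f x\<bar>"] by (simp add: abs_mult mult_ac)
  then show "AE x in torus. norm (f x *\<^sub>R grad_wave m x) \<le> norm (2 * pi * norm (intvec (fst m)) * f x)"
    by (rule AE_I2)
qed

lemma integrable_kernel_mult:
  fixes f :: "real^3 \<Rightarrow> 'b::euclidean_space"
  assumes "integrable torus f" shows "integrable torus (\<lambda>y. cos_kernel N (x - y) *\<^sub>R f y)"
  using assms kernel_bounded kernel_nonneg
  by (intro integrable_mult_bounded[where C = "1 / (\<integral>x. peak x ^ N \<partial>torus)"]) auto

lemma mol_expansion:
  fixes f :: "real^3 \<Rightarrow> 'b::euclidean_space"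
  assumes f: "integrable torus f"
  shows "mol N f x = (\<Sum>m\<in>modes N. (coef N m * wave m x) *\<^sub>R (\<integral>y. wave m y *\<^sub>R f y \<partial>torus))"
proof -
  have "mol N f x = (\<integral>y. (\<Sum>m\<in>modes N. (coef N m * wave m x) *\<^sub>R (wave m y *\<^sub>R f y)) \<partial>torus)"
    by (simp add: mol_def kernel_diff_modes scaleR_sum_left)
  also have "\<dots> = (\<Sum>m\<in>modes N. (\<integral>y. (coef N m * wave m x) *\<^sub>R (wave m y *\<^sub>R f y) \<partial>torus))"
    by (intro Bochner_Integration.integral_sum integrable_scaleR_right integrable_wave_mult f)
  also have "\<dots> = (\<Sum>m\<in>modes N. (coef N m * wave m x) *\<^sub>R (\<integral>y. wave m y *\<^sub>R f y \<partial>torus))"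
    by (simp only: integral_scaleR_right)
  finally show ?thesis .
qed

lemma continuous_mol:
  fixes f :: "real^3 \<Rightarrow> 'b::euclidean_space"
  assumes "integrable torus f" shows "continuous_on S (mol N f)"
  unfolding mol_expansion[OF assms, abs_def] by (intro continuous_intros)

lemma periodic_mol: "periodic (mol N f)"
proof -
  have "cos_kernel N (x + axis i 1 - y) = cos_kernel N (x - y)" for x y i
    using periodic_kernel[of N] unfolding periodic_def by (metis add_diff_eq diff_add_eq)
  then show ?thesis by (simp add: periodic_def mol_def)
qed

lemma mol_bounded:
  fixes f :: "real^3 \<Rightarrow> 'b::euclidean_space"
  assumes "integrable torus f"
  shows "norm (mol N f x) \<le> (\<Sum>m\<in>modes N. \<bar>coef N m\<bar> * norm (\<integral>y. wave m y *\<^sub>R f y \<partial>torus))"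
proof -
  have "norm (mol N f x) \<le> (\<Sum>m\<in>modes N. norm ((coef N m * wave m x) *\<^sub>R (\<integral>y. wave m y *\<^sub>R f y \<partial>torus)))"
    unfolding mol_expansion[OF assms] by (rule norm_sum)
  also have "\<dots> \<le> (\<Sum>m\<in>modes N. \<bar>coef N m\<bar> * norm (\<integral>y. wave m y *\<^sub>R f y \<partial>torus))"
    by (intro sum_mono) (simp add: abs_mult mult_left_le wave_le_1 mult_right_mono)
  finally show ?thesis .
qed

lemma L2_torus_mol:
  fixes f :: "real^3 \<Rightarrow> 'b::euclidean_space"
  assumes "integrable torus f" shows "L2_torus (mol N f)"
  by (rule L2_torus_bounded[OF _ mol_bounded[OF assms] periodic_mol])
    (intro borel_measurable_continuous_onI continuous_mol assms)

lemma mol_diff: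
  fixes f :: "real^3 \<Rightarrow> 'b::euclidean_space"
  assumes "integrable torus f"
  shows "mol N f x - v = (\<integral>y. cos_kernel N (x - y) *\<^sub>R (f y - v) \<partial>torus)"
proof -
  have "(\<integral>y. cos_kernel N (x - y) *\<^sub>R (f y - v) \<partial>torus)
      = (\<integral>y. cos_kernel N (x - y) *\<^sub>R f y - cos_kernel N (x - y) *\<^sub>R v \<partial>torus)"
    by (simp add: scaleR_diff_right)
  also have "\<dots> = mol N f x - (\<integral>y. cos_kernel N (x - y) *\<^sub>R v \<partial>torus)"
    unfolding mol_def using assms by (intro Bochner_Integration.integral_diff integrable_kernel_mult) auto
  also have "(\<integral>y. cos_kernel N (x - y) *\<^sub>R v \<partial>torus) = v"
  proof -
    have "integrable torus (\<lambda>y. cos_kernel N (x - y))"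
      using kernel_bounded kernel_nonneg
      by (intro integrable_torus_bounded[where C = "1 / (\<integral>x. peak x ^ N \<partial>torus)"]) auto
    then show ?thesis by (simp add: integral_kernel_diff)
  qed
  finally show ?thesis ..
qed

text \<open>Since the kernel has integral 1, \<open>mol N f x - f x\<close> is the kernel mean of \<open>f y - f x\<close>.\<close>

lemma mol_weak_error:
  fixes f g :: "real^3 \<Rightarrow> 'b::euclidean_space"
  assumes f: "L2_torus f" and g: "L2_torus g"
  shows "\<bar>(\<integral>x. g x \<bullet> mol N f x \<partial>torus) - (\<integral>x. g x \<bullet> f x \<partial>torus)\<bar> \<le> sqrt (defect N f) * L2_norm g"
proof -
  have [measurable]: "f \<in> borel_measurable borel" "g \<in> borel_measurable borel"
    using f g by (auto simp: L2_torus_iff)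
  note fi = L2_torus_integrable[OF f]
  have d: "L2_torus (\<lambda>x. mol N f x - f x)" by (intro L2_torus_diff L2_torus_mol fi f)
  have "(\<integral>x. g x \<bullet> mol N f x \<partial>torus) - (\<integral>x. g x \<bullet> f x \<partial>torus) = (\<integral>x. g x \<bullet> (mol N f x - f x) \<partial>torus)"
    by (simp add: inner_diff_right Bochner_Integration.integral_diff L2_torus_inner[OF g L2_torus_mol[OF fi]] L2_torus_inner[OF g f])
  moreover have "ennreal \<bar>\<integral>x. g x \<bullet> (mol N f x - f x) \<partial>torus\<bar> \<le> ennreal (sqrt (defect N f) * L2_norm g)"
  proof -
    have "ennreal \<bar>\<integral>x. g x \<bullet> (mol N f x - f x) \<partial>torus\<bar> \<le> (\<integral>\<^sup>+x. ennreal \<bar>g x \<bullet> (mol N f x - f x)\<bar> \<partial>torus)"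
      using integral_norm_bound_ennreal[OF L2_torus_inner[OF g d]] by simp
    also have "\<dots> \<le> (\<integral>\<^sup>+x. \<integral>\<^sup>+y. ennreal (cos_kernel N (x - y) * norm (f y - f x) * norm (g x)) \<partial>torus \<partial>torus)"
    proof (rule nn_integral_mono)
      fix x
      have i: "integrable torus (\<lambda>y. cos_kernel N (x - y) *\<^sub>R (f y - f x))"
        by (intro integrable_kernel_mult Bochner_Integration.integrable_diff fi) simp
      have "ennreal \<bar>g x \<bullet> (mol N f x - f x)\<bar> \<le> ennreal (norm (g x) * norm (mol N f x - f x))"
        by (intro ennreal_leI Cauchy_Schwarz_ineq2)
      also have "\<dots> = ennreal (norm (g x)) * ennreal (norm (\<integral>y. cos_kernel N (x - y) *\<^sub>R (f y - f x) \<partial>torus))"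
        by (simp add: mol_diff[OF fi] ennreal_mult)
      also have "\<dots> \<le> ennreal (norm (g x)) * (\<integral>\<^sup>+y. ennreal (norm (cos_kernel N (x - y) *\<^sub>R (f y - f x))) \<partial>torus)"
        by (intro mult_left_mono integral_norm_bound_ennreal i) auto
      also have "\<dots> = (\<integral>\<^sup>+y. ennreal (norm (g x)) * ennreal (norm (cos_kernel N (x - y) *\<^sub>R (f y - f x))) \<partial>torus)"
        by (intro nn_integral_cmult[symmetric]) measurable
      also have "\<dots> = (\<integral>\<^sup>+y. ennreal (cos_kernel N (x - y) * norm (f y - f x) * norm (g x)) \<partial>torus)"
        by (intro nn_integral_cong) (simp add: kernel_nonneg ennreal_mult'[symmetric] mult_ac)
      finally show "ennreal \<bar>g x \<bullet> (mol N f x - f x)\<bar> \<le> (\<integral>\<^sup>+y. ennreal (cos_kernel N (x - y) * norm (f y - f x) * norm (g x)) \<partial>torus)" .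
    qed
    also have "\<dots> \<le> ennreal (sqrt (defect N f) * L2_norm g)" by (rule defect_pairing(2)[OF f g])
    finally show ?thesis .
  qed
  ultimately show ?thesis
    by (simp add: ennreal_le_iff defect_nonneg L2_norm_nonneg)
qed

lemma mol_weak_tendsto:
  fixes f g :: "real^3 \<Rightarrow> 'b::euclidean_space"
  assumes f: "L2_torus f" and g: "L2_torus g"
  shows "(\<lambda>N. \<integral>x. g x \<bullet> mol N f x \<partial>torus) \<longlonglongrightarrow> (\<integral>x. g x \<bullet> f x \<partial>torus)"
proof -
  have "(\<lambda>N. sqrt (defect N f) * L2_norm g) \<longlonglongrightarrow> sqrt 0 * L2_norm g"
    by (intro tendsto_intros defect_tendsto f)
  then have "(\<lambda>N. sqrt (defect N f) * L2_norm g) \<longlonglongrightarrow> 0" by simp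
  then have "(\<lambda>N. (\<integral>x. g x \<bullet> mol N f x \<partial>torus) - (\<integral>x. g x \<bullet> f x \<partial>torus)) \<longlonglongrightarrow> 0"
    by (rule Lim_null_comparison[rotated]) (use mol_weak_error[OF f g] in auto)
  then show ?thesis by (simp add: LIM_zero_iff)
qed

section \<open>Weak gradients tested with waves\<close>

text \<open>The weak gradient and the weak divergence condition tested with waves only. This is enough
  because the kernel consists of waves, and for \<open>wave_div_free\<close> the countably many waves with the
  phases of the kernel suffice, which matters when null sets of times are collected.\<close>

definition wave_grad :: "(real^3 \<Rightarrow> real) \<Rightarrow> (real^3 \<Rightarrow> real^3) \<Rightarrow> bool" where
  "wave_grad \<phi> G \<longleftrightarrow> (\<forall>m. (\<integral>x. \<phi> x *\<^sub>R grad_wave m x \<partial>torus) = - (\<integral>x. wave m x *\<^sub>R G x \<partial>torus))"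

definition wave_div_free :: "(real^3 \<Rightarrow> real^3) \<Rightarrow> bool" where
  "wave_div_free u \<longleftrightarrow> (\<forall>m\<in>UNIV \<times> {0, - pi / 2}. (\<integral>x. u x \<bullet> grad_wave m x \<partial>torus) = 0)"

text \<open>The kernel depends on \<open>x - y\<close> only, so its expansion is constant along a common shift of \<open>x\<close>
  and \<open>y\<close>; the statement is that its derivative in the direction of the shift vanishes.\<close>

lemma kernel_gradient_antisymmetry:
  "(\<Sum>m\<in>modes N. (coef N m * wave m x) *\<^sub>R grad_wave m y) = - (\<Sum>m\<in>modes N. (coef N m * wave m y) *\<^sub>R grad_wave m x)"
proof -
  let ?S = "(\<Sum>m\<in>modes N. (coef N m * wave m x) *\<^sub>R grad_wave m y) + (\<Sum>m\<in>modes N. (coef N m * wave m y) *\<^sub>R grad_wave m x)"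
  have w: "((\<lambda>t. wave m (z + t *\<^sub>R h)) has_real_derivative grad_wave m z \<bullet> h) (at 0)" for m z h
  proof -
    have "((\<lambda>t. wave m (z + t *\<^sub>R h)) has_derivative (\<lambda>t. grad_wave m (z + 0 *\<^sub>R h) \<bullet> (t *\<^sub>R h))) (at 0)"
      by (rule has_derivative_compose[OF _ wave_has_derivative]) (auto intro!: derivative_eq_intros)
    then show ?thesis by (simp add: has_field_derivative_def mult_commute_abs)
  qed
  have "?S \<bullet> h = 0" for h
  proof -
    have "((\<lambda>t. \<Sum>m\<in>modes N. coef N m * wave m (x + t *\<^sub>R h) * wave m (y + t *\<^sub>R h)) has_real_derivative
       (\<Sum>m\<in>modes N. coef N m * (grad_wave m x \<bullet> h) * wave m (y + 0 *\<^sub>R h) + (grad_wave m y \<bullet> h) * (coef N m * wave m (x + 0 *\<^sub>R h)))) (at 0)"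
      by (intro DERIV_sum DERIV_mult DERIV_cmult w)
    moreover have "(\<lambda>t. \<Sum>m\<in>modes N. coef N m * wave m (x + t *\<^sub>R h) * wave m (y + t *\<^sub>R h)) = (\<lambda>t. cos_kernel N (x - y))"
      by (subst kernel_diff_modes[symmetric]) simp
    ultimately have d: "((\<lambda>t. cos_kernel N (x - y)) has_real_derivative
       (\<Sum>m\<in>modes N. coef N m * (grad_wave m x \<bullet> h) * wave m (y + 0 *\<^sub>R h) + (grad_wave m y \<bullet> h) * (coef N m * wave m (x + 0 *\<^sub>R h)))) (at 0)"
      by (simp only:)
    have "(\<Sum>m\<in>modes N. coef N m * (grad_wave m x \<bullet> h) * wave m y + (grad_wave m y \<bullet> h) * (coef N m * wave m x)) = 0"
      using DERIV_unique[OF d DERIV_const] by simp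
    then show ?thesis
      by (simp add: inner_add_left inner_sum_left sum.distrib mult_ac)
  qed
  from this[of ?S] have "?S = 0" by (simp only: inner_eq_zero_iff)
  then show ?thesis by (simp add: eq_neg_iff_add_eq_0)
qed

text \<open>Smoothing commutes with the weak gradient: the gradient is moved from \<open>\<phi>\<close> to the second
  variable of the kernel by the definition of \<open>wave_grad\<close>, and from there to the first variable by
  antisymmetry.\<close>

lemma mol_gradient:
  assumes phi: "integrable torus \<phi>" and G: "integrable torus G" and w: "wave_grad \<phi> G"
  shows "mol N G x = (\<Sum>m\<in>modes N. (coef N m * (\<integral>y. wave m y * \<phi> y \<partial>torus)) *\<^sub>R grad_wave m x)"
proof -
  have gw: "integrable torus (\<lambda>y. \<phi> y *\<^sub>R grad_wave m y)" for m
    by (rule integrable_grad_wave_mult[OF phi])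
  have "mol N G x = (\<Sum>m\<in>modes N. (coef N m * wave m x) *\<^sub>R (- (\<integral>y. \<phi> y *\<^sub>R grad_wave m y \<partial>torus)))"
    unfolding mol_expansion[OF G] w[unfolded wave_grad_def, rule_format] by simp
  also have "\<dots> = - (\<Sum>m\<in>modes N. (\<integral>y. (coef N m * wave m x) *\<^sub>R (\<phi> y *\<^sub>R grad_wave m y) \<partial>torus))"
    by (simp only: integral_scaleR_right scaleR_minus_right sum_negf)
  also have "\<dots> = - (\<integral>y. (\<Sum>m\<in>modes N. (coef N m * wave m x) *\<^sub>R (\<phi> y *\<^sub>R grad_wave m y)) \<partial>torus)"
    by (intro arg_cong[where f = uminus] Bochner_Integration.integral_sum[symmetric] integrable_scaleR_right gw)
  also have "\<dots> = - (\<integral>y. \<phi> y *\<^sub>R (\<Sum>m\<in>modes N. (coef N m * wave m x) *\<^sub>R grad_wave m y) \<partial>torus)"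
    by (simp add: scaleR_sum_right mult_ac)
  also have "\<dots> = (\<integral>y. (\<Sum>m\<in>modes N. (wave m y *\<^sub>R \<phi> y) *\<^sub>R (coef N m *\<^sub>R grad_wave m x)) \<partial>torus)"
    by (subst kernel_gradient_antisymmetry) (simp add: scaleR_sum_right mult_ac)
  also have "\<dots> = (\<Sum>m\<in>modes N. (\<integral>y. (wave m y *\<^sub>R \<phi> y) *\<^sub>R (coef N m *\<^sub>R grad_wave m x) \<partial>torus))"
    by (intro Bochner_Integration.integral_sum integrable_scaleR_left integrable_wave_mult phi)
  also have "\<dots> = (\<Sum>m\<in>modes N. (\<integral>y. wave m y *\<^sub>R \<phi> y \<partial>torus) *\<^sub>R (coef N m *\<^sub>R grad_wave m x))"
    by (intro sum.cong refl integral_scaleR_left integrable_wave_mult phi)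
  finally show ?thesis by (simp add: mult_ac)
qed

lemma mol_has_derivative:
  assumes phi: "integrable torus \<phi>" and G: "integrable torus G" and w: "wave_grad \<phi> G"
  shows "(mol N \<phi> has_derivative (\<lambda>h. mol N G x \<bullet> h)) (at x)"
proof -
  have "mol N \<phi> = (\<lambda>x. \<Sum>m\<in>modes N. (coef N m * (\<integral>y. wave m y * \<phi> y \<partial>torus)) * wave m x)"
    by (rule ext) (simp add: mol_expansion[OF phi] mult_ac)
  moreover have "(\<dots> has_derivative (\<lambda>h. \<Sum>m\<in>modes N. (coef N m * (\<integral>y. wave m y * \<phi> y \<partial>torus)) * (grad_wave m x \<bullet> h))) (at x)"
    by (intro has_derivative_sum has_derivative_mult_right wave_has_derivative)
  ultimately show ?thesis
    by (simp add: mol_gradient[OF assms] inner_sum_left)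
qed

text \<open>The smoothed gradient is a finite combination of gradients of waves, hence orthogonal to \<open>u\<close>.
  Only weak convergence of the smoothing is needed for the limit.\<close>

lemma div_free_weak_gradient:
  assumes u: "L2_torus u" "wave_div_free u"
    and phi: "L2_torus \<phi>" and G: "L2_torus G" and w: "wave_grad \<phi> G"
  shows "(\<integral>x. u x \<bullet> G x \<partial>torus) = 0"
proof -
  note i = L2_torus_integrable[OF phi] L2_torus_integrable[OF G]
  have "(\<integral>x. u x \<bullet> mol N G x \<partial>torus) = 0" for N
  proof -
    have gw: "L2_torus (grad_wave m)" for m
      by (rule L2_torus_bounded[OF _ norm_grad_wave_le periodic_grad_wave]) simp
    have "(\<integral>x. u x \<bullet> mol N G x \<partial>torus)
      = (\<integral>x. (\<Sum>m\<in>modes N. (coef N m * (\<integral>y. wave m y * \<phi> y \<partial>torus)) * (u x \<bullet> grad_wave m x)) \<partial>torus)"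
      by (simp add: mol_gradient[OF i w] inner_sum_right)
    also have "\<dots> = (\<Sum>m\<in>modes N. (coef N m * (\<integral>y. wave m y * \<phi> y \<partial>torus)) * (\<integral>x. u x \<bullet> grad_wave m x \<partial>torus))"
      by (subst Bochner_Integration.integral_sum) (auto intro!: integrable_mult_right L2_torus_inner u gw)
    also have "\<dots> = 0"
      using u(2) modes_subset[of N] by (intro sum.neutral) (auto simp: wave_div_free_def)
    finally show ?thesis .
  qed
  then show ?thesis using mol_weak_tendsto[OF G u(1)] by (simp add: LIMSEQ_const_iff)
qed

section \<open>Integration by parts on the torus\<close>

lemma periodic_continuous_bounded:
  fixes g :: "real^3 \<Rightarrow> 'b::real_normed_vector"
  assumes per: "periodic g" and cont: "continuous_on UNIV g"
  obtains C where "\<And>x. norm (g x) \<le> C"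
proof -
  have "compact (g ` cube)"
    by (intro compact_continuous_image continuous_on_subset[OF cont]) auto
  then obtain C where C: "\<And>y. y \<in> g ` cube \<Longrightarrow> norm y \<le> C"
    using compact_imp_bounded bounded_iff by metis
  have "norm (g x) \<le> C" for x
  proof -
    let ?z = "\<chi> i. - \<lfloor>x $ i\<rfloor>"
    have "0 \<le> r + of_int (- \<lfloor>r\<rfloor>) \<and> r + of_int (- \<lfloor>r\<rfloor>) \<le> 1" for r :: real by linarith
    then have "x + intvec ?z \<in> cube" by (auto simp: mem_box_cart)
    then have "norm (g (x + intvec ?z)) \<le> C" by (intro C) auto
    then show ?thesis by (simp add: periodic_intvec[OF per])
  qed
  then show ?thesis by (rule that)
qed

lemma integrable_torus_continuous:
  fixes f :: "real^3 \<Rightarrow> 'b::euclidean_space"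
  assumes "continuous_on UNIV f" shows "integrable torus f"
  unfolding set_integrable_torus[symmetric] set_integrable_def
  by (rule borel_integrable_compact) (auto intro: continuous_on_subset[OF assms])

lemma periodic_gradient:
  assumes per: "periodic f" and der: "\<And>x. (f has_derivative (\<lambda>h. g x \<bullet> h)) (at x)"
  shows "periodic g"
  unfolding periodic_def
proof (intro allI)
  fix x i
  have "((\<lambda>y. f (y + axis i 1)) has_derivative (\<lambda>h. g (x + axis i 1) \<bullet> h)) (at x)"
    by (rule has_derivative_compose[OF _ der]) (auto intro!: derivative_eq_intros)
  moreover have "(\<lambda>y. f (y + axis i 1)) = f" using per by (auto simp: periodic_def)
  ultimately have "(f has_derivative (\<lambda>h. g (x + axis i 1) \<bullet> h)) (at x)" by simp
  then have "(\<lambda>h. g (x + axis i 1) \<bullet> h) = (\<lambda>h. g x \<bullet> h)"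
    using der has_derivative_unique by blast
  then have "g (x + axis i 1) \<bullet> h = g x \<bullet> h" for h by (rule fun_cong)
  then show "g (x + axis i 1) = g x" by (rule vector_eq_rdot[THEN iffD1, rule_format])
qed

text \<open>By translation invariance all difference quotients of \<open>f\<close> have mean zero, and they converge
  boundedly to the directional derivative.\<close>

lemma integral_gradient_zero:
  fixes f :: "real^3 \<Rightarrow> real"
  assumes per: "periodic f" and der: "\<And>x. (f has_derivative (\<lambda>h. g x \<bullet> h)) (at x)"
    and cont: "continuous_on UNIV g"
  shows "(\<integral>x. g x \<partial>torus) = 0"
proof -
  have cf: "continuous_on UNIV f"
    by (intro continuous_at_imp_continuous_on ballI has_derivative_continuous[OF der])
  have [measurable]: "f \<in> borel_measurable borel" "g \<in> borel_measurable borel"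
    using cf cont by (auto intro: borel_measurable_continuous_onI)
  have "periodic g" by (rule periodic_gradient[OF per der])
  then obtain C where C: "\<And>x. norm (g x) \<le> C" using periodic_continuous_bounded cont by blast
  have C0: "0 \<le> C" using C[of 0] norm_ge_zero order_trans by blast
  have lip: "\<bar>f x - f y\<bar> \<le> C * norm (x - y)" for x y
  proof -
    have on: "onorm (\<lambda>h. g z \<bullet> h) \<le> C" for z
    proof (rule onorm_le)
      show "norm (g z \<bullet> h) \<le> C * norm h" for h
        using Cauchy_Schwarz_ineq2[of "g z" h] mult_right_mono[OF C[of z] norm_ge_zero[of h]] by simp
    qed
    show ?thesis
      using differentiable_bound[of UNIV f "\<lambda>x h. g x \<bullet> h" C x y] der on by simp
  qed
  have "(\<integral>x. g x \<bullet> v \<partial>torus) = 0" for v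
  proof -
    let ?d = "\<lambda>n x. (f (x + (1 / Suc n) *\<^sub>R v) - f x) * Suc n"
    have "(\<lambda>n. \<integral>x. ?d n x \<partial>torus) \<longlonglongrightarrow> (\<integral>x. g x \<bullet> v \<partial>torus)"
    proof (rule integral_dominated_convergence[where w = "\<lambda>_. C * norm v"])
      show "AE x in torus. (\<lambda>n. ?d n x) \<longlonglongrightarrow> g x \<bullet> v"
      proof (rule AE_I2)
        fix x
        have "((\<lambda>t. f (x + t *\<^sub>R v)) has_derivative (\<lambda>t. g (x + 0 *\<^sub>R v) \<bullet> (t *\<^sub>R v))) (at 0)"
          by (rule has_derivative_compose[OF _ der]) (auto intro!: derivative_eq_intros)
        then have "((\<lambda>t. f (x + t *\<^sub>R v)) has_real_derivative (g x \<bullet> v)) (at 0)"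
          by (simp add: has_field_derivative_def mult_commute_abs)
        then have "((\<lambda>t. (f (x + t *\<^sub>R v) - f x) / t) \<longlongrightarrow> g x \<bullet> v) (at 0)"
          by (simp add: DERIV_def)
        moreover have "filterlim (\<lambda>n. 1 / real (Suc n)) (at 0) sequentially"
          unfolding filterlim_at using LIMSEQ_Suc[OF lim_const_over_n[of "1::real"]] by (auto intro: always_eventually)
        ultimately have "(\<lambda>n. (f (x + (1 / Suc n) *\<^sub>R v) - f x) / (1 / Suc n)) \<longlonglongrightarrow> g x \<bullet> v"
          by (rule filterlim_compose)
        then show "(\<lambda>n. ?d n x) \<longlonglongrightarrow> g x \<bullet> v" by simp
      qed
      show "AE x in torus. norm (?d n x) \<le> C * norm v" for n
      proof (rule AE_I2)
        fix x
        have "\<bar>?d n x\<bar> \<le> C * norm ((1 / Suc n) *\<^sub>R v) * Suc n"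
          using lip[of "x + (1 / Suc n) *\<^sub>R v" x] by (simp only: abs_mult) (intro mult_mono, auto)
        then show "norm (?d n x) \<le> C * norm v" by simp
      qed
    qed auto
    moreover have "(\<integral>x. ?d n x \<partial>torus) = 0" for n
    proof -
      have "integrable torus (\<lambda>x. f (x + (1 / Suc n) *\<^sub>R v))" "integrable torus f"
        by (auto intro!: integrable_torus_continuous continuous_on_compose2[OF cf] continuous_intros cf)
      then show ?thesis
        using integral_torus_isometry(2)[OF _ per, of 1 "(1 / Suc n) *\<^sub>R v"] by (simp add: add.commute)
    qed
    ultimately show ?thesis by (simp add: LIMSEQ_const_iff)
  qed
  from this[of "\<integral>x. g x \<partial>torus"] show ?thesis
    using integral_inner_left[of "\<integral>x. g x \<partial>torus" torus g] integrable_torus_continuous[OF cont] by simp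
qed

lemma wave_grad_C1:
  assumes per: "periodic f" and der: "\<And>x. (f has_derivative (\<lambda>h. g x \<bullet> h)) (at x)"
    and cont: "continuous_on UNIV g"
  shows "wave_grad f g"
  unfolding wave_grad_def
proof
  fix m
  have cf: "continuous_on UNIV f"
    by (intro continuous_at_imp_continuous_on ballI has_derivative_continuous[OF der])
  have c1: "continuous_on UNIV (\<lambda>x. wave m x *\<^sub>R g x)" "continuous_on UNIV (\<lambda>x. f x *\<^sub>R grad_wave m x)"
    by (intro continuous_intros cf cont)+
  have "(\<integral>x. wave m x *\<^sub>R g x + f x *\<^sub>R grad_wave m x \<partial>torus) = 0"
  proof (rule integral_gradient_zero[where f = "\<lambda>x. wave m x * f x"])
    show "periodic (\<lambda>x. wave m x * f x)" using per periodic_wave[of m] by (simp add: periodic_def)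
    show "((\<lambda>x. wave m x * f x) has_derivative (\<lambda>h. (wave m x *\<^sub>R g x + f x *\<^sub>R grad_wave m x) \<bullet> h)) (at x)" for x
      by (rule has_derivative_eq_rhs[OF has_derivative_mult[OF wave_has_derivative der]])
        (simp add: inner_add_left mult_ac)
  qed (intro continuous_on_add c1)
  then show "(\<integral>x. f x *\<^sub>R grad_wave m x \<partial>torus) = - (\<integral>x. wave m x *\<^sub>R g x \<partial>torus)"
    using c1[THEN integrable_torus_continuous] by (simp add: add_eq_0_iff)
qed

text \<open>A product of two waves is half the sum of two waves, so the product rule for weak gradients
  stays within the class of waves as test functions.\<close>

lemma wave_grad_mult_wave:
  assumes f: "integrable torus f" and G: "integrable torus G" and w: "wave_grad f G"
  shows "wave_grad (\<lambda>x. wave m x * f x) (\<lambda>x. wave m x *\<^sub>R G x + f x *\<^sub>R grad_wave m x)"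
  unfolding wave_grad_def
proof
  fix l
  \<comment> \<open>The two waves in the product-to-sum formula.\<close>
  let ?p = "(fst m + fst l, snd m + snd l)" and ?q = "(fst m - fst l, snd m - snd l)"
  have prod: "wave m x * wave l x = (wave ?p x + wave ?q x) / 2" for x
    using wave_mult[of "fst m" "snd m" x "fst l" "snd l"] by simp
  have dprod: "wave m x *\<^sub>R grad_wave l x + wave l x *\<^sub>R grad_wave m x = (1/2) *\<^sub>R (grad_wave ?p x + grad_wave ?q x)" for x
  proof -
    have d1: "((\<lambda>x. wave m x * wave l x) has_derivative (\<lambda>h. wave m x * (grad_wave l x \<bullet> h) + (grad_wave m x \<bullet> h) * wave l x)) (at x)"
      by (intro has_derivative_mult wave_has_derivative)
    have d2: "((\<lambda>x. (wave ?p x + wave ?q x) * (1/2)) has_derivative (\<lambda>h. ((grad_wave ?p x \<bullet> h) + (grad_wave ?q x \<bullet> h)) * (1/2))) (at x)"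
      by (intro has_derivative_mult_left has_derivative_add wave_has_derivative)
    have eq: "(\<lambda>x. wave m x * wave l x) = (\<lambda>x. (wave ?p x + wave ?q x) * (1/2))" using prod by auto
    have "(\<lambda>h. wave m x * (grad_wave l x \<bullet> h) + (grad_wave m x \<bullet> h) * wave l x)
       = (\<lambda>h. ((grad_wave ?p x \<bullet> h) + (grad_wave ?q x \<bullet> h)) * (1/2))"
      by (rule has_derivative_unique[OF d1[unfolded eq] d2])
    then have "(wave m x *\<^sub>R grad_wave l x + wave l x *\<^sub>R grad_wave m x) \<bullet> h = ((1/2) *\<^sub>R (grad_wave ?p x + grad_wave ?q x)) \<bullet> h" for h
      by (simp add: fun_eq_iff inner_add_left mult_ac)
    then show ?thesis by (rule vector_eq_rdot[THEN iffD1, rule_format])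
  qed
  have fg: "integrable torus (\<lambda>x. f x *\<^sub>R grad_wave k x)" for k by (rule integrable_grad_wave_mult[OF f])
  have wG: "integrable torus (\<lambda>x. wave k x *\<^sub>R G x)" for k by (rule integrable_wave_mult[OF G])
  have wfg: "integrable torus (\<lambda>x. wave k x *\<^sub>R (f x *\<^sub>R grad_wave j x))" for k j by (rule integrable_wave_mult[OF fg])
  have wwG: "integrable torus (\<lambda>x. wave k x *\<^sub>R (wave j x *\<^sub>R G x))" for k j by (rule integrable_wave_mult[OF wG])
  have "(\<integral>x. wave m x *\<^sub>R (f x *\<^sub>R grad_wave l x) \<partial>torus) + (\<integral>x. wave l x *\<^sub>R (f x *\<^sub>R grad_wave m x) \<partial>torus)
      = (\<integral>x. f x *\<^sub>R (wave m x *\<^sub>R grad_wave l x + wave l x *\<^sub>R grad_wave m x) \<partial>torus)"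
    by (subst Bochner_Integration.integral_add[OF wfg wfg, symmetric]) (simp add: scaleR_add_right mult_ac)
  also have "\<dots> = (\<integral>x. (1/2) *\<^sub>R (f x *\<^sub>R grad_wave ?p x + f x *\<^sub>R grad_wave ?q x) \<partial>torus)"
    by (simp add: dprod scaleR_add_right mult_ac)
  also have "\<dots> = (1/2) *\<^sub>R ((\<integral>x. f x *\<^sub>R grad_wave ?p x \<partial>torus) + (\<integral>x. f x *\<^sub>R grad_wave ?q x \<partial>torus))"
    by (subst integral_scaleR_right) (subst Bochner_Integration.integral_add[OF fg fg], simp)
  also have "\<dots> = - ((1/2) *\<^sub>R ((\<integral>x. wave ?p x *\<^sub>R G x \<partial>torus) + (\<integral>x. wave ?q x *\<^sub>R G x \<partial>torus)))"
    by (subst (1 2) w[unfolded wave_grad_def, rule_format]) (simp add: scaleR_add_right scaleR_diff_right)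
  also have "\<dots> = - (\<integral>x. (1/2) *\<^sub>R (wave ?p x *\<^sub>R G x + wave ?q x *\<^sub>R G x) \<partial>torus)"
    by (subst integral_scaleR_right) (subst Bochner_Integration.integral_add[OF wG wG], simp)
  also have "\<dots> = - (\<integral>x. wave l x *\<^sub>R (wave m x *\<^sub>R G x) \<partial>torus)"
    by (simp add: scaleR_add_left[symmetric] mult.commute[of "wave l _"] prod)
  finally have *: "(\<integral>x. wave m x *\<^sub>R (f x *\<^sub>R grad_wave l x) \<partial>torus) + (\<integral>x. wave l x *\<^sub>R (f x *\<^sub>R grad_wave m x) \<partial>torus)
      = - (\<integral>x. wave l x *\<^sub>R (wave m x *\<^sub>R G x) \<partial>torus)" .
  have "(\<integral>x. wave l x *\<^sub>R (wave m x *\<^sub>R G x + f x *\<^sub>R grad_wave m x) \<partial>torus)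
    = (\<integral>x. wave l x *\<^sub>R (wave m x *\<^sub>R G x) \<partial>torus) + (\<integral>x. wave l x *\<^sub>R (f x *\<^sub>R grad_wave m x) \<partial>torus)"
    unfolding scaleR_add_right by (rule Bochner_Integration.integral_add[OF wwG wfg])
  moreover have "(\<integral>x. (wave m x * f x) *\<^sub>R grad_wave l x \<partial>torus) = (\<integral>x. wave m x *\<^sub>R (f x *\<^sub>R grad_wave l x) \<partial>torus)"
    by simp
  ultimately show "(\<integral>x. (wave m x * f x) *\<^sub>R grad_wave l x \<partial>torus)
      = - (\<integral>x. wave l x *\<^sub>R (wave m x *\<^sub>R G x + f x *\<^sub>R grad_wave m x) \<partial>torus)"
    using * by (simp add: algebra_simps eq_neg_iff_add_eq_0)
qed

section \<open>The energy estimate at a fixed time\<close>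

text \<open>The renormalising function \<open>beta\<close> and its first two derivatives. It is convex, attains its
  minimum \<open>1\<close> only at \<open>0\<close>, and \<open>beta1\<close> is bounded, so that \<open>beta1\<close> of an unbounded function can be
  paired with a transport term that is only integrable.\<close>

definition beta :: "real \<Rightarrow> real" where "beta s = sqrt (1 + s\<^sup>2)"
definition beta1 :: "real \<Rightarrow> real" where "beta1 s = s / sqrt (1 + s\<^sup>2)"
definition beta2 :: "real \<Rightarrow> real" where "beta2 s = 1 / (sqrt (1 + s\<^sup>2) * (1 + s\<^sup>2))"

lemma one_plus_sq_pos: "0 < 1 + s\<^sup>2" for s :: real
  by (simp add: add_pos_nonneg)

lemma beta_deriv [derivative_intros]: "(beta has_real_derivative beta1 s) (at s)"
  unfolding beta_def[abs_def] beta1_def using one_plus_sq_pos[of s]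
  by (auto intro!: derivative_eq_intros simp: field_simps)

lemma beta1_deriv: "(beta1 has_real_derivative beta2 s) (at s)"
proof -
  have s: "sqrt (1 + s\<^sup>2) > 0" "sqrt (1 + s\<^sup>2) * sqrt (1 + s\<^sup>2) = 1 + s\<^sup>2" using one_plus_sq_pos[of s] by auto
  have "(beta1 has_real_derivative (1 * sqrt (1 + s\<^sup>2) - s * (s / sqrt (1 + s\<^sup>2))) / (sqrt (1 + s\<^sup>2) * sqrt (1 + s\<^sup>2))) (at s)"
    unfolding beta1_def[abs_def]
    by (rule DERIV_divide) (use beta_deriv[of s] s in \<open>auto simp: beta_def[abs_def] beta1_def\<close>)
  moreover have "(1 * sqrt (1 + s\<^sup>2) - s * (s / sqrt (1 + s\<^sup>2))) / (sqrt (1 + s\<^sup>2) * sqrt (1 + s\<^sup>2)) = beta2 s"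
    using s by (simp add: beta2_def divide_simps power2_eq_square)
  ultimately show ?thesis by simp
qed

lemma beta1_le: "\<bar>beta1 s\<bar> \<le> 1"
proof -
  have "\<bar>s\<bar> \<le> sqrt (1 + s\<^sup>2)" by (rule real_le_rsqrt) simp
  then show ?thesis using one_plus_sq_pos[of s] by (simp add: beta1_def abs_divide)
qed

lemma beta2_bounds: "0 \<le> beta2 s" "beta2 s \<le> 1"
proof -
  show "0 \<le> beta2 s" using one_plus_sq_pos[of s] by (simp add: beta2_def)
  have "1 \<le> sqrt (1 + s\<^sup>2) * (1 + s\<^sup>2)"
    using mult_mono[of 1 "sqrt (1 + s\<^sup>2)" 1 "1 + s\<^sup>2"] by simp
  then show "beta2 s \<le> 1" by (simp add: beta2_def)
qed

lemma continuous_beta [continuous_intros]: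
  "continuous_on S f \<Longrightarrow> continuous_on S (\<lambda>x. beta (f x))"
  "continuous_on S f \<Longrightarrow> continuous_on S (\<lambda>x. beta1 (f x))"
  "continuous_on S f \<Longrightarrow> continuous_on S (\<lambda>x. beta2 (f x))"
  unfolding beta_def beta1_def beta2_def
  using one_plus_sq_pos by (auto intro!: continuous_intros simp: less_imp_neq[symmetric])

lemma beta_borel [measurable]: "beta \<in> borel_measurable borel" "beta1 \<in> borel_measurable borel" "beta2 \<in> borel_measurable borel"
  by (auto intro!: borel_measurable_continuous_onI continuous_intros)

text \<open>The eigenvalue of \<open>- \<Delta>\<close> for the wave \<open>m\<close>.\<close>

definition eigen :: "(int^3) \<times> real \<Rightarrow> real" where
  "eigen m = (2 * pi)\<^sup>2 * (intvec (fst m) \<bullet> intvec (fst m))"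

lemma grad_wave_has_derivative:
  "((\<lambda>x. grad_wave m x $ i) has_derivative (\<lambda>h. (- (2 * pi)\<^sup>2 * intvec (fst m) $ i * wave m x) * (intvec (fst m) \<bullet> h))) (at x)"
  unfolding grad_wave_def wave_def
  by (auto intro!: derivative_eq_intros simp: power2_eq_square)

text \<open>The sum over the modes is \<open>- \<Delta>\<close> of the smoothed function. Integration by parts gives the
  integral of \<open>beta2 (mol N D)\<close> times the squared norm of the gradient of \<open>mol N D\<close>. It is carried out
  for each component \<open>beta1 (mol N D) * \<partial>\<^sub>i (mol N D)\<close> separately.\<close>

lemma dissipation_nonneg:
  assumes D: "L2_torus D" and G: "L2_torus G" and w: "wave_grad D G"
  shows "0 \<le> (\<integral>x. beta1 (mol N D x) * (\<Sum>m\<in>modes N. coef N m * (\<integral>y. wave m y * D y \<partial>torus) * eigen m * wave m x) \<partial>torus)"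
proof -
  note i = L2_torus_integrable[OF D] L2_torus_integrable[OF G]
  define a where "a m = coef N m * (\<integral>y. wave m y * D y \<partial>torus)" for m
  define k where "k m = intvec (fst m)" for m :: "(int^3) \<times> real"
  define H where "H i x = (\<Sum>m\<in>modes N. (a m * (- (2 * pi)\<^sup>2 * k m $ i * wave m x)) *\<^sub>R k m)" for i x
  define g where "g i x = (beta2 (mol N D x) * (mol N G x $ i)) *\<^sub>R mol N G x + beta1 (mol N D x) *\<^sub>R H i x" for i x
  have GN: "mol N G x = (\<Sum>m\<in>modes N. a m *\<^sub>R grad_wave m x)" for x
    using mol_gradient[OF i w] by (simp add: a_def)
  note cD = continuous_mol[OF i(1)] and cG = continuous_mol[OF i(2)]
  have cg: "continuous_on UNIV (g i)" for i
    unfolding g_def H_def by (intro continuous_intros cD cG)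
  have "(\<integral>x. g i x \<partial>torus) = 0" for i
  proof (rule integral_gradient_zero[where f = "\<lambda>x. beta1 (mol N D x) * (mol N G x $ i)"])
    show "periodic (\<lambda>x. beta1 (mol N D x) * (mol N G x $ i))"
      using periodic_mol[of N D] periodic_mol[of N G] by (simp add: periodic_def)
    show "((\<lambda>x. beta1 (mol N D x) * (mol N G x $ i)) has_derivative (\<lambda>h. g i x \<bullet> h)) (at x)" for x
    proof -
      have 1: "((\<lambda>x. beta1 (mol N D x)) has_derivative (\<lambda>h. beta2 (mol N D x) * (mol N G x \<bullet> h))) (at x)"
        by (rule has_derivative_compose[OF mol_has_derivative[OF i w], of beta1 "\<lambda>s. beta2 (mol N D x) * s", simplified])
          (use beta1_deriv in \<open>simp add: has_field_derivative_def\<close>)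
      have 2: "((\<lambda>x. mol N G x $ i) has_derivative (\<lambda>h. H i x \<bullet> h)) (at x)"
      proof -
        have "(\<lambda>x. mol N G x $ i) = (\<lambda>x. \<Sum>m\<in>modes N. a m * (grad_wave m x $ i))"
          by (auto simp: GN)
        moreover have "((\<lambda>x. \<Sum>m\<in>modes N. a m * (grad_wave m x $ i)) has_derivative
            (\<lambda>h. \<Sum>m\<in>modes N. a m * ((- (2 * pi)\<^sup>2 * intvec (fst m) $ i * wave m x) * (intvec (fst m) \<bullet> h)))) (at x)"
          by (intro has_derivative_sum has_derivative_mult_right grad_wave_has_derivative)
        moreover have "(\<lambda>h. \<Sum>m\<in>modes N. a m * ((- (2 * pi)\<^sup>2 * intvec (fst m) $ i * wave m x) * (intvec (fst m) \<bullet> h))) = (\<lambda>h. H i x \<bullet> h)"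
          unfolding H_def k_def inner_sum_left inner_scaleR_left by (simp only: mult.assoc)
        ultimately show ?thesis by simp
      qed
      show ?thesis
        by (rule has_derivative_eq_rhs[OF has_derivative_mult[OF 1 2]])
          (simp add: g_def inner_add_left mult_ac add_ac)
    qed
  qed (rule cg)
  then have gi: "(\<integral>x. g i x $ i \<partial>torus) = 0" for i
    using integral_bounded_linear[OF bounded_linear_vec_nth, of torus "g i" i] integrable_torus_continuous[OF cg] by simp
  have "0 = (\<Sum>i\<in>UNIV. (\<integral>x. g i x $ i \<partial>torus))" by (simp add: gi)
  also have "\<dots> = (\<integral>x. (\<Sum>i\<in>UNIV. g i x $ i) \<partial>torus)"
    by (intro Bochner_Integration.integral_sum[symmetric] integrable_torus_continuous continuous_intros cg)
  also have "\<dots> = (\<integral>x. beta2 (mol N D x) * (norm (mol N G x))\<^sup>2 - beta1 (mol N D x) * (\<Sum>m\<in>modes N. a m * eigen m * wave m x) \<partial>torus)"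
  proof (intro Bochner_Integration.integral_cong refl)
    fix x
    have 1: "(\<Sum>i\<in>UNIV. beta2 (mol N D x) * (mol N G x $ i) * (mol N G x $ i)) = beta2 (mol N D x) * (norm (mol N G x))\<^sup>2"
      unfolding power2_norm_eq_inner inner_vec_def sum_distrib_left inner_real_def mult.assoc ..
    have "(\<Sum>i\<in>UNIV. H i x $ i) = (\<Sum>m\<in>modes N. \<Sum>i\<in>UNIV. a m * (- (2 * pi)\<^sup>2 * k m $ i * wave m x) * (k m $ i))"
      unfolding H_def by (subst sum.swap) simp
    also have "\<dots> = (\<Sum>m\<in>modes N. - (a m * eigen m * wave m x))"
      unfolding eigen_def inner_vec_def k_def inner_real_def
      by (intro sum.cong refl) (simp add: sum_3 algebra_simps)
    finally have 2: "(\<Sum>i\<in>UNIV. H i x $ i) = - (\<Sum>m\<in>modes N. a m * eigen m * wave m x)" by (simp add: sum_negf)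
    have "(\<Sum>i\<in>UNIV. g i x $ i) = (\<Sum>i\<in>UNIV. beta2 (mol N D x) * (mol N G x $ i) * (mol N G x $ i)) + beta1 (mol N D x) * (\<Sum>i\<in>UNIV. H i x $ i)"
      by (simp add: g_def sum.distrib sum_distrib_left)
    then show "(\<Sum>i\<in>UNIV. g i x $ i) = beta2 (mol N D x) * (norm (mol N G x))\<^sup>2 - beta1 (mol N D x) * (\<Sum>m\<in>modes N. a m * eigen m * wave m x)"
      unfolding 1 2 by simp
  qed
  also have "\<dots> = (\<integral>x. beta2 (mol N D x) * (norm (mol N G x))\<^sup>2 \<partial>torus) - (\<integral>x. beta1 (mol N D x) * (\<Sum>m\<in>modes N. a m * eigen m * wave m x) \<partial>torus)"
    by (intro Bochner_Integration.integral_diff integrable_torus_continuous continuous_intros cD cG)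
  finally have "(\<integral>x. beta1 (mol N D x) * (\<Sum>m\<in>modes N. a m * eigen m * wave m x) \<partial>torus) = (\<integral>x. beta2 (mol N D x) * (norm (mol N G x))\<^sup>2 \<partial>torus)"
    by simp
  also have "\<dots> \<ge> 0" by (intro integral_nonneg_AE AE_I2) (simp add: beta2_bounds)
  finally show ?thesis by (simp add: a_def)
qed

text \<open>The field \<open>u\<close> is orthogonal to the gradient of \<open>beta (mol N D)\<close>, which is
  \<open>beta1 (mol N D)\<close> times \<open>mol N G\<close>. Hence only the commutator
  \<open>mol N (u \<bullet> G) - u \<bullet> mol N G\<close> contributes, and it is a kernel mean of \<open>(u y - u x) \<bullet> G y\<close>.\<close>

lemma transport_error:
  assumes u: "L2_torus u" "wave_div_free u"
    and D: "L2_torus D" and G: "L2_torus G" and w: "wave_grad D G"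
  shows "\<bar>\<integral>x. beta1 (mol N D x) * mol N (\<lambda>y. u y \<bullet> G y) x \<partial>torus\<bar> \<le> sqrt (defect N u) * L2_norm G"
proof -
  note i = L2_torus_integrable[OF D] L2_torus_integrable[OF G]
  note cD = continuous_mol[OF i(1)] and cG = continuous_mol[OF i(2)]
  have [measurable]: "u \<in> borel_measurable borel" "G \<in> borel_measurable borel"
    using u G by (auto simp: L2_torus_iff)
  have F: "integrable torus (\<lambda>y. u y \<bullet> G y)" by (rule L2_torus_inner[OF u(1) G])
  have mb: "mol N D \<in> borel_measurable borel" "mol N G \<in> borel_measurable borel" "mol N (\<lambda>y. u y \<bullet> G y) \<in> borel_measurable borel"
    by (intro borel_measurable_continuous_onI cD cG continuous_mol[OF F])+
  note mb[measurable]
  let ?b = "\<lambda>x. beta1 (mol N D x)"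
  have bG: "L2_torus (\<lambda>x. ?b x *\<^sub>R mol N G x)"
    by (rule L2_torus_bounded_mult'[OF L2_torus_mol[OF i(2)], where C=1])
      (use beta1_le periodic_mol[of N D] in \<open>auto simp: periodic_def\<close>)
  have zero: "(\<integral>x. u x \<bullet> (?b x *\<^sub>R mol N G x) \<partial>torus) = 0"
  proof (rule div_free_weak_gradient[OF u _ bG, where \<phi> = "\<lambda>x. beta (mol N D x)"])
    have per: "periodic (\<lambda>x. beta (mol N D x))" by (rule periodicI_comp[OF periodic_mol])
    have c: "continuous_on UNIV (\<lambda>x. beta (mol N D x))" by (intro continuous_intros cD)
    show "L2_torus (\<lambda>x. beta (mol N D x))"
      using periodic_continuous_bounded[OF per c] L2_torus_bounded[OF _ _ per] by (metis borel_measurable_continuous_onI c)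
    show "wave_grad (\<lambda>x. beta (mol N D x)) (\<lambda>x. ?b x *\<^sub>R mol N G x)"
    proof (rule wave_grad_C1[OF per])
      have "((\<lambda>x. beta (mol N D x)) has_derivative (\<lambda>h. beta1 (mol N D x) * (mol N G x \<bullet> h))) (at x)" for x
        by (rule has_derivative_compose[OF mol_has_derivative[OF i w], of beta "\<lambda>s. beta1 (mol N D x) * s", simplified])
          (use beta_deriv in \<open>simp add: has_field_derivative_def\<close>)
      then show "((\<lambda>x. beta (mol N D x)) has_derivative (\<lambda>h. (?b x *\<^sub>R mol N G x) \<bullet> h)) (at x)" for x
        by (simp only: inner_scaleR_left)
    qed (intro continuous_intros cD cG)
  qed
  have int1: "integrable torus (\<lambda>x. ?b x * mol N (\<lambda>y. u y \<bullet> G y) x)"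
    by (intro integrable_torus_continuous continuous_intros cD continuous_mol[OF F])
  have int2: "integrable torus (\<lambda>x. u x \<bullet> (?b x *\<^sub>R mol N G x))" by (rule L2_torus_inner[OF u(1) bG])
  let ?e = "\<lambda>x. mol N (\<lambda>y. u y \<bullet> G y) x - u x \<bullet> mol N G x"
  have eq: "(\<integral>x. ?b x * mol N (\<lambda>y. u y \<bullet> G y) x \<partial>torus) = (\<integral>x. ?b x * ?e x \<partial>torus)"
    using Bochner_Integration.integral_diff[OF int1 int2] zero by (simp add: algebra_simps)
  have int3: "integrable torus (\<lambda>x. ?b x * ?e x)"
    using Bochner_Integration.integrable_diff[OF int1 int2] by (simp add: algebra_simps)
  have "ennreal \<bar>\<integral>x. ?b x * ?e x \<partial>torus\<bar> \<le> (\<integral>\<^sup>+x. ennreal \<bar>?b x * ?e x\<bar> \<partial>torus)"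
    using integral_norm_bound_ennreal[OF int3] by simp
  also have "\<dots> \<le> (\<integral>\<^sup>+x. \<integral>\<^sup>+y. ennreal (cos_kernel N (x - y) * norm (u y - u x) * norm (G y)) \<partial>torus \<partial>torus)"
  proof (rule nn_integral_mono)
    fix x
    have k: "integrable torus (\<lambda>y. cos_kernel N (x - y) *\<^sub>R (u y \<bullet> G y))" "integrable torus (\<lambda>y. cos_kernel N (x - y) *\<^sub>R G y)"
      by (intro integrable_kernel_mult F i)+
    have "u x \<bullet> mol N G x = (\<integral>y. u x \<bullet> (cos_kernel N (x - y) *\<^sub>R G y) \<partial>torus)"
      unfolding mol_def using k(2) by (rule integral_inner_right[symmetric])
    moreover have "integrable torus (\<lambda>y. u x \<bullet> (cos_kernel N (x - y) *\<^sub>R G y))"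
      using k(2) by (rule integrable_inner_right)
    ultimately have e: "?e x = (\<integral>y. cos_kernel N (x - y) *\<^sub>R (u y \<bullet> G y) - u x \<bullet> (cos_kernel N (x - y) *\<^sub>R G y) \<partial>torus)"
      "integrable torus (\<lambda>y. cos_kernel N (x - y) *\<^sub>R (u y \<bullet> G y) - u x \<bullet> (cos_kernel N (x - y) *\<^sub>R G y))"
      using k(1) by (simp_all add: mol_def Bochner_Integration.integral_diff)
    have "ennreal \<bar>?b x * ?e x\<bar> \<le> ennreal \<bar>?e x\<bar>"
      using mult_right_mono[OF beta1_le[of "mol N D x"] abs_ge_zero[of "?e x"]] by (intro ennreal_leI) (simp add: abs_mult)
    also have "\<dots> \<le> (\<integral>\<^sup>+y. ennreal (norm (cos_kernel N (x - y) *\<^sub>R (u y \<bullet> G y) - u x \<bullet> (cos_kernel N (x - y) *\<^sub>R G y))) \<partial>torus)"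
      unfolding e(1) using integral_norm_bound_ennreal[OF e(2)] by simp
    also have "\<dots> \<le> (\<integral>\<^sup>+y. ennreal (cos_kernel N (x - y) * norm (u y - u x) * norm (G y)) \<partial>torus)"
    proof (intro nn_integral_mono ennreal_leI)
      fix y
      have "cos_kernel N (x - y) *\<^sub>R (u y \<bullet> G y) - u x \<bullet> (cos_kernel N (x - y) *\<^sub>R G y) = cos_kernel N (x - y) * ((u y - u x) \<bullet> G y)"
        by (simp add: inner_diff_left algebra_simps)
      then show "norm (cos_kernel N (x - y) *\<^sub>R (u y \<bullet> G y) - u x \<bullet> (cos_kernel N (x - y) *\<^sub>R G y)) \<le> cos_kernel N (x - y) * norm (u y - u x) * norm (G y)"
        using mult_left_mono[OF Cauchy_Schwarz_ineq2[of "u y - u x" "G y"] kernel_nonneg[of N "x - y"]] kernel_nonneg[of N "x - y"]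
        by (simp add: abs_mult mult_ac)
    qed
    finally show "ennreal \<bar>?b x * ?e x\<bar> \<le> (\<integral>\<^sup>+y. ennreal (cos_kernel N (x - y) * norm (u y - u x) * norm (G y)) \<partial>torus)" .
  qed
  also have "\<dots> \<le> ennreal (sqrt (defect N u) * L2_norm G)" by (rule defect_pairing(1)[OF u(1) G])
  finally show ?thesis
    unfolding eq by (simp add: ennreal_le_iff defect_nonneg L2_norm_nonneg)
qed

text \<open>The sum over the modes is the time derivative of \<open>mol N D\<close> that the advection-diffusion equation
  prescribes. Its transport part is \<open>- mol N (u \<bullet> G)\<close> by the product rule and the
  divergence-free condition.\<close>

lemma slice_energy:
  assumes u: "L2_torus u" "wave_div_free u"
    and D: "L2_torus D" and G: "L2_torus G" and w: "wave_grad D G" and nu: "0 \<le> \<nu>"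
  shows "(\<integral>x. beta1 (mol N D x) * (\<Sum>m\<in>modes N. coef N m * wave m x *
       ((\<integral>y. D y * (u y \<bullet> grad_wave m y) \<partial>torus) - \<nu> * eigen m * (\<integral>y. wave m y * D y \<partial>torus))) \<partial>torus)
     \<le> sqrt (defect N u) * L2_norm G"
proof -
  note i = L2_torus_integrable[OF D] L2_torus_integrable[OF G]
  note cD = continuous_mol[OF i(1)]
  have [measurable]: "D \<in> borel_measurable borel" "u \<in> borel_measurable borel" "G \<in> borel_measurable borel" using D u G by (auto simp: L2_torus_iff)
  have F: "integrable torus (\<lambda>y. u y \<bullet> G y)" by (rule L2_torus_inner[OF u(1) G])
  have flux: "(\<integral>y. D y * (u y \<bullet> grad_wave m y) \<partial>torus) = - (\<integral>y. wave m y * (u y \<bullet> G y) \<partial>torus)" for m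
  proof -
    have 1: "L2_torus (\<lambda>x. wave m x *\<^sub>R G x)"
      by (rule L2_torus_bounded_mult'[OF G _ wave_le_1 periodic_wave]) simp
    have 2: "L2_torus (\<lambda>x. D x *\<^sub>R grad_wave m x)"
    proof (rule L2_torus_bounded_mult[OF D])
      show "norm (D x *\<^sub>R grad_wave m x) \<le> (2 * pi * norm (intvec (fst m))) * norm (D x)" for x
        using mult_right_mono[OF norm_grad_wave_le[of m x] norm_ge_zero[of "D x"]] by (simp add: mult_ac)
      show "periodic (\<lambda>x. D x *\<^sub>R grad_wave m x)" using D periodic_grad_wave[of m] by (simp add: periodic_def L2_torus_iff)
    qed simp
    have 3: "L2_torus (\<lambda>x. wave m x * D x)"
      using L2_torus_bounded_mult'[OF D _ wave_le_1 periodic_wave] by simp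
    have "(\<integral>x. u x \<bullet> (wave m x *\<^sub>R G x + D x *\<^sub>R grad_wave m x) \<partial>torus) = 0"
      by (rule div_free_weak_gradient[OF u 3 L2_torus_add[OF 1 2] wave_grad_mult_wave[OF i w]])
    moreover have "(\<integral>x. u x \<bullet> (wave m x *\<^sub>R G x + D x *\<^sub>R grad_wave m x) \<partial>torus)
        = (\<integral>x. u x \<bullet> (wave m x *\<^sub>R G x) \<partial>torus) + (\<integral>x. u x \<bullet> (D x *\<^sub>R grad_wave m x) \<partial>torus)"
      unfolding inner_add_right by (intro Bochner_Integration.integral_add L2_torus_inner u 1 2)
    ultimately show ?thesis by simp
  qed
  let ?b = "\<lambda>x. beta1 (mol N D x)"
  let ?L = "\<lambda>x. \<Sum>m\<in>modes N. coef N m * (\<integral>y. wave m y * D y \<partial>torus) * eigen m * wave m x"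
  have P: "(\<Sum>m\<in>modes N. coef N m * wave m x * ((\<integral>y. D y * (u y \<bullet> grad_wave m y) \<partial>torus) - \<nu> * eigen m * (\<integral>y. wave m y * D y \<partial>torus)))
      = - mol N (\<lambda>y. u y \<bullet> G y) x - \<nu> * ?L x" for x
    unfolding flux mol_expansion[OF F]
    by (simp add: sum_distrib_left sum_subtractf sum_negf right_diff_distrib) (simp add: mult_ac)
  have "(\<integral>x. ?b x * (\<Sum>m\<in>modes N. coef N m * wave m x *
       ((\<integral>y. D y * (u y \<bullet> grad_wave m y) \<partial>torus) - \<nu> * eigen m * (\<integral>y. wave m y * D y \<partial>torus))) \<partial>torus)
     = (\<integral>x. ?b x * (- mol N (\<lambda>y. u y \<bullet> G y) x - \<nu> * ?L x) \<partial>torus)"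
    by (simp only: P)
  also have "\<dots> = (\<integral>x. - (?b x * mol N (\<lambda>y. u y \<bullet> G y) x) - \<nu> * (?b x * ?L x) \<partial>torus)"
    by (simp only: right_diff_distrib mult_minus_right mult.left_commute)
  also have "\<dots> = (\<integral>x. - (?b x * mol N (\<lambda>y. u y \<bullet> G y) x) \<partial>torus) - (\<integral>x. \<nu> * (?b x * ?L x) \<partial>torus)"
    by (intro Bochner_Integration.integral_diff integrable_torus_continuous continuous_intros cD continuous_mol[OF F])
  also have "\<dots> = - (\<integral>x. ?b x * mol N (\<lambda>y. u y \<bullet> G y) x \<partial>torus) - \<nu> * (\<integral>x. ?b x * ?L x \<partial>torus)" by simp
  also have "\<dots> \<le> sqrt (defect N u) * L2_norm G"
    using transport_error[OF u D G w, of N] mult_nonneg_nonneg[OF nu dissipation_nonneg[OF D G w, of N]] by linarith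
  finally show ?thesis .
qed

section \<open>Calculus of continuously differentiable functions\<close>

lemma Ck_SucI:
  assumes "\<And>x. (f has_derivative f' x) (at x)" "\<And>v. Ck k (\<lambda>x. f' x v)"
  shows "Ck (Suc k) f"
proof -
  have "frechet_derivative f (at x) = f' x" for x
    using frechet_derivative_at[OF assms(1)[of x]] by simp
  then show ?thesis using assms by (auto simp: differentiable_def)
qed

lemma Ck_SucD: "Ck (Suc k) f \<Longrightarrow> Ck k f"
proof (induction k arbitrary: f)
  case 0
  then show ?case
    by (auto intro!: differentiable_imp_continuous_on simp: differentiable_on_def differentiable_at_withinI)
next
  case (Suc k)
  then show ?case by (metis Ck.simps(2))
qed

lemma Ck_has_derivative: "Ck (Suc k) f \<Longrightarrow> (f has_derivative frechet_derivative f (at x)) (at x)"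
  by (simp add: frechet_derivative_works[symmetric])

lemma Ck_frechet: "Ck (Suc k) f \<Longrightarrow> Ck k (\<lambda>x. frechet_derivative f (at x) v)"
  by simp

lemma Ck_continuous: "Ck k f \<Longrightarrow> continuous_on UNIV f"
  by (induction k) (simp, blast dest: Ck_SucD)

lemma Ck_const: "Ck k (\<lambda>x. c)"
proof (induction k arbitrary: c)
  case (Suc k)
  show ?case by (rule Ck_SucI[where f' = "\<lambda>_ _. 0"]) (auto simp: Suc)
qed simp

lemma Ck_add: "Ck k f \<Longrightarrow> Ck k g \<Longrightarrow> Ck k (\<lambda>x. f x + g x)"
proof (induction k arbitrary: f g)
  case (Suc k)
  show ?case
    by (rule Ck_SucI[OF has_derivative_add[OF Ck_has_derivative[OF Suc.prems(1)] Ck_has_derivative[OF Suc.prems(2)]]])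
      (intro Suc.IH Ck_frechet Suc.prems)
qed (auto intro: continuous_intros)

lemma Ck_mult:
  fixes f g :: "'a::real_normed_vector \<Rightarrow> real"
  shows "Ck k f \<Longrightarrow> Ck k g \<Longrightarrow> Ck k (\<lambda>x. f x * g x)"
proof (induction k arbitrary: f g)
  case (Suc k)
  show ?case
    by (rule Ck_SucI[OF has_derivative_mult[OF Ck_has_derivative[OF Suc.prems(1)] Ck_has_derivative[OF Suc.prems(2)]]])
      (intro Suc.IH Ck_add Ck_frechet Suc.prems Ck_SucD[OF Suc.prems(1)] Ck_SucD[OF Suc.prems(2)])
qed (auto intro: continuous_intros)

lemma Ck_scaleR_const:
  fixes f :: "'a::real_normed_vector \<Rightarrow> real"
  shows "Ck k f \<Longrightarrow> Ck k (\<lambda>x. f x *\<^sub>R c)"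
proof (induction k arbitrary: f)
  case (Suc k)
  show ?case
    by (rule Ck_SucI[OF has_derivative_scaleR_left[OF Ck_has_derivative[OF Suc.prems(1)]]])
      (intro Suc.IH Ck_frechet Suc.prems)
qed (auto intro: continuous_intros)

lemma Ck_affine:
  assumes L: "bounded_linear L"
  shows "Ck k f \<Longrightarrow> Ck k (\<lambda>x. f (L x + c))"
proof (induction k arbitrary: f)
  case 0
  have "continuous_on UNIV (\<lambda>x. L x + c)"
    by (intro continuous_intros linear_continuous_on L)
  then show ?case using 0 by (auto intro: continuous_on_compose2)
next
  case (Suc k)
  have d: "((\<lambda>x. L x + c) has_derivative L) (at x)" for x
    using has_derivative_add[OF bounded_linear_imp_has_derivative[OF L] has_derivative_const] by simp
  show ?case
    by (rule Ck_SucI[OF has_derivative_compose[OF d Ck_has_derivative[OF Suc.prems(1)]]])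
      (intro Suc.IH Ck_frechet Suc.prems)
qed

lemma Ck_wave: "Ck k (wave m)"
proof (induction k arbitrary: m)
  case 0
  show ?case by (simp add: continuous_wave)
next
  case (Suc k)
  have "(\<lambda>x. grad_wave m x \<bullet> v) = (\<lambda>x. (2 * pi * (intvec (fst m) \<bullet> v)) * wave (fst m, snd m + pi / 2) x)" for v
    by (simp add: grad_wave_def wave_def fun_eq_iff cos_add sin_add algebra_simps)
  then show ?case
    using Suc.IH by (intro Ck_SucI[OF wave_has_derivative]) (simp add: Ck_mult Ck_const)
qed

section \<open>Test functions of time\<close>

text \<open>The classical flat functions \<open>exp (- 1 / x) / x ^ n\<close>, extended by zero. The family is closed under
  differentiation up to linear combinations, which makes its members smooth.\<close>

definition flat :: "nat \<Rightarrow> real \<Rightarrow> real" where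
  "flat n x = (if x \<le> 0 then 0 else exp (- 1 / x) / x ^ n)"

lemma flat_tendsto: "(flat n \<longlongrightarrow> 0) (at 0)"
proof -
  have "((\<lambda>x::real. inverse x ^ n / exp (inverse x)) \<longlongrightarrow> 0) (at_right 0)"
    by (rule filterlim_compose[OF tendsto_power_div_exp_0 filterlim_inverse_at_top_right])
  moreover have "\<forall>\<^sub>F x in at_right 0. inverse x ^ n / exp (inverse x) = flat n x"
    by (auto simp: eventually_at_right_field flat_def exp_minus field_simps intro!: exI[of _ 1])
  ultimately have "(flat n \<longlongrightarrow> 0) (at_right 0)" by (rule Lim_transform_eventually)
  moreover have "(flat n \<longlongrightarrow> 0) (at_left 0)"
    by (rule tendsto_eventually) (auto simp: eventually_at_left_field flat_def intro!: exI[of _ "-1"])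
  ultimately show ?thesis by (simp add: filterlim_split_at)
qed

lemma flat_deriv: "(flat n has_real_derivative (flat (n + 2) x - n * flat (n + 1) x)) (at x)"
proof (cases x "0::real" rule: linorder_cases)
  case less
  have "((\<lambda>_. 0) has_real_derivative 0) (at x)" by simp
  moreover have "\<forall>\<^sub>F y in nhds x. flat n y = 0"
    using less by (auto simp: flat_def intro!: eventually_mono[OF eventually_nhds_in_open[of "{..<0}" x]])
  ultimately show ?thesis using less
    by (subst DERIV_cong_ev[OF refl, of _ "\<lambda>_. 0"]) (auto simp: flat_def)
next
  case equal
  have "((\<lambda>h. (flat n (0 + h) - flat n 0) / h) \<longlongrightarrow> 0) (at 0)"
  proof (rule Lim_transform_eventually[OF flat_tendsto[of "n + 1"]])
    show "\<forall>\<^sub>F h in at 0. flat (n + 1) h = (flat n (0 + h) - flat n 0) / h"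
      by (auto simp: flat_def eventually_at_filter intro!: always_eventually)
  qed
  then show ?thesis using equal by (simp add: DERIV_def flat_def)
next
  case greater
  have "((\<lambda>y. exp (- 1 / y) / y ^ n) has_real_derivative
      ((exp (- 1 / x) * (1 / x ^ 2)) * x ^ n - exp (- 1 / x) * (n * x ^ (n - 1))) / (x ^ n * x ^ n)) (at x)"
    using greater by (auto intro!: derivative_eq_intros simp: power2_eq_square)
  moreover have "((exp (- 1 / x) * (1 / x ^ 2)) * x ^ n - exp (- 1 / x) * (n * x ^ (n - 1))) / (x ^ n * x ^ n)
      = flat (n + 2) x - n * flat (n + 1) x"
    using greater by (cases n) (simp_all add: flat_def field_simps power2_eq_square)
  moreover have "\<forall>\<^sub>F y in nhds x. exp (- 1 / y) / y ^ n = flat n y"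
    using greater by (auto simp: flat_def intro!: eventually_mono[OF eventually_nhds_in_open[of "{0<..}" x]])
  ultimately show ?thesis using DERIV_cong_ev[OF refl _ refl] by fastforce
qed

lemma Ck_flat: "Ck k (flat n)"
proof (induction k arbitrary: n)
  case 0
  have "isCont (flat n) x" for x using flat_deriv by (rule DERIV_isCont)
  then show ?case by (simp add: continuous_at_imp_continuous_on)
next
  case (Suc k)
  have "Ck k (\<lambda>x. (flat (n + 2) x + (- real n) * flat (n + 1) x) * v)" for v
    by (intro Ck_mult Ck_add Ck_const Suc.IH)
  then show ?case
    by (intro Ck_SucI[where f' = "\<lambda>x v. (flat (n + 2) x - n * flat (n + 1) x) * v"])
      (use flat_deriv in \<open>auto simp: has_field_derivative_def\<close>)
qed

definition time_test :: "real \<Rightarrow> (real \<Rightarrow> real) \<Rightarrow> bool" where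
  "time_test T \<zeta> \<longleftrightarrow> smooth \<zeta> \<and> (\<exists>a b. 0 < a \<and> a < b \<and> b < T \<and> (\<forall>t. t \<notin> {a..b} \<longrightarrow> \<zeta> t = 0))"

lemma flat0: "0 \<le> flat 0 x" "flat 0 x \<le> 1"
  by (auto simp: flat_def)

text \<open>Smooth functions that converge to the indicator of \<open>(a, b)\<close>. The offset \<open>(b - a) / 4\<close> cuts the
  support down to a compact subinterval, at distance \<open>(b - a) / (4 n)\<close> from the end points.\<close>

definition plateau :: "real \<Rightarrow> real \<Rightarrow> nat \<Rightarrow> real \<Rightarrow> real" where
  "plateau a b n s = flat 0 (n * (s - a) - (b - a) / 4) * flat 0 (n * (b - s) - (b - a) / 4)"

lemma time_test_plateau:
  assumes "0 \<le> a" "a < b" "b \<le> T" "n \<ge> 1"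
  shows "time_test T (plateau a b n)"
proof -
  define d where "d = (b - a) / (4 * n)"
  have d: "0 < d" "d \<le> (b - a) / 4"
  proof -
    show "0 < d" using assms by (simp add: d_def)
    have "d = ((b - a) / 4) / n" by (simp add: d_def)
    also have "\<dots> \<le> (b - a) / 4" using assms divide_left_mono[of 1 "real n" "(b - a) / 4"] by simp
    finally show "d \<le> (b - a) / 4" .
  qed
  have nd: "n * d = (b - a) / 4" using assms by (simp add: d_def)
  have "smooth (plateau a b n)"
    unfolding smooth_def
  proof
    fix k
    have 1: "Ck k (\<lambda>s. flat 0 (n * s + (- (n * a) - (b - a) / 4)))" "Ck k (\<lambda>s. flat 0 ((- n) * s + (n * b - (b - a) / 4)))"
      by (intro Ck_affine bounded_linear_mult_right Ck_flat)+
    have "plateau a b n = (\<lambda>s::real. flat 0 (n * s + (- (n * a) - (b - a) / 4)) * flat 0 ((- n) * s + (n * b - (b - a) / 4)))"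
      by (simp add: plateau_def fun_eq_iff algebra_simps)
    then show "Ck k (plateau a b n)" using Ck_mult[OF 1] by simp
  qed
  moreover have "plateau a b n t = 0" if "t \<notin> {a + d..b - d}" for t
  proof -
    consider "t < a + d" | "t > b - d" using \<open>t \<notin> _\<close> by force
    then show ?thesis
    proof cases
      case 1
      then have "n * (t - a) \<le> n * d" by (intro mult_left_mono) auto
      then show ?thesis by (simp add: nd plateau_def flat_def)
    next
      case 2
      then have "n * (b - t) \<le> n * d" by (intro mult_left_mono) auto
      then show ?thesis by (simp add: nd plateau_def flat_def)
    qed
  qed
  ultimately show ?thesis
    unfolding time_test_def using assms d
    by (intro conjI exI[of _ "a + d"] exI[of _ "b - d"]) auto
qed

lemma plateau_bounds: "0 \<le> plateau a b n s" "plateau a b n s \<le> 1"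
  unfolding plateau_def using flat0 mult_le_one[OF flat0(2) flat0(1) flat0(2)] by auto

lemma plateau_tendsto:
  assumes "a < b"
  shows "(\<lambda>n. plateau a b n s) \<longlonglongrightarrow> indicator {a<..<b} s"
proof -
  have lim: "(\<lambda>n. flat 0 (real n * r - c)) \<longlonglongrightarrow> 1" if "r > 0" for r c :: real
  proof -
    have "filterlim (\<lambda>n. real n * r - c) at_top sequentially"
      using that by real_asymp
    moreover have "(flat 0 \<longlongrightarrow> 1) at_top"
    proof (rule Lim_transform_eventually)
      have "((\<lambda>x::real. exp (- inverse x)) \<longlongrightarrow> exp (- 0)) at_top"
        by (intro tendsto_intros tendsto_inverse_0_at_top filterlim_ident)
      then show "((\<lambda>x::real. exp (- inverse x)) \<longlongrightarrow> 1) at_top" by simp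
      show "\<forall>\<^sub>F x in at_top. exp (- inverse x) = flat 0 x"
        using eventually_gt_at_top[of 0] by eventually_elim (simp add: flat_def inverse_eq_divide)
    qed
    ultimately show ?thesis by (rule filterlim_compose[rotated])
  qed
  consider "s \<le> a" | "s \<ge> b" | "a < s" "s < b" by linarith
  then show ?thesis
  proof cases
    case 1
    then have "real n * (s - a) - (b - a) / 4 \<le> 0" for n
      using assms mult_nonneg_nonpos[of "real n" "s - a"] by simp
    then show ?thesis using 1 by (simp add: plateau_def flat_def)
  next
    case 2
    then have "real n * (b - s) - (b - a) / 4 \<le> 0" for n
      using assms mult_nonneg_nonpos[of "real n" "b - s"] by simp
    then show ?thesis using 2 by (simp add: plateau_def flat_def)
  next
    case 3
    then have "(\<lambda>n. plateau a b n s) \<longlonglongrightarrow> 1 * 1"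
      unfolding plateau_def by (intro tendsto_mult lim) auto
    then show ?thesis using 3 by simp
  qed
qed

section \<open>Primitives of bounded functions\<close>

lemma set_integrable_interval_bounded:
  fixes f :: "real \<Rightarrow> real"
  assumes "f \<in> borel_measurable borel" "\<And>s. s \<in> {a<..b} \<Longrightarrow> \<bar>f s\<bar> \<le> C"
  shows "set_integrable lborel {a<..b} f"
  unfolding set_integrable_def
proof (rule integrableI_bounded_set_indicator[where B = C])
  show "emeasure lborel {a<..b} < \<infinity>"
    by (rule emeasure_bounded_finite) (rule bounded_subset[OF bounded_closed_interval[of a b]], auto)
qed (use assms in auto)

lemma set_integral_interval_bound:
  fixes f :: "real \<Rightarrow> real"
  assumes "f \<in> borel_measurable borel" "\<And>s. s \<in> {a<..b} \<Longrightarrow> \<bar>f s\<bar> \<le> C" "a \<le> b"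
  shows "\<bar>LINT s:{a<..b}|lborel. f s\<bar> \<le> C * (b - a)"
proof -
  have i: "set_integrable lborel {a<..b} f" by (rule set_integrable_interval_bounded[OF assms(1,2)])
  have c: "set_integrable lborel {a<..b} (\<lambda>_. C)" "set_integrable lborel {a<..b} (\<lambda>_. - C)"
    by (auto intro!: set_integrable_interval_bounded[where C = "\<bar>C\<bar>"])
  have v: "(LINT s:{a<..b}|lborel. r) = r * (b - a)" for r :: real
    using assms(3) by (simp add: set_lebesgue_integral_def)
  have "(LINT s:{a<..b}|lborel. f s) \<le> C * (b - a)"
    unfolding v[symmetric] using assms(2) by (intro set_integral_mono i c) force
  moreover have "- C * (b - a) \<le> (LINT s:{a<..b}|lborel. f s)"
    unfolding v[symmetric] using assms(2) by (intro set_integral_mono i c) force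
  ultimately show ?thesis by simp
qed

lemma set_integral_interval_split:
  fixes f :: "real \<Rightarrow> real"
  assumes "set_integrable lborel {0<..t} f" "0 \<le> s" "s \<le> t"
  shows "(LINT r:{0<..t}|lborel. f r) = (LINT r:{0<..s}|lborel. f r) + (LINT r:{s<..t}|lborel. f r)"
proof -
  have "{0<..t} = {0<..s} \<union> {s<..t}" using assms by auto
  then show ?thesis
    using assms by (simp only:) (intro set_integral_Un set_integrable_subset[OF assms(1)], auto)
qed

text \<open>Subdividing \<open>[0, T]\<close> into \<open>n\<close> equal parts bounds the total increment by a multiple of \<open>1 / n\<close>.\<close>

lemma const_if_quadratic:
  fixes V :: "real \<Rightarrow> real"
  assumes V: "\<And>s t. 0 \<le> s \<Longrightarrow> s \<le> t \<Longrightarrow> t \<le> T \<Longrightarrow> \<bar>V t - V s\<bar> \<le> C * (t - s)\<^sup>2" and T: "0 \<le> T"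
  shows "V T = V 0"
proof -
  have "\<bar>V T - V 0\<bar> \<le> C * T\<^sup>2 / n" if n: "n > 0" for n :: nat
  proof -
    define p where "p i = real i * (T / n)" for i
    have p: "0 \<le> p i" "p i \<le> p (Suc i)" for i using T by (auto simp: p_def intro!: mult_right_mono divide_right_mono)
    have pT: "p (Suc i) \<le> T" if "i < n" for i
    proof -
      have "real (Suc i) * T \<le> real n * T" using that T by (intro mult_right_mono) auto
      then show ?thesis using n by (simp add: p_def field_simps)
    qed
    have step: "\<bar>V (p (Suc i)) - V (p i)\<bar> \<le> C * (T / n)\<^sup>2" if "i < n" for i
    proof -
      have "p (Suc i) - p i = T / n" by (simp add: p_def distrib_right add_divide_distrib)
      then show ?thesis using V[OF p(1)[of i] p(2)[of i] pT[OF that]] by simp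
    qed
    have "V T - V 0 = (\<Sum>i<n. V (p (Suc i)) - V (p i))"
      using n by (subst sum_lessThan_telescope) (simp add: p_def)
    then have "\<bar>V T - V 0\<bar> \<le> (\<Sum>i<n. \<bar>V (p (Suc i)) - V (p i)\<bar>)" by simp
    also have "\<dots> \<le> (\<Sum>i<n. C * (T / n)\<^sup>2)" by (intro sum_mono step) auto
    also have "\<dots> = C * T\<^sup>2 / n" using n by (simp add: power2_eq_square)
    finally show ?thesis .
  qed
  then have "\<forall>n\<ge>1. \<bar>V T - V 0\<bar> \<le> C * T\<^sup>2 / real n" by auto
  moreover have "(\<lambda>n. C * T\<^sup>2 / real n) \<longlonglongrightarrow> 0" by (rule lim_const_over_n)
  ultimately have "\<bar>V T - V 0\<bar> \<le> 0" by (meson LIMSEQ_le_const)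
  then show ?thesis by simp
qed

definition primitive :: "(real \<Rightarrow> real) \<Rightarrow> real \<Rightarrow> real" where
  "primitive g t = (LINT s:{0<..t}|lborel. g s)"

lemma primitive_0 [simp]: "primitive g 0 = 0"
  by (simp add: primitive_def set_lebesgue_integral_def)

lemma primitive_diff:
  assumes [measurable]: "g \<in> borel_measurable borel" and C: "\<And>s. \<bar>g s\<bar> \<le> C" and "0 \<le> s" "s \<le> t"
  shows "primitive g t - primitive g s = (LINT r:{s<..t}|lborel. g r)"
  unfolding primitive_def
  by (subst set_integral_interval_split[where s = s]) (use assms in \<open>auto intro: set_integrable_interval_bounded[where C = C]\<close>)

lemma primitive_lipschitz:
  assumes "g \<in> borel_measurable borel" and "\<And>s. \<bar>g s\<bar> \<le> C" and "0 \<le> s" "s \<le> t"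
  shows "\<bar>primitive g t - primitive g s\<bar> \<le> C * (t - s)"
  unfolding primitive_diff[OF assms] by (rule set_integral_interval_bound) (use assms in auto)

lemma primitive_borel [measurable]:
  assumes [measurable]: "g \<in> borel_measurable borel"
  shows "primitive g \<in> borel_measurable borel"
proof -
  have "(\<lambda>t. \<integral>s. (\<lambda>(t, s). indicator {0<..t} s *\<^sub>R g s) (t, s) \<partial>lborel) \<in> borel_measurable borel"
  proof (rule lborel.borel_measurable_lebesgue_integral)
    have "indicator {0<..t} s * g s = (if 0 < s \<and> s \<le> t then g s else 0)" for t s by simp
    then show "(\<lambda>(t, s). (\<lambda>(t, s). indicator {0<..t} s *\<^sub>R g s) (t, s)) \<in> borel_measurable (borel \<Otimes>\<^sub>M lborel)"
      by (simp only: prod.case real_scaleR_def) measurable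
  qed
  then show ?thesis by (simp add: primitive_def[abs_def] set_lebesgue_integral_def)
qed

text \<open>The difference of the two sides has increments of second order in the step: by the mean value
  theorem an increment of \<open>b (primitive g t)\<close> is \<open>b1\<close> at some intermediate point times the integral of \<open>g\<close>,
  and \<open>b1\<close> varies only linearly in the step. This replaces differentiation of the
  primitive, which is only Lipschitz continuous.\<close>

lemma chain_rule_primitive:
  fixes b b1 :: "real \<Rightarrow> real"
  assumes g [measurable]: "g \<in> borel_measurable borel" and C: "\<And>s. \<bar>g s\<bar> \<le> C"
    and b: "\<And>x. (b has_real_derivative b1 x) (at x)" and lip: "\<And>x y. \<bar>b1 x - b1 y\<bar> \<le> L * \<bar>x - y\<bar>"
    and [measurable]: "b1 \<in> borel_measurable borel" and T: "0 \<le> T"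
  shows "b (primitive g T) - b 0 = (LINT s:{0<..T}|lborel. b1 (primitive g s) * g s)"
proof -
  let ?h = "primitive g"
  have C0: "0 \<le> C" using C[of 0] by linarith
  have L0: "0 \<le> L" using lip[of 1 0] by (simp add: order_trans[OF abs_ge_zero])
  have hb: "\<bar>?h s\<bar> \<le> C * T" if "0 \<le> s" "s \<le> T" for s
    using primitive_lipschitz[OF g C order_refl that(1)] mult_left_mono[OF that(2) C0] by simp
  have b1b: "\<bar>b1 (?h s) * g s\<bar> \<le> (\<bar>b1 0\<bar> + L * (C * T)) * C" if "0 \<le> s" "s \<le> T" for s
  proof -
    have "\<bar>b1 (?h s)\<bar> \<le> \<bar>b1 0\<bar> + L * \<bar>?h s\<bar>" using lip[of "?h s" 0] by simp
    also have "\<dots> \<le> \<bar>b1 0\<bar> + L * (C * T)" using hb[OF that] L0 by (intro add_left_mono mult_left_mono)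
    finally show ?thesis unfolding abs_mult using C[of s] by (intro mult_mono) auto
  qed
  have int: "set_integrable lborel {0<..t} (\<lambda>s. b1 (?h s) * g s)" if "t \<le> T" for t
    by (rule set_integrable_interval_bounded[where C = "(\<bar>b1 0\<bar> + L * (C * T)) * C"]) (use b1b that in auto)
  \<comment> \<open>The difference of the two sides, whose increments are shown to be quadratic.\<close>
  define V where "V t = b (?h t) - (LINT s:{0<..t}|lborel. b1 (?h s) * g s)" for t
  have "V T = V 0"
  proof (rule const_if_quadratic[OF _ T])
    fix s t assume st: "0 \<le> s" "s \<le> t" "t \<le> T"
    have "\<exists>z. \<bar>z - ?h s\<bar> \<le> \<bar>?h t - ?h s\<bar> \<and> b (?h t) - b (?h s) = (?h t - ?h s) * b1 z"
    proof (cases "?h s" "?h t" rule: linorder_cases)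
      case less
      then obtain z where "?h s < z" "z < ?h t" "b (?h t) - b (?h s) = (?h t - ?h s) * b1 z"
        using MVT2[of "?h s" "?h t" b b1] b by blast
      then show ?thesis by (intro exI[of _ z]) auto
    next
      case greater
      then obtain z where "?h t < z" "z < ?h s" "b (?h s) - b (?h t) = (?h s - ?h t) * b1 z"
        using MVT2[of "?h t" "?h s" b b1] b by blast
      then show ?thesis by (intro exI[of _ z]) (auto simp: algebra_simps)
    qed auto
    then obtain z where z: "\<bar>z - ?h s\<bar> \<le> \<bar>?h t - ?h s\<bar>" "b (?h t) - b (?h s) = (?h t - ?h s) * b1 z" by blast
    have ig: "set_integrable lborel {s<..t} g" by (rule set_integrable_interval_bounded[OF g C])
    have ih: "set_integrable lborel {s<..t} (\<lambda>r. b1 (?h r) * g r)"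
      by (rule set_integrable_subset[OF int[OF st(3)]]) (use st in auto)
    have "V t - V s = b1 z * (?h t - ?h s) - (LINT r:{s<..t}|lborel. b1 (?h r) * g r)"
      using set_integral_interval_split[OF int[OF st(3)] st(1,2)] z(2) by (simp add: V_def mult.commute)
    also have "\<dots> = (LINT r:{s<..t}|lborel. b1 z * g r) - (LINT r:{s<..t}|lborel. b1 (?h r) * g r)"
      by (simp add: primitive_diff[OF g C st(1,2)])
    also have "\<dots> = (LINT r:{s<..t}|lborel. b1 z * g r - b1 (?h r) * g r)"
      by (rule set_integral_diff(2)[symmetric]) (use ig ih in auto)
    finally have eq: "V t - V s = (LINT r:{s<..t}|lborel. b1 z * g r - b1 (?h r) * g r)" .
    have "\<bar>V t - V s\<bar> \<le> (L * (2 * (C * (t - s))) * C) * (t - s)"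
      unfolding eq
    proof (rule set_integral_interval_bound)
      fix r assume r: "r \<in> {s<..t}"
      have "\<bar>z - ?h r\<bar> \<le> \<bar>z - ?h s\<bar> + \<bar>?h r - ?h s\<bar>" by linarith
      also have "\<dots> \<le> C * (t - s) + C * (r - s)"
        using z(1) primitive_lipschitz[OF g C st(1,2)] primitive_lipschitz[OF g C st(1), of r] r by auto
      also have "\<dots> \<le> 2 * (C * (t - s))" using mult_left_mono[of "r - s" "t - s" C] C0 r by auto
      finally have zr: "\<bar>z - ?h r\<bar> \<le> 2 * (C * (t - s))" .
      have "\<bar>b1 z - b1 (?h r)\<bar> \<le> L * (2 * (C * (t - s)))"
        using lip[of z "?h r"] mult_left_mono[OF zr L0] by linarith
      then have "\<bar>b1 z - b1 (?h r)\<bar> * \<bar>g r\<bar> \<le> (L * (2 * (C * (t - s)))) * C"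
        using C[of r] by (intro mult_mono) (use L0 C0 st in auto)
      then show "\<bar>b1 z * g r - b1 (?h r) * g r\<bar> \<le> L * (2 * (C * (t - s))) * C"
        by (simp add: abs_mult[symmetric] left_diff_distrib)
    qed (use st in auto)
    then show "\<bar>V t - V s\<bar> \<le> (2 * L * C\<^sup>2) * (t - s)\<^sup>2"
      by (simp add: power2_eq_square mult_ac)
  qed
  then show ?thesis by (simp add: V_def set_lebesgue_integral_def)
qed

section \<open>Weak derivatives on an interval\<close>

lemma set_integral_Ioo_Ioc:
  fixes f :: "real \<Rightarrow> real"
  assumes "f \<in> borel_measurable borel"
  shows "(LINT t:{a<..<b}|lborel. f t) = (LINT t:{a<..b}|lborel. f t)"
  unfolding set_lebesgue_integral_def
proof (rule integral_cong_AE)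
  show "AE t in lborel. indicator {a<..<b} t *\<^sub>R f t = indicator {a<..b} t *\<^sub>R f t"
    using AE_lborel_singleton[of b] by eventually_elim (auto simp: indicator_def)
qed (use assms in auto)

text \<open>The positive and the negative part of \<open>f\<close> are densities of two finite measures that agree on all
  half-lines, hence are equal.\<close>

lemma AE_zero_if_interval_integrals_zero:
  fixes f :: "real \<Rightarrow> real"
  assumes f [measurable]: "f \<in> borel_measurable borel" and C: "\<And>s. s \<in> {0<..T} \<Longrightarrow> \<bar>f s\<bar> \<le> C"
    and zero: "\<And>a b. 0 \<le> a \<Longrightarrow> a < b \<Longrightarrow> b \<le> T \<Longrightarrow> (LINT s:{a<..b}|lborel. f s) = 0"
  shows "AE t in lborel. t \<in> {0<..T} \<longrightarrow> f t = 0"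
proof -
  define F where "F s = indicator {0<..T} s * f s" for s
  have [measurable]: "F \<in> borel_measurable borel" unfolding F_def by measurable
  have Fi: "integrable lborel F"
    using set_integrable_interval_bounded[of f 0 T C, OF f C] by (simp add: F_def[abs_def] set_integrable_def)
  have fin: "(\<integral>\<^sup>+s. ennreal (F s) \<partial>lborel) < \<infinity>" "(\<integral>\<^sup>+s. ennreal (- F s) \<partial>lborel) < \<infinity>"
    using Fi by (simp_all add: real_integrable_def top.not_eq_extremum)
  have eq: "(\<integral>\<^sup>+s. ennreal (F s) * indicator {x<..} s \<partial>lborel) = (\<integral>\<^sup>+s. ennreal (- F s) * indicator {x<..} s \<partial>lborel)" for x
  proof -
    let ?G = "\<lambda>s. indicator {x<..} s * F s"
    have Gi: "integrable lborel ?G" using integrable_mult_indicator[of "{x<..}" lborel F] Fi by simp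
    have "(\<integral>s. ?G s \<partial>lborel) = 0"
    proof (cases "max x 0 < T")
      case True
      have "(\<integral>s. ?G s \<partial>lborel) = (LINT s:{max x 0<..T}|lborel. f s)"
        unfolding set_lebesgue_integral_def
        by (intro Bochner_Integration.integral_cong refl) (auto simp: F_def indicator_def)
      then show ?thesis using zero[OF _ True order_refl] by simp
    next
      case False
      then have "?G = (\<lambda>s. 0)" by (auto simp: F_def indicator_def fun_eq_iff)
      then show ?thesis by simp
    qed
    moreover have g: "(\<integral>\<^sup>+s. ennreal (?G s) \<partial>lborel) \<noteq> \<infinity>" "(\<integral>\<^sup>+s. ennreal (- ?G s) \<partial>lborel) \<noteq> \<infinity>"
      using Gi by (simp_all add: real_integrable_def)
    ultimately have e: "enn2real (\<integral>\<^sup>+s. ennreal (?G s) \<partial>lborel) = enn2real (\<integral>\<^sup>+s. ennreal (- ?G s) \<partial>lborel)"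
      using real_lebesgue_integral_def[OF Gi] by simp
    have fin_eq: "X = Y" if "enn2real X = enn2real Y" "X \<noteq> \<infinity>" "Y \<noteq> \<infinity>" for X Y :: ennreal
      using that by (cases X rule: ennreal_cases; cases Y rule: ennreal_cases) auto
    have "(\<integral>\<^sup>+s. ennreal (?G s) \<partial>lborel) = (\<integral>\<^sup>+s. ennreal (- ?G s) \<partial>lborel)"
      by (rule fin_eq[OF e g])
    moreover have "ennreal (?G s) = ennreal (F s) * indicator {x<..} s" "ennreal (- ?G s) = ennreal (- F s) * indicator {x<..} s" for s
      by (auto simp: indicator_def)
    ultimately show ?thesis by simp
  qed
  have "density lborel (\<lambda>s. ennreal (F s)) = density lborel (\<lambda>s. ennreal (- F s))"
  proof (rule measure_eqI_lessThan)
    show "emeasure (density lborel (\<lambda>s. ennreal (F s))) {x<..} < \<infinity>" for x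
    proof -
      have "(\<integral>\<^sup>+s. ennreal (F s) * indicator {x<..} s \<partial>lborel) \<le> (\<integral>\<^sup>+s. ennreal (F s) \<partial>lborel)"
        by (intro nn_integral_mono) (auto simp: indicator_def)
      then show ?thesis using fin by (simp add: emeasure_density)
    qed
    show "emeasure (density lborel (\<lambda>s. ennreal (F s))) {x<..} = emeasure (density lborel (\<lambda>s. ennreal (- F s))) {x<..}" for x
      by (simp add: emeasure_density eq)
  qed auto
  then have "AE s in lborel. ennreal (F s) = ennreal (- F s)"
    using fin by (subst (asm) finite_density_unique) auto
  then show ?thesis
  proof eventually_elim
    case (elim s)
    then have "F s = 0" by (cases "F s \<ge> 0") (auto simp: ennreal_neg ennreal_eq_0_iff)
    then show ?case by (auto simp: F_def)
  qed
qed

lemma time_test_continuous: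
  assumes "time_test T \<zeta>" shows "continuous_on UNIV \<zeta>"
  using assms unfolding time_test_def smooth_def by (metis Ck_continuous)

lemma time_test_borel:
  assumes "time_test T \<zeta>" shows "\<zeta> \<in> borel_measurable borel"
  by (intro borel_measurable_continuous_onI time_test_continuous[OF assms])

lemma time_test_bounded:
  assumes "time_test T \<zeta>" obtains C where "\<And>s. \<bar>\<zeta> s\<bar> \<le> C" "0 \<le> C"
proof -
  obtain a b where ab: "\<And>t. t \<notin> {a..b} \<Longrightarrow> \<zeta> t = 0" using assms unfolding time_test_def by blast
  have "compact (\<zeta> ` {a..b})"
    by (intro compact_continuous_image continuous_on_subset[OF time_test_continuous[OF assms]]) auto
  then obtain C where C: "\<And>y. y \<in> \<zeta> ` {a..b} \<Longrightarrow> norm y \<le> C"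
    using compact_imp_bounded bounded_iff by metis
  have "\<bar>\<zeta> s\<bar> \<le> max C 0" for s
  proof (cases "s \<in> {a..b}")
    case True then show ?thesis using C[of "\<zeta> s"] by auto
  qed (use ab in auto)
  then show ?thesis by (rule that) simp
qed

lemma AE_zero_if_tests_zero:
  fixes k :: "real \<Rightarrow> real"
  assumes k [measurable]: "k \<in> borel_measurable borel" and C: "\<And>s. s \<in> {0<..T} \<Longrightarrow> \<bar>k s\<bar> \<le> C"
    and zero: "\<And>\<zeta>. time_test T \<zeta> \<Longrightarrow> (LINT s:{0<..T}|lborel. k s * \<zeta> s) = 0"
  shows "AE t in lborel. t \<in> {0<..T} \<longrightarrow> k t = 0"
proof (rule AE_zero_if_interval_integrals_zero[OF k C])
  fix a b :: real assume ab: "0 \<le> a" "a < b" "b \<le> T"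
  have C0: "0 \<le> C" using C[of T] ab by force
  have pm: "plateau a b n \<in> borel_measurable borel" if "n \<ge> 1" for n
    using time_test_borel[OF time_test_plateau[OF ab that]] .
  have "(\<lambda>n. \<integral>s. indicator {0<..T} s * (k s * plateau a b (Suc n) s) \<partial>lborel)
     \<longlonglongrightarrow> (\<integral>s. indicator {0<..T} s * (k s * indicator {a<..<b} s) \<partial>lborel)"
  proof (rule integral_dominated_convergence[where w = "\<lambda>s. indicator {0<..T} s * C"])
    show "(\<lambda>s. indicator {0<..T} s * (k s * plateau a b (Suc n) s)) \<in> borel_measurable lborel" for n
      using pm[of "Suc n"] by measurable
    show "integrable lborel (\<lambda>s. indicator {0<..T} s * C :: real)"
      using set_integrable_interval_bounded[of "\<lambda>_. C" 0 T "\<bar>C\<bar>"] by (simp add: set_integrable_def)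
    show "AE s in lborel. (\<lambda>n. indicator {0<..T} s * (k s * plateau a b (Suc n) s)) \<longlonglongrightarrow> indicator {0<..T} s * (k s * indicator {a<..<b} s)"
      by (intro AE_I2 tendsto_intros LIMSEQ_Suc[OF plateau_tendsto[OF ab(2)]])
    show "AE s in lborel. norm (indicator {0<..T} s * (k s * plateau a b (Suc n) s)) \<le> indicator {0<..T} s * C" for n
    proof (rule AE_I2)
      fix s
      have "s \<in> {0<..T} \<Longrightarrow> \<bar>k s\<bar> * \<bar>plateau a b (Suc n) s\<bar> \<le> C * 1"
        using C[of s] plateau_bounds[of a b "Suc n" s] C0 by (intro mult_mono) auto
      then show "norm (indicator {0<..T} s * (k s * plateau a b (Suc n) s)) \<le> indicator {0<..T} s * C"
        by (auto simp: indicator_def abs_mult)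
    qed
  qed auto
  moreover have "(\<integral>s. indicator {0<..T} s * (k s * plateau a b (Suc n) s) \<partial>lborel) = 0" for n
    using zero[OF time_test_plateau[OF ab, of "Suc n"]] by (simp add: set_lebesgue_integral_def)
  ultimately have "(\<integral>s. indicator {0<..T} s * (k s * indicator {a<..<b} s) \<partial>lborel) = 0"
    by (simp add: LIMSEQ_const_iff)
  also have "(\<integral>s. indicator {0<..T} s * (k s * indicator {a<..<b} s) \<partial>lborel) = (LINT s:{a<..<b}|lborel. k s)"
    unfolding set_lebesgue_integral_def
    by (intro Bochner_Integration.integral_cong refl) (use ab in \<open>auto simp: indicator_def\<close>)
  finally show "(LINT s:{a<..b}|lborel. k s) = 0" by (simp add: set_integral_Ioo_Ioc)
qed

lemma primitive_add:
  assumes [measurable]: "f \<in> borel_measurable borel" "g \<in> borel_measurable borel"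
    and "\<And>s. \<bar>f s\<bar> \<le> C" "\<And>s. \<bar>g s\<bar> \<le> C'"
  shows "primitive (\<lambda>s. f s + g s) t = primitive f t + primitive g t"
  unfolding primitive_def
  by (intro set_integral_add set_integrable_interval_bounded[where C = C] set_integrable_interval_bounded[where C = C'] assms)

lemma primitive_bound:
  assumes "g \<in> borel_measurable borel" "\<And>s. \<bar>g s\<bar> \<le> C" "0 \<le> s" "s \<le> T"
  shows "\<bar>primitive g s\<bar> \<le> C * T"
proof -
  have "0 \<le> C" using assms(2)[of 0] by linarith
  then show ?thesis
    using primitive_lipschitz[OF assms(1,2) order_refl assms(3)] mult_left_mono[OF assms(4)] by fastforce
qed

text \<open>Integration by parts, obtained from the chain rule for the square by polarisation.\<close>

lemma primitive_mult:
  assumes f [measurable]: "f \<in> borel_measurable borel" and g [measurable]: "g \<in> borel_measurable borel"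
    and C: "\<And>s. \<bar>f s\<bar> \<le> C" and C': "\<And>s. \<bar>g s\<bar> \<le> C'" and T: "0 \<le> T"
  shows "primitive f T * primitive g T
    = (LINT s:{0<..T}|lborel. f s * primitive g s) + (LINT s:{0<..T}|lborel. primitive f s * g s)"
proof -
  have sq: "(primitive k T)\<^sup>2 = (LINT s:{0<..T}|lborel. 2 * primitive k s * k s)"
    if "k \<in> borel_measurable borel" "\<And>s. \<bar>k s\<bar> \<le> c" for k c
  proof -
    have "\<bar>2 * x - 2 * y\<bar> \<le> 2 * \<bar>x - y\<bar>" for x y :: real
      unfolding right_diff_distrib[symmetric] abs_mult by simp
    moreover have "((\<lambda>x. x\<^sup>2) has_real_derivative 2 * x) (at x)" for x :: real
      by (auto intro!: derivative_eq_intros)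
    ultimately show ?thesis
      using chain_rule_primitive[OF that, of "\<lambda>x. x\<^sup>2" "\<lambda>x. 2 * x" 2 T] T by simp
  qed
  have int: "set_integrable lborel {0<..T} (\<lambda>s. p s * primitive q s)"
    if [measurable]: "p \<in> borel_measurable borel" "q \<in> borel_measurable borel" and "\<And>s. \<bar>p s\<bar> \<le> c" "\<And>s. \<bar>q s\<bar> \<le> d" for p q c d
  proof (rule set_integrable_interval_bounded[where C = "c * (d * T)"])
    fix s assume "s \<in> {0<..T}"
    then show "\<bar>p s * primitive q s\<bar> \<le> c * (d * T)"
      unfolding abs_mult using that(3)[of s] primitive_bound[OF that(2,4), of s T]
      by (intro mult_mono) (auto intro: order_trans[OF abs_ge_zero])
  qed measurable
  note i = int[OF f f C C] int[OF f g C C'] int[OF g f C' C] int[OF g g C' C']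
  have i': "set_integrable lborel {0<..T} (\<lambda>s. primitive f s * g s)" using i(3) by (simp add: mult.commute)
  have "\<bar>f s + g s\<bar> \<le> C + C'" for s using C[of s] C'[of s] by linarith
  from sq[of "\<lambda>s. f s + g s", OF _ this] have "(primitive f T + primitive g T)\<^sup>2
     = (LINT s:{0<..T}|lborel. 2 * (primitive f s + primitive g s) * (f s + g s))"
    using primitive_add[OF f g C C'] by simp
  also have "\<dots> = (LINT s:{0<..T}|lborel. 2 * (f s * primitive f s) + 2 * (g s * primitive g s) + 2 * (f s * primitive g s + primitive f s * g s))"
    by (simp add: algebra_simps)
  also have "\<dots> = 2 * (LINT s:{0<..T}|lborel. f s * primitive f s) + 2 * (LINT s:{0<..T}|lborel. g s * primitive g s)
     + 2 * ((LINT s:{0<..T}|lborel. f s * primitive g s) + (LINT s:{0<..T}|lborel. primitive f s * g s))"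
    using i i' by (simp add: set_integral_add)
  also have "2 * (LINT s:{0<..T}|lborel. f s * primitive f s) = (primitive f T)\<^sup>2"
    unfolding sq[OF f C] set_integral_mult_right[symmetric] by (simp only: mult_ac)
  also have "2 * (LINT s:{0<..T}|lborel. g s * primitive g s) = (primitive g T)\<^sup>2"
    unfolding sq[OF g C'] set_integral_mult_right[symmetric] by (simp only: mult_ac)
  finally show ?thesis by (simp add: power2_eq_square algebra_simps)
qed

lemma FTC_primitive:
  assumes "\<And>t. (F has_real_derivative f t) (at t)" "continuous_on UNIV f" "a \<le> b"
  shows "(LINT s:{a<..b}|lborel. f s) = F b - F a"
proof -
  have [measurable]: "f \<in> borel_measurable borel" by (intro borel_measurable_continuous_onI assms)
  have "(\<integral>x. indicator {a..b} x *\<^sub>R f x \<partial>lborel) = F b - F a"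
    using assms
    by (intro integral_FTC_atLeastAtMost)
      (auto simp: has_real_derivative_iff_has_vector_derivative[symmetric]
        intro: has_field_derivative_at_within continuous_on_subset)
  also have "(\<integral>x. indicator {a..b} x *\<^sub>R f x \<partial>lborel) = (\<integral>x. indicator {a<..b} x *\<^sub>R f x \<partial>lborel)"
  proof (rule integral_cong_AE)
    show "AE t in lborel. indicator {a..b} t *\<^sub>R f t = indicator {a<..b} t *\<^sub>R f t"
      using AE_lborel_singleton[of a] by eventually_elim (auto simp: indicator_def)
  qed simp_all
  finally show ?thesis by (simp add: set_lebesgue_integral_def)
qed

lemma time_test_lincomb:
  assumes "time_test T f" "time_test T g"
  shows "time_test T (\<lambda>t. f t + c * g t)"
proof -
  obtain a b where ab: "0 < a" "a < b" "b < T" "\<And>t. t \<notin> {a..b} \<Longrightarrow> f t = 0" "smooth f"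
    using assms(1) unfolding time_test_def by blast
  obtain a' b' where ab': "0 < a'" "a' < b'" "b' < T" "\<And>t. t \<notin> {a'..b'} \<Longrightarrow> g t = 0" "smooth g"
    using assms(2) unfolding time_test_def by blast
  have "smooth (\<lambda>t. f t + c * g t)"
    using ab(5) ab'(5) unfolding smooth_def by (intro allI Ck_add Ck_mult Ck_const) auto
  show ?thesis
    unfolding time_test_def
  proof (rule conjI, rule \<open>smooth (\<lambda>t. f t + c * g t)\<close>, rule exI[of _ "min a a'"], rule exI[of _ "max b b'"], intro conjI allI impI)
    fix t assume "t \<notin> {min a a'..max b b'}"
    then have "t \<notin> {a..b}" "t \<notin> {a'..b'}" by auto
    then show "f t + c * g t = 0" using ab(4) ab'(4) by simp
  qed (use ab ab' in auto)
qed

text \<open>The antiderivative that vanishes at \<open>0\<close> is constant outside the support of \<open>w\<close>, and zero to the right of it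
  because \<open>w\<close> has integral zero.\<close>

lemma time_test_antiderivative:
  assumes w: "time_test T w" and zero: "(LINT s:{0<..T}|lborel. w s) = 0"
  obtains F where "time_test T F" "\<And>t. (F has_real_derivative w t) (at t)"
proof -
  obtain a b where ab: "0 < a" "a < b" "b < T" "\<And>t. t \<notin> {a..b} \<Longrightarrow> w t = 0" and sm: "smooth w"
    using w unfolding time_test_def by blast
  have cont: "continuous_on UNIV w" by (rule time_test_continuous[OF w])
  have "\<exists>F. \<forall>x::real. - \<infinity> < ereal x \<longrightarrow> ereal x < \<infinity> \<longrightarrow> (F has_vector_derivative w x) (at x)"
    using cont by (intro einterval_antiderivative) (auto simp: continuous_on_eq_continuous_at)
  then obtain F0 where F0: "\<And>x. (F0 has_real_derivative w x) (at x)"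
    by (auto simp: has_real_derivative_iff_has_vector_derivative)
  define F where "F t = F0 t - F0 0" for t
  have F: "(F has_real_derivative w x) (at x)" for x
    unfolding F_def using DERIV_diff[OF F0 DERIV_const] by simp
  have ftc: "(LINT s:{p<..q}|lborel. w s) = F q - F p" if "p \<le> q" for p q
    by (rule FTC_primitive[OF F cont that])
  have z: "(LINT s:{p<..q}|lborel. w s) = 0" if "q < a \<or> p \<ge> b" for p q
  proof -
    have "indicator {p<..q} s *\<^sub>R w s = 0" for s using ab(4)[of s] that by (auto simp: indicator_def)
    then show ?thesis unfolding set_lebesgue_integral_def by (simp only: integral_zero)
  qed
  have FT: "F T = 0" using ftc[of 0 T] zero ab by (simp add: F_def)
  have "F t = 0" if "t \<notin> {a..b}" for t
  proof -
    consider "t < a" "t \<le> 0" | "t < a" "0 \<le> t" | "t > b" "t \<le> T" | "t > b" "T \<le> t" using \<open>t \<notin> _\<close> by force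
    then show ?thesis
    proof cases
      case 1 then show ?thesis using ftc[of t 0] z[of 0 t] ab by (simp add: F_def)
    next
      case 2 then show ?thesis using ftc[of 0 t] z[of t 0] ab by (simp add: F_def)
    next
      case 3 then show ?thesis using ftc[of t T] z[of T t] ab FT by simp
    next
      case 4 then show ?thesis using ftc[of T t] z[of t T] ab FT by simp
    qed
  qed
  moreover have "smooth F"
    unfolding smooth_def
  proof
    fix k
    have "Ck (Suc k) F"
      by (rule Ck_SucI[where f' = "\<lambda>x v. w x * v"])
        (use F sm in \<open>auto simp: has_field_derivative_def smooth_def intro!: Ck_mult Ck_const\<close>)
    then show "Ck k F" by (rule Ck_SucD)
  qed
  ultimately have "time_test T F" unfolding time_test_def using ab by blast
  then show ?thesis using F by (rule that)
qed

lemma time_test_derivative: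
  assumes "time_test T \<zeta>" "\<And>t. (\<zeta> has_real_derivative \<zeta>' t) (at t)"
  shows "time_test T \<zeta>'"
proof -
  obtain a b where ab: "0 < a" "a < b" "b < T" "\<And>t. t \<notin> {a..b} \<Longrightarrow> \<zeta> t = 0" and sm: "smooth \<zeta>"
    using assms(1) unfolding time_test_def by blast
  have "frechet_derivative \<zeta> (at t) 1 = \<zeta>' t" for t
    using frechet_derivative_at[OF assms(2)[of t, unfolded has_field_derivative_def]] by (metis mult.right_neutral)
  then have "Ck k \<zeta>'" for k
    using Ck_frechet[of k \<zeta> 1] sm unfolding smooth_def by simp
  moreover have "\<zeta>' t = 0" if "t \<notin> {a..b}" for t
  proof -
    have "open (- {a..b})" by auto
    then have "\<forall>\<^sub>F s in nhds t. \<zeta> s = 0"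
      using that ab(4) by (auto intro!: eventually_mono[OF eventually_nhds_in_open[of "- {a..b}" t]])
    then have "(\<zeta> has_real_derivative 0) (at t)"
      by (subst DERIV_cong_ev[OF refl _ refl, of _ "\<lambda>_. 0"]) auto
    then show ?thesis using DERIV_unique assms(2) by blast
  qed
  ultimately show ?thesis unfolding time_test_def smooth_def using ab by blast
qed

text \<open>The lemma of du Bois-Reymond. The difference \<open>k\<close> of \<open>h\<close> and the primitive is orthogonal to all
  derivatives of test functions, that is, to all test functions with integral zero. Correcting an
  arbitrary test function by a multiple of a fixed one with nonzero integral shows that \<open>k\<close> minus a
  constant is orthogonal to all test functions.\<close>

lemma weak_derivative_primitive:
  fixes h g :: "real \<Rightarrow> real"
  assumes T: "0 < T" and h [measurable]: "h \<in> borel_measurable borel" and g [measurable]: "g \<in> borel_measurable borel"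
    and hC: "\<And>s. \<bar>h s\<bar> \<le> C" and gC: "\<And>s. \<bar>g s\<bar> \<le> C'"
    and weak: "\<And>\<zeta> \<zeta>'. time_test T \<zeta> \<Longrightarrow> (\<And>t. (\<zeta> has_real_derivative \<zeta>' t) (at t)) \<Longrightarrow>
       (LINT t:{0<..T}|lborel. \<zeta>' t * h t) = - (LINT t:{0<..T}|lborel. \<zeta> t * g t)"
  shows "\<exists>c. AE t in lborel. t \<in> {0<..T} \<longrightarrow> h t = c + primitive g t"
proof -
  define k where "k t = h t - primitive g t" for t
  have k [measurable]: "k \<in> borel_measurable borel" unfolding k_def by measurable
  have kC: "\<bar>k s\<bar> \<le> C + C' * T" if "s \<in> {0<..T}" for s
    using hC[of s] primitive_bound[OF g gC, of s T] that by (auto simp: k_def)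
  have int_k: "set_integrable lborel {0<..T} (\<lambda>t. z t * k t)" if z: "time_test T z" for z
  proof -
    obtain c where c: "\<And>s. \<bar>z s\<bar> \<le> c" "0 \<le> c" using time_test_bounded[OF z] by blast
    note [measurable] = time_test_borel[OF z]
    show ?thesis
      by (rule set_integrable_interval_bounded[where C = "c * (C + C' * T)"])
        (use c kC in \<open>auto simp: abs_mult intro!: mult_mono\<close>)
  qed
  have int_t: "set_integrable lborel {0<..T} z" if z: "time_test T z" for z
    using time_test_bounded[OF z] set_integrable_interval_bounded[OF time_test_borel[OF z]] by metis
  have deriv_zero: "(LINT t:{0<..T}|lborel. \<zeta>' t * k t) = 0"
    if z: "time_test T \<zeta>" and d: "\<And>t. (\<zeta> has_real_derivative \<zeta>' t) (at t)" for \<zeta> \<zeta>'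
  proof -
    note z' = time_test_derivative[OF z d]
    obtain c where c: "\<And>s. \<bar>\<zeta>' s\<bar> \<le> c" "0 \<le> c" using time_test_bounded[OF z'] by blast
    note [measurable] = time_test_borel[OF z] time_test_borel[OF z']
    have z0: "\<zeta> 0 = 0" "\<zeta> T = 0" using z unfolding time_test_def by force+
    have pz: "primitive \<zeta>' t = \<zeta> t" if "0 \<le> t" for t
      unfolding primitive_def using FTC_primitive[OF d time_test_continuous[OF z'] that] z0 by simp
    have "0 = (LINT s:{0<..T}|lborel. \<zeta>' s * primitive g s) + (LINT s:{0<..T}|lborel. primitive \<zeta>' s * g s)"
      using primitive_mult[OF time_test_borel[OF z'] g c(1) gC less_imp_le[OF T]] pz[of T] T z0 by simp
    also have "(LINT s:{0<..T}|lborel. primitive \<zeta>' s * g s) = (LINT s:{0<..T}|lborel. \<zeta> s * g s)"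
      by (rule set_lebesgue_integral_cong) (auto simp: pz)
    also have "\<dots> = - (LINT s:{0<..T}|lborel. \<zeta>' s * h s)" using weak[OF z d] by simp
    finally have "(LINT s:{0<..T}|lborel. \<zeta>' s * h s) = (LINT s:{0<..T}|lborel. \<zeta>' s * primitive g s)" by simp
    moreover have "set_integrable lborel {0<..T} (\<lambda>s. \<zeta>' s * h s)"
      by (rule set_integrable_interval_bounded[where C = "c * C"]) (use c hC in \<open>auto simp: abs_mult intro!: mult_mono\<close>)
    moreover have "set_integrable lborel {0<..T} (\<lambda>s. \<zeta>' s * primitive g s)"
      by (rule set_integrable_interval_bounded[where C = "c * (C' * T)"])
        (use c primitive_bound[OF g gC, of _ T] in \<open>auto simp: abs_mult intro!: mult_mono\<close>)
    ultimately show ?thesis by (simp add: k_def right_diff_distrib set_integral_diff)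
  qed
  \<comment> \<open>A fixed test function whose integral does not vanish; it is positive on the middle quarter.\<close>
  define \<rho> where "\<rho> = plateau 0 T 1"
  have \<rho>: "time_test T \<rho>" unfolding \<rho>_def using T by (intro time_test_plateau) auto
  define R where "R = (LINT t:{0<..T}|lborel. \<rho> t)"
  have R: "R \<noteq> 0"
  proof
    assume "R = 0"
    have "AE t in lborel. indicator {0<..T} t *\<^sub>R \<rho> t = 0"
      using \<open>R = 0\<close> int_t[OF \<rho>]
      by (subst integral_nonneg_eq_0_iff_AE[symmetric])
        (auto simp: R_def set_lebesgue_integral_def set_integrable_def \<rho>_def plateau_bounds)
    then have "AE t in lborel. t \<notin> {3/8 * T<..<5/8 * T}"
    proof eventually_elim
      case (elim t)
      show ?case
      proof
        assume t: "t \<in> {3/8 * T<..<5/8 * T}"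
        then have "\<rho> t > 0" using T by (simp add: \<rho>_def plateau_def flat_def)
        then show False using elim t T by (auto simp: indicator_def)
      qed
    qed
    then have "emeasure lborel {3/8 * T<..<5/8 * T} = 0"
      by (subst (asm) AE_iff_measurable[of "{3/8 * T<..<5/8 * T}"]) auto
    then show False using T by simp
  qed
  define c where "c = (LINT t:{0<..T}|lborel. \<rho> t * k t) / R"
  have "AE t in lborel. t \<in> {0<..T} \<longrightarrow> k t - c = 0"
  proof (rule AE_zero_if_tests_zero)
    show "\<bar>k s - c\<bar> \<le> C + C' * T + \<bar>c\<bar>" if "s \<in> {0<..T}" for s using kC[OF that] by linarith
    fix z assume z: "time_test T z"
    define Z where "Z = (LINT t:{0<..T}|lborel. z t)"
    \<comment> \<open>The corrected test function has integral zero and is therefore a derivative.\<close>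
    let ?w = "\<lambda>t. z t + (- Z / R) * \<rho> t"
    have w: "time_test T ?w" by (rule time_test_lincomb[OF z \<rho>])
    have "(LINT t:{0<..T}|lborel. ?w t) = Z + (- Z / R) * R"
      using int_t[OF z] set_integrable_mult_right[of "- Z / R", OF int_t[OF \<rho>]]
      by (subst set_integral_add(2)) (simp_all only: set_integral_mult_right Z_def R_def)
    then have "(LINT t:{0<..T}|lborel. ?w t) = 0" using R by simp
    then obtain F where "time_test T F" "\<And>t. (F has_real_derivative ?w t) (at t)"
      using time_test_antiderivative[OF w] by blast
    then have "0 = (LINT t:{0<..T}|lborel. ?w t * k t)" using deriv_zero by simp
    also have "\<dots> = (LINT t:{0<..T}|lborel. z t * k t + (- Z / R) * (\<rho> t * k t))"
      by (simp add: algebra_simps)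
    also have "\<dots> = (LINT t:{0<..T}|lborel. z t * k t) + (- Z / R) * (LINT t:{0<..T}|lborel. \<rho> t * k t)"
      using int_k[OF z] set_integrable_mult_right[of "- Z / R", OF int_k[OF \<rho>]]
      by (subst set_integral_add(2)) (simp_all only: set_integral_mult_right)
    finally have zk: "(LINT t:{0<..T}|lborel. z t * k t) = c * Z" by (simp add: c_def)
    have "(LINT t:{0<..T}|lborel. (k t - c) * z t) = (LINT t:{0<..T}|lborel. z t * k t - c * z t)"
      by (simp add: algebra_simps)
    also have "\<dots> = c * Z - c * Z"
      using int_k[OF z] set_integrable_mult_right[of c, OF int_t[OF z]]
      by (subst set_integral_diff) (auto simp: zk Z_def)
    finally show "(LINT t:{0<..T}|lborel. (k t - c) * z t) = 0" by simp
  qed measurable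
  then have "AE t in lborel. t \<in> {0<..T} \<longrightarrow> h t = c + primitive g t"
    by eventually_elim (auto simp: k_def)
  then show ?thesis by blast
qed

text \<open>The constant is determined by the behaviour at \<open>0\<close>, where the primitive is continuous.\<close>

lemma weak_derivative_primitive_zero:
  fixes h g :: "real \<Rightarrow> real"
  assumes T: "0 < T" and h: "h \<in> borel_measurable borel" and g: "g \<in> borel_measurable borel"
    and hC: "\<And>s. \<bar>h s\<bar> \<le> C" and gC: "\<And>s. \<bar>g s\<bar> \<le> C'"
    and weak: "\<And>\<zeta> \<zeta>'. time_test T \<zeta> \<Longrightarrow> (\<And>t. (\<zeta> has_real_derivative \<zeta>' t) (at t)) \<Longrightarrow>
       (LINT t:{0<..T}|lborel. \<zeta>' t * h t) = - (LINT t:{0<..T}|lborel. \<zeta> t * g t)"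
    and init: "ess_lim0 T h 0"
  shows "AE t in lborel. t \<in> {0<..T} \<longrightarrow> h t = primitive g t"
proof -
  obtain c where c: "AE t in lborel. t \<in> {0<..T} \<longrightarrow> h t = c + primitive g t"
    using weak_derivative_primitive[OF T h g hC gC weak] by blast
  have "c = 0"
  proof (rule ccontr)
    assume "c \<noteq> 0"
    then have e: "\<bar>c\<bar> / 2 > 0" by simp
    then obtain d where d: "d > 0" "AE t in lborel. 0 < t \<and> t < d \<and> t < T \<longrightarrow> \<bar>h t - 0\<bar> < \<bar>c\<bar> / 2"
      using init unfolding ess_lim0_def by meson
    have C'0: "0 \<le> C'" using gC[of 0] by linarith
    define d' where "d' = min (min d T) (\<bar>c\<bar> / (2 * (C' + 1)))"
    have d': "d' > 0" using d T e C'0 by (simp add: d'_def)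
    have "AE t in lborel. t \<notin> {0<..<d'}"
      using c d(2)
    proof eventually_elim
      case (elim t)
      show ?case
      proof
        assume t: "t \<in> {0<..<d'}"
        then have "\<bar>primitive g t\<bar> \<le> C' * t" using primitive_bound[OF g gC, of t t] by simp
        also have "\<dots> \<le> (C' + 1) * t" using t C'0 by (simp add: mult_right_mono)
        also have "\<dots> < (C' + 1) * (\<bar>c\<bar> / (2 * (C' + 1)))"
          using t C'0 by (intro mult_strict_left_mono) (auto simp: d'_def)
        also have "\<dots> = \<bar>c\<bar> / 2" using C'0 nonzero_mult_divide_mult_cancel_left[of "C' + 1" "\<bar>c\<bar>" 2]
          by (simp add: mult.commute)
        finally have "\<bar>primitive g t\<bar> < \<bar>c\<bar> / 2" .
        moreover have "h t = c + primitive g t" "\<bar>h t\<bar> < \<bar>c\<bar> / 2" using elim t by (auto simp: d'_def)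
        ultimately show False by linarith
      qed
    qed
    then have "emeasure lborel {0<..<d'} = 0"
      by (subst (asm) AE_iff_measurable[of "{0<..<d'}"]) auto
    then show False using d' by simp
  qed
  then show ?thesis using c by simp
qed

section \<open>Uniqueness for the advection-diffusion equation\<close>

lemma beta_0: "beta 0 = 1" by (simp add: beta_def)

lemma beta_ge_1: "1 \<le> beta s" by (simp add: beta_def)

lemma beta_factor: "\<bar>s\<bar> = sqrt (beta s - 1) * sqrt (beta s + 1)"
proof -
  have "(beta s - 1) * (beta s + 1) = s\<^sup>2"
    by (simp add: beta_def algebra_simps)
  then show ?thesis by (simp flip: real_sqrt_mult)
qed

lemma beta1_lipschitz: "\<bar>beta1 x - beta1 y\<bar> \<le> 1 * \<bar>x - y\<bar>"
  using field_differentiable_bound[of UNIV beta1 beta2 1 x y] beta1_deriv beta2_bounds by simp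

lemma abs_integral_le_integral:
  fixes f g :: "'a \<Rightarrow> real"
  assumes "integrable M f" "integrable M g" "\<And>x. \<bar>f x\<bar> \<le> g x"
  shows "\<bar>integral\<^sup>L M f\<bar> \<le> integral\<^sup>L M g"
proof -
  have "\<bar>integral\<^sup>L M f\<bar> \<le> (\<integral>x. \<bar>f x\<bar> \<partial>M)"
    using integral_norm_bound[of M f] by simp
  also have "\<dots> \<le> integral\<^sup>L M g"
    by (rule integral_mono) (use assms in auto)
  finally show ?thesis .
qed

text \<open>Since \<open>s\<^sup>2 = (beta s - 1) * (beta s + 1)\<close>, smallness of \<open>beta (f x) - 1\<close> in mean controls \<open>f\<close> in \<open>L\<^sup>1\<close>.\<close>

lemma integral_abs_le_beta:
  fixes f :: "real^3 \<Rightarrow> real"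
  assumes "continuous_on UNIV f" and e: "(\<integral>x. beta (f x) - 1 \<partial>torus) \<le> e"
  shows "(\<integral>x. \<bar>f x\<bar> \<partial>torus) \<le> sqrt e * sqrt (e + 2)"
proof -
  have i: "integrable torus (\<lambda>x. beta (f x) - 1)" "integrable torus (\<lambda>x. beta (f x) + 1)"
    by (intro integrable_torus_continuous continuous_intros assms)+
  have [measurable]: "f \<in> borel_measurable borel" by (intro borel_measurable_continuous_onI assms)
  have sq: "(sqrt (beta s - 1))\<^sup>2 = beta s - 1" "(sqrt (beta s + 1))\<^sup>2 = beta s + 1" for s
    using beta_ge_1[of s] by auto
  have nn: "0 \<le> (\<integral>x. beta (f x) - 1 \<partial>torus)"
    by (intro integral_nonneg_AE AE_I2) (simp add: beta_ge_1)
  have "(\<integral>x. \<bar>f x\<bar> \<partial>torus) = (\<integral>x. \<bar>sqrt (beta (f x) - 1) * sqrt (beta (f x) + 1)\<bar> \<partial>torus)"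
    by (simp flip: beta_factor)
  also have "\<dots> \<le> sqrt (\<integral>x. (sqrt (beta (f x) - 1))\<^sup>2 \<partial>torus) * sqrt (\<integral>x. (sqrt (beta (f x) + 1))\<^sup>2 \<partial>torus)"
    by (rule Cauchy_Schwarz_integral(2)) (use i in \<open>auto simp: sq\<close>)
  also have "\<dots> = sqrt (\<integral>x. beta (f x) - 1 \<partial>torus) * sqrt (\<integral>x. beta (f x) + 1 \<partial>torus)"
    by (simp add: sq)
  also have "(\<integral>x. beta (f x) + 1 \<partial>torus) = (\<integral>x. (beta (f x) - 1) + 2 \<partial>torus)"
    by (intro Bochner_Integration.integral_cong refl) simp
  also have "\<dots> = (\<integral>x. beta (f x) - 1 \<partial>torus) + 2"
    using i(1) by (subst Bochner_Integration.integral_add) auto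
  also have "sqrt (\<integral>x. beta (f x) - 1 \<partial>torus) * sqrt ((\<integral>x. beta (f x) - 1 \<partial>torus) + 2) \<le> sqrt e * sqrt (e + 2)"
    using e nn by (intro mult_mono) auto
  finally show ?thesis .
qed

lemma L2_norm_grad_wave: "L2_torus (grad_wave m)" "L2_norm (grad_wave m) \<le> 2 * pi * norm (intvec (fst m))"
proof -
  show g: "L2_torus (grad_wave m)"
    by (rule L2_torus_bounded[OF _ norm_grad_wave_le periodic_grad_wave]) simp
  have "(\<integral>x. (norm (grad_wave m x))\<^sup>2 \<partial>torus) \<le> (\<integral>x. (2 * pi * norm (intvec (fst m)))\<^sup>2 \<partial>torus)"
    by (rule integral_mono) (use g norm_grad_wave_le in \<open>auto simp: L2_torus_iff intro!: power_mono\<close>)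
  then show "L2_norm (grad_wave m) \<le> 2 * pi * norm (intvec (fst m))"
    unfolding L2_norm_torus by (intro real_le_lsqrt) auto
qed

lemma abs_integral_inner_le:
  fixes f g :: "real^3 \<Rightarrow> 'b::euclidean_space"
  assumes "L2_torus f" "L2_torus g"
  shows "\<bar>\<integral>x. f x \<bullet> g x \<partial>torus\<bar> \<le> L2_norm f * L2_norm g"
proof -
  have "\<bar>\<integral>x. f x \<bullet> g x \<partial>torus\<bar> \<le> (\<integral>x. norm (f x) * norm (g x) \<partial>torus)"
    by (rule abs_integral_le_integral[OF L2_torus_inner[OF assms] L2_torus_product(1)[OF assms] Cauchy_Schwarz_ineq2])
  then show ?thesis using L2_torus_product(2)[OF assms] by linarith
qed

lemma abs_integral_flux_le:
  assumes D: "L2_torus D" and u: "L2_torus u"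
  shows "\<bar>\<integral>y. D y * (u y \<bullet> grad_wave m y) \<partial>torus\<bar> \<le> 2 * pi * norm (intvec (fst m)) * (L2_norm D * L2_norm u)"
    and "integrable torus (\<lambda>y. D y * (u y \<bullet> grad_wave m y))"
proof -
  let ?K = "2 * pi * norm (intvec (fst m))"
  have [measurable]: "D \<in> borel_measurable borel" "u \<in> borel_measurable borel"
    using D u by (auto simp: L2_torus_iff)
  have le: "\<bar>D y * (u y \<bullet> grad_wave m y)\<bar> \<le> ?K * (norm (D y) * norm (u y))" for y
  proof -
    have "\<bar>u y \<bullet> grad_wave m y\<bar> \<le> norm (u y) * ?K"
      using order_trans[OF Cauchy_Schwarz_ineq2 mult_left_mono[OF norm_grad_wave_le norm_ge_zero]] .
    from mult_left_mono[OF this, of "\<bar>D y\<bar>"] show ?thesis by (simp add: abs_mult mult_ac)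
  qed
  have i: "integrable torus (\<lambda>y. ?K * (norm (D y) * norm (u y)))"
    using L2_torus_product(1)[OF D u] by simp
  show int: "integrable torus (\<lambda>y. D y * (u y \<bullet> grad_wave m y))"
    by (rule Bochner_Integration.integrable_bound[OF i]) (use le in \<open>auto intro!: AE_I2 intro: order_trans[OF _ abs_ge_self]\<close>)
  have "\<bar>\<integral>y. D y * (u y \<bullet> grad_wave m y) \<partial>torus\<bar> \<le> (\<integral>y. ?K * (norm (D y) * norm (u y)) \<partial>torus)"
    by (rule abs_integral_le_integral[OF int i le])
  also have "\<dots> = ?K * (\<integral>y. norm (D y) * norm (u y) \<partial>torus)" by simp
  also have "\<dots> \<le> ?K * (L2_norm D * L2_norm u)"
    by (intro mult_left_mono L2_torus_product D u) auto
  finally show "\<bar>\<integral>y. D y * (u y \<bullet> grad_wave m y) \<partial>torus\<bar> \<le> ?K * (L2_norm D * L2_norm u)" .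
qed

lemma L2_norm_wave: "L2_torus (wave m)" "L2_norm (wave m) \<le> 1"
proof -
  show g: "L2_torus (wave m)"
    by (rule L2_torus_bounded[OF _ _ periodic_wave, of _ 1]) (auto simp: wave_le_1)
  have "(\<integral>x. (norm (wave m x))\<^sup>2 \<partial>torus) \<le> (\<integral>x. 1 \<partial>torus)"
    by (rule integral_mono) (use g wave_le_1 in \<open>auto simp: L2_torus_iff abs_square_le_1\<close>)
  then show "L2_norm (wave m) \<le> 1"
    unfolding L2_norm_torus by (intro real_le_lsqrt) auto
qed

text \<open>The coefficients of \<open>D\<close> with respect to the waves, and the time derivatives of these coefficients
  that follow from \<open>\<partial>\<^sub>t D + div (U D) = \<nu> \<Delta> D\<close>.\<close>

definition amplitude :: "(real \<times> (real^3) \<Rightarrow> real) \<Rightarrow> (int^3) \<times> real \<Rightarrow> real \<Rightarrow> real" where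
  "amplitude D m t = (\<integral>y. wave m y * D (t, y) \<partial>torus)"

definition amplitude_rate ::
    "real \<Rightarrow> (real \<times> (real^3) \<Rightarrow> real^3) \<Rightarrow> (real \<times> (real^3) \<Rightarrow> real) \<Rightarrow> (int^3) \<times> real \<Rightarrow> real \<Rightarrow> real" where
  "amplitude_rate \<nu> U D m t = (\<integral>y. D (t, y) * (U (t, y) \<bullet> grad_wave m y) \<partial>torus) - \<nu> * eigen m * amplitude D m t"

lemma borel_pairI:
  fixes f :: "'a::second_countable_topology \<times> 'b::second_countable_topology \<Rightarrow> 'c::topological_space"
  shows "f \<in> borel_measurable borel \<Longrightarrow> f \<in> borel_measurable (borel \<Otimes>\<^sub>M borel)"
  by (simp add: borel_prod)

lemma amplitude_borel:
  assumes "D \<in> borel_measurable borel" shows "amplitude D m \<in> borel_measurable borel"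
proof -
  note [measurable] = borel_pairI[OF assms]
  show ?thesis unfolding amplitude_def[abs_def]
    using integral_torus_measurable[of "\<lambda>(t, y). wave m y * D (t, y)"] by simp
qed

lemma amplitude_rate_borel:
  assumes "D \<in> borel_measurable borel" "U \<in> borel_measurable borel"
  shows "amplitude_rate \<nu> U D m \<in> borel_measurable borel"
proof -
  note [measurable] = assms[THEN borel_pairI] amplitude_borel[OF assms(1)]
  have [measurable]: "(\<lambda>t. \<integral>y. D (t, y) * (U (t, y) \<bullet> grad_wave m y) \<partial>torus) \<in> borel_measurable borel"
    using integral_torus_measurable[of "\<lambda>(t, y). D (t, y) * (U (t, y) \<bullet> grad_wave m y)"] by simp
  show ?thesis unfolding amplitude_rate_def[abs_def] by measurable
qed

lemma L2_norm_slice_borel: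
  fixes f :: "'a::second_countable_topology \<times> (real^3) \<Rightarrow> 'b::euclidean_space"
  assumes "f \<in> borel_measurable borel"
  shows "(\<lambda>t. L2_norm (\<lambda>x. f (t, x))) \<in> borel_measurable borel"
proof -
  note [measurable] = borel_pairI[OF assms]
  show ?thesis unfolding L2_norm_torus
    using integral_torus_measurable[of "\<lambda>(t, y). (norm (f (t, y)))\<^sup>2"] by simp
qed

lemma defect_slice_borel:
  fixes U :: "real \<times> (real^3) \<Rightarrow> 'b::euclidean_space"
  assumes "U \<in> borel_measurable borel"
  shows "(\<lambda>t. defect N (\<lambda>x. U (t, x))) \<in> borel_measurable borel"
proof -
  note U [measurable] = borel_pairI[OF assms]
  have "(\<lambda>p. \<integral>x. (norm (U (fst p, x - snd p) - U (fst p, x)))\<^sup>2 \<partial>torus) \<in> borel_measurable (borel :: (real \<times> (real^3)) measure)"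
    using integral_torus_measurable[of "\<lambda>(p :: real \<times> (real^3), x). (norm (U (fst p, x - snd p) - U (fst p, x)))\<^sup>2"]
    by (simp add: borel_prod[symmetric])
  then have [measurable]: "(\<lambda>(t, h). shift_defect (\<lambda>x. U (t, x)) h) \<in> borel_measurable (borel \<Otimes>\<^sub>M borel)"
    by (simp add: shift_defect_def case_prod_beta' borel_prod)
  show ?thesis unfolding defect_def
    using integral_torus_measurable[of "\<lambda>(t, h). cos_kernel N h * shift_defect (\<lambda>x. U (t, x)) h"] by simp
qed

lemma amplitude_bound:
  assumes "L2_torus (\<lambda>x. D (t, x))" "L2_norm (\<lambda>x. D (t, x)) \<le> CD"
  shows "\<bar>amplitude D m t\<bar> \<le> CD"
proof -
  have "\<bar>amplitude D m t\<bar> \<le> L2_norm (wave m) * L2_norm (\<lambda>x. D (t, x))"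
    using abs_integral_inner_le[OF L2_norm_wave(1) assms(1), of m] by (simp add: amplitude_def)
  also have "\<dots> \<le> 1 * CD" by (intro mult_mono L2_norm_wave assms L2_norm_nonneg) simp
  finally show ?thesis by simp
qed

lemma amplitude_rate_bound:
  assumes D: "L2_torus (\<lambda>x. D (t, x))" "L2_norm (\<lambda>x. D (t, x)) \<le> CD"
    and U: "L2_torus (\<lambda>x. U (t, x))" "L2_norm (\<lambda>x. U (t, x)) \<le> CU"
  shows "\<bar>amplitude_rate \<nu> U D m t\<bar> \<le> 2 * pi * norm (intvec (fst m)) * (CD * CU) + \<bar>\<nu> * eigen m\<bar> * CD"
proof -
  have "\<bar>amplitude_rate \<nu> U D m t\<bar> \<le> \<bar>\<integral>y. D (t, y) * (U (t, y) \<bullet> grad_wave m y) \<partial>torus\<bar> + \<bar>\<nu> * eigen m * amplitude D m t\<bar>"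
    unfolding amplitude_rate_def by (rule abs_triangle_ineq4)
  also have "\<dots> \<le> 2 * pi * norm (intvec (fst m)) * (L2_norm (\<lambda>x. D (t, x)) * L2_norm (\<lambda>x. U (t, x))) + \<bar>\<nu> * eigen m\<bar> * CD"
    using abs_integral_flux_le(1)[OF D(1) U(1), of m] amplitude_bound[OF D, of m]
    by (intro add_mono) (auto simp: abs_mult intro: mult_left_mono)
  also have "\<dots> \<le> 2 * pi * norm (intvec (fst m)) * (CD * CU) + \<bar>\<nu> * eigen m\<bar> * CD"
    using D U L2_norm_nonneg order_trans by (intro add_right_mono mult_left_mono mult_mono) (auto intro: order_trans[OF L2_norm_nonneg])
  finally show ?thesis .
qed

lemma sqrt_defect_le:
  assumes "L2_torus f" "L2_norm f \<le> C" shows "sqrt (defect N f) \<le> 2 * C"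
proof (rule real_le_lsqrt)
  have "defect N f \<le> 4 * (L2_norm f)\<^sup>2" by (rule defect_le[OF assms(1)])
  also have "\<dots> \<le> 4 * C\<^sup>2" using assms(2) L2_norm_nonneg by (intro mult_left_mono power_mono) auto
  finally show "defect N f \<le> (2 * C)\<^sup>2" by (simp add: power_mult_distrib)
  show "0 \<le> 2 * C" using order_trans[OF L2_norm_nonneg assms(2)] by simp
qed

text \<open>For fixed \<open>x\<close> the smoothed function is a primitive of a bounded function of time, so the chain rule
  applies. Integrating it over the torus and exchanging the integrals leads to the estimate at fixed
  times, which holds at almost every time. The left-hand side contains the primitives, which agree
  with the amplitudes of \<open>D\<close> only at almost every time.\<close>

lemma energy_estimate:
  fixes U G :: "real \<times> (real^3) \<Rightarrow> real^3" and D :: "real \<times> (real^3) \<Rightarrow> real"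
  assumes nu: "0 \<le> \<nu>" and t: "0 \<le> t" "t \<le> T"
    and Um: "U \<in> borel_measurable borel" and Dm: "D \<in> borel_measurable borel" and Gm: "G \<in> borel_measurable borel"
    and U: "\<And>t. L2_torus (\<lambda>x. U (t, x))" "\<And>t. L2_norm (\<lambda>x. U (t, x)) \<le> CU"
    and D: "\<And>t. L2_torus (\<lambda>x. D (t, x))" "\<And>t. L2_norm (\<lambda>x. D (t, x)) \<le> CD"
    and G: "\<And>t. L2_torus (\<lambda>x. G (t, x))" "\<And>t. wave_grad (\<lambda>x. D (t, x)) (\<lambda>x. G (t, x))"
    and Gi: "set_integrable lborel {0<..T} (\<lambda>t. L2_norm (\<lambda>x. G (t, x)))"
    and df: "AE t in lborel. t \<in> {0<..T} \<longrightarrow> wave_div_free (\<lambda>x. U (t, x))"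
    and ode: "\<And>m. m \<in> modes N \<Longrightarrow>
      AE t in lborel. t \<in> {0<..T} \<longrightarrow> amplitude D m t = primitive (amplitude_rate \<nu> U D m) t"
  shows "(\<integral>x. beta (\<Sum>m\<in>modes N. coef N m * wave m x * primitive (amplitude_rate \<nu> U D m) t) - 1 \<partial>torus)
     \<le> (LINT s:{0<..T}|lborel. sqrt (defect N (\<lambda>x. U (s, x))) * L2_norm (\<lambda>x. G (s, x)))"
proof -
  define g where "g m s = amplitude_rate \<nu> U D m s" for m s
  have gB [measurable]: "g m \<in> borel_measurable borel" for m
    unfolding g_def[abs_def] by (rule amplitude_rate_borel[OF Dm Um])
  define K where "K m = 2 * pi * norm (intvec (fst m)) * (CD * CU) + \<bar>\<nu> * eigen m\<bar> * CD" for m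
  have gK: "\<bar>g m s\<bar> \<le> K m" for m s
    unfolding g_def K_def by (rule amplitude_rate_bound[OF D U])
  define H where "H x s = (\<Sum>m\<in>modes N. coef N m * wave m x * primitive (g m) s)" for x s
  define gx where "gx x s = (\<Sum>m\<in>modes N. coef N m * wave m x * g m s)" for x s
  have gxB [measurable]: "gx x \<in> borel_measurable borel" for x unfolding gx_def[abs_def] by measurable
  \<comment> \<open>A bound for the time derivative of the smoothed function, uniform in \<open>x\<close>.\<close>
  define KK where "KK = (\<Sum>m\<in>modes N. \<bar>coef N m\<bar> * K m)"
  have gxK: "\<bar>gx x s\<bar> \<le> KK" for x s
  proof -
    have "\<bar>gx x s\<bar> \<le> (\<Sum>m\<in>modes N. \<bar>coef N m * wave m x * g m s\<bar>)"
      unfolding gx_def by (rule sum_abs)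
    also have "\<dots> \<le> KK"
      unfolding KK_def
    proof (intro sum_mono)
      fix m
      have "\<bar>coef N m * wave m x\<bar> \<le> \<bar>coef N m\<bar> * 1"
        unfolding abs_mult by (intro mult_left_mono wave_le_1) simp
      then show "\<bar>coef N m * wave m x * g m s\<bar> \<le> \<bar>coef N m\<bar> * K m"
        unfolding abs_mult[of "coef N m * wave m x"] using gK[of m s] by (intro mult_mono) auto
    qed
    finally show ?thesis .
  qed
  have pH: "primitive (gx x) s = H x s" for x s
  proof -
    have i: "set_integrable lborel {0<..s} (\<lambda>r. coef N m * wave m x * g m r)" for m
      by (intro set_integrable_mult_right set_integrable_interval_bounded[where C = "K m"] gB gK)
    have "primitive (gx x) s = (\<Sum>m\<in>modes N. LINT r:{0<..s}|lborel. coef N m * wave m x * g m r)"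
      using i unfolding primitive_def gx_def set_lebesgue_integral_def set_integrable_def scaleR_sum_right
      by (intro Bochner_Integration.integral_sum)
    then show ?thesis by (simp add: H_def primitive_def)
  qed
  have chain: "beta (H x t) - 1 = (LINT s:{0<..t}|lborel. beta1 (H x s) * gx x s)" for x
    using chain_rule_primitive[OF gxB gxK beta_deriv beta1_lipschitz _ t(1), of x] by (simp add: pH beta_0)
  have [measurable]: "(\<lambda>s. primitive (g m) s) \<in> borel_measurable borel" for m by measurable
  let ?f = "\<lambda>x s. indicator {0<..t} s * (beta1 (H x s) * gx x s)"
  interpret tl: pair_sigma_finite torus "lborel :: real measure" ..
  have [measurable]: "(\<lambda>p. wave m (fst p)) \<in> borel_measurable (torus \<Otimes>\<^sub>M lborel)"
    "(\<lambda>p. g m (snd p)) \<in> borel_measurable (torus \<Otimes>\<^sub>M lborel)"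
    "(\<lambda>p. primitive (g m) (snd p)) \<in> borel_measurable (torus \<Otimes>\<^sub>M lborel)" for m
    by (rule measurable_compose[OF measurable_fst] measurable_compose[OF measurable_snd]; simp add: borel_measurable_torus)+
  have [measurable]: "(\<lambda>p. \<Sum>m\<in>modes N. coef N m * wave m (fst p) * primitive (g m) (snd p)) \<in> borel_measurable (torus \<Otimes>\<^sub>M lborel)"
    "(\<lambda>p. \<Sum>m\<in>modes N. coef N m * wave m (fst p) * g m (snd p)) \<in> borel_measurable (torus \<Otimes>\<^sub>M lborel)"
    by (intro borel_measurable_sum borel_measurable_times borel_measurable_const; measurable)+
  have fm: "case_prod ?f \<in> borel_measurable (torus \<Otimes>\<^sub>M lborel)"
    unfolding H_def gx_def case_prod_beta' by measurable
  have fK: "\<bar>?f x s\<bar> \<le> indicator {0<..t} s * KK" for x s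
  proof -
    have "\<bar>beta1 (H x s)\<bar> * \<bar>gx x s\<bar> \<le> 1 * KK" by (intro mult_mono beta1_le gxK) auto
    then show ?thesis by (auto simp: indicator_def abs_mult)
  qed
  have iK: "integrable lborel (\<lambda>s. indicator {0<..t} s * KK :: real)"
    using set_integrable_interval_bounded[of "\<lambda>_. KK" 0 t "\<bar>KK\<bar>"] by (simp add: set_integrable_def)
  have fint: "integrable (torus \<Otimes>\<^sub>M lborel) (case_prod ?f)"
  proof (rule Bochner_Integration.integrable_bound)
    let ?b = "\<lambda>p. indicator {0<..t} (snd p) * KK"
    show "integrable (torus \<Otimes>\<^sub>M lborel) ?b"
    proof (rule tl.Fubini_integrable)
      show "integrable torus (\<lambda>x. \<integral>s. norm (?b (x, s)) \<partial>lborel)" by simp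
      show "AE x in torus. integrable lborel (\<lambda>s. ?b (x, s))" using iK by simp
    qed measurable
    show "AE p in torus \<Otimes>\<^sub>M lborel. norm (case_prod ?f p) \<le> norm (?b p)"
    proof (rule AE_I2)
      fix p
      show "norm (case_prod ?f p) \<le> norm (?b p)"
        using fK[of "snd p" "fst p"] by (simp add: case_prod_beta')
    qed
  qed (rule fm)
  have "(\<integral>x. beta (H x t) - 1 \<partial>torus) = (\<integral>x. \<integral>s. ?f x s \<partial>lborel \<partial>torus)"
    by (simp add: chain set_lebesgue_integral_def)
  also have "\<dots> = (\<integral>s. \<integral>x. ?f x s \<partial>torus \<partial>lborel)"
    by (rule tl.Fubini_integral[OF fint, symmetric])
  also have "\<dots> \<le> (\<integral>s. indicator {0<..T} s * (sqrt (defect N (\<lambda>x. U (s, x))) * L2_norm (\<lambda>x. G (s, x))) \<partial>lborel)"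
  proof (rule integral_mono_AE)
    show "integrable lborel (\<lambda>s. \<integral>x. ?f x s \<partial>torus)" by (rule tl.integrable_snd[OF fint])
    show "integrable lborel (\<lambda>s. indicator {0<..T} s * (sqrt (defect N (\<lambda>x. U (s, x))) * L2_norm (\<lambda>x. G (s, x))))"
    proof (rule Bochner_Integration.integrable_bound)
      show "integrable lborel (\<lambda>s. (2 * CU) * (indicator {0<..T} s * L2_norm (\<lambda>x. G (s, x))))"
        using Gi by (simp add: set_integrable_def)
      note [measurable] = defect_slice_borel[OF Um] L2_norm_slice_borel[OF Gm]
      show "(\<lambda>s. indicator {0<..T} s * (sqrt (defect N (\<lambda>x. U (s, x))) * L2_norm (\<lambda>x. G (s, x)))) \<in> borel_measurable lborel"
        by measurable
      have CU0: "0 \<le> CU" using U(2)[of 0] L2_norm_nonneg order_trans by blast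
      have "sqrt (defect N (\<lambda>x. U (s, x))) \<le> 2 * CU" for s
        by (rule sqrt_defect_le[OF U])
      then have "sqrt (defect N (\<lambda>x. U (s, x))) * L2_norm (\<lambda>x. G (s, x)) \<le> (2 * CU) * L2_norm (\<lambda>x. G (s, x))" for s
        by (intro mult_right_mono L2_norm_nonneg)
      then show "AE s in lborel. norm (indicator {0<..T} s * (sqrt (defect N (\<lambda>x. U (s, x))) * L2_norm (\<lambda>x. G (s, x))))
          \<le> norm ((2 * CU) * (indicator {0<..T} s * L2_norm (\<lambda>x. G (s, x))))"
        using CU0 by (intro AE_I2) (auto simp: indicator_def defect_nonneg L2_norm_nonneg)
    qed
    have "AE s in lborel. \<forall>m\<in>modes N. s \<in> {0<..T} \<longrightarrow> amplitude D m s = primitive (g m) s"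
      using ode by (subst AE_ball_countable) (auto simp: g_def[abs_def] countable_finite finite_modes)
    then show "AE s in lborel. (\<integral>x. ?f x s \<partial>torus) \<le> indicator {0<..T} s * (sqrt (defect N (\<lambda>x. U (s, x))) * L2_norm (\<lambda>x. G (s, x)))"
      using df
    proof eventually_elim
      case (elim s)
      have nn: "0 \<le> sqrt (defect N (\<lambda>x. U (s, x))) * L2_norm (\<lambda>x. G (s, x))"
        by (simp add: defect_nonneg L2_norm_nonneg)
      show ?case
      proof (cases "s \<in> {0<..t}")
        case True
        then have sT: "s \<in> {0<..T}" using t by auto
        have Di: "integrable torus (\<lambda>y. D (s, y))" by (rule L2_torus_integrable[OF D(1)])
        have "H x s = mol N (\<lambda>y. D (s, y)) x" for x
          using elim(1) sT unfolding H_def mol_expansion[OF Di] by (simp add: amplitude_def)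
        moreover have "gx x s = (\<Sum>m\<in>modes N. coef N m * wave m x *
            ((\<integral>y. D (s, y) * (U (s, y) \<bullet> grad_wave m y) \<partial>torus) - \<nu> * eigen m * (\<integral>y. wave m y * D (s, y) \<partial>torus)))" for x
          by (simp add: gx_def g_def amplitude_rate_def amplitude_def)
        ultimately have "(\<integral>x. ?f x s \<partial>torus) \<le> sqrt (defect N (\<lambda>x. U (s, x))) * L2_norm (\<lambda>x. G (s, x))"
          using slice_energy[OF U(1) _ D(1) G(1) G(2) nu, of s N] elim(2) sT True by simp
        then show ?thesis using sT by simp
      next
        case False
        then have z: "(indicator {0<..t} s :: real) = 0" by (auto simp: indicator_def)
        show ?thesis using nn unfolding z by (simp split: split_indicator)
      qed
    qed
  qed
  finally show ?thesis by (simp add: H_def g_def[abs_def] set_lebesgue_integral_def)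
qed

lemma defect_integral_tendsto:
  fixes U G :: "real \<times> (real^3) \<Rightarrow> real^3"
  assumes Um: "U \<in> borel_measurable borel" and Gm: "G \<in> borel_measurable borel"
    and U: "\<And>t. L2_torus (\<lambda>x. U (t, x))" "\<And>t. L2_norm (\<lambda>x. U (t, x)) \<le> CU"
    and Gi: "set_integrable lborel {0<..T} (\<lambda>t. L2_norm (\<lambda>x. G (t, x)))"
  shows "(\<lambda>N. LINT s:{0<..T}|lborel. sqrt (defect N (\<lambda>x. U (s, x))) * L2_norm (\<lambda>x. G (s, x))) \<longlonglongrightarrow> 0"
proof -
  have "(\<lambda>N. \<integral>s. indicator {0<..T} s * (sqrt (defect N (\<lambda>x. U (s, x))) * L2_norm (\<lambda>x. G (s, x))) \<partial>lborel)
     \<longlonglongrightarrow> integral\<^sup>L (lborel :: real measure) (\<lambda>s. 0)"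
  proof (rule integral_dominated_convergence[where w = "\<lambda>s. (2 * CU) * (indicator {0<..T} s * L2_norm (\<lambda>x. G (s, x)))"])
    show "integrable lborel (\<lambda>s. (2 * CU) * (indicator {0<..T} s * L2_norm (\<lambda>x. G (s, x))))"
      using Gi by (simp add: set_integrable_def)
    note [measurable] = defect_slice_borel[OF Um] L2_norm_slice_borel[OF Gm]
    show "(\<lambda>s. indicator {0<..T} s * (sqrt (defect N (\<lambda>x. U (s, x))) * L2_norm (\<lambda>x. G (s, x)))) \<in> borel_measurable lborel" for N
      by measurable
    have CU0: "0 \<le> CU" using U(2)[of 0] L2_norm_nonneg order_trans by blast
    have "sqrt (defect N (\<lambda>x. U (s, x))) \<le> 2 * CU" for s N
      by (rule sqrt_defect_le[OF U])
    then have "sqrt (defect N (\<lambda>x. U (s, x))) * L2_norm (\<lambda>x. G (s, x)) \<le> (2 * CU) * L2_norm (\<lambda>x. G (s, x))" for s N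
      by (intro mult_right_mono L2_norm_nonneg)
    then show "AE s in lborel. norm (indicator {0<..T} s * (sqrt (defect N (\<lambda>x. U (s, x))) * L2_norm (\<lambda>x. G (s, x))))
        \<le> (2 * CU) * (indicator {0<..T} s * L2_norm (\<lambda>x. G (s, x)))" for N
      using CU0 by (intro AE_I2) (auto simp: indicator_def defect_nonneg L2_norm_nonneg)
    show "AE s in lborel. (\<lambda>N. indicator {0<..T} s * (sqrt (defect N (\<lambda>x. U (s, x))) * L2_norm (\<lambda>x. G (s, x)))) \<longlonglongrightarrow> 0"
    proof (rule AE_I2)
      fix s
      have "(\<lambda>N. indicator {0<..T} s * (sqrt (defect N (\<lambda>x. U (s, x))) * L2_norm (\<lambda>x. G (s, x))))
         \<longlonglongrightarrow> indicator {0<..T} s * (sqrt 0 * L2_norm (\<lambda>x. G (s, x)))"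
        by (intro tendsto_intros defect_tendsto U)
      then show "(\<lambda>N. indicator {0<..T} s * (sqrt (defect N (\<lambda>x. U (s, x))) * L2_norm (\<lambda>x. G (s, x)))) \<longlonglongrightarrow> 0" by simp
    qed
  qed simp
  then show ?thesis by (simp add: set_lebesgue_integral_def)
qed

text \<open>The bound of the energy estimate tends to zero with the smoothing defect of \<open>U\<close>, so \<open>mol N D\<close> tends
  to zero in \<open>L\<^sup>1\<close>; at the same time it converges weakly to \<open>D\<close>.\<close>

lemma advection_diffusion_unique:
  fixes U G :: "real \<times> (real^3) \<Rightarrow> real^3" and D :: "real \<times> (real^3) \<Rightarrow> real"
  assumes nu: "0 \<le> \<nu>"
    and Um: "U \<in> borel_measurable borel" and Dm: "D \<in> borel_measurable borel" and Gm: "G \<in> borel_measurable borel"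
    and U: "\<And>t. L2_torus (\<lambda>x. U (t, x))" "\<And>t. L2_norm (\<lambda>x. U (t, x)) \<le> CU"
    and D: "\<And>t. L2_torus (\<lambda>x. D (t, x))" "\<And>t. L2_norm (\<lambda>x. D (t, x)) \<le> CD"
    and G: "\<And>t. L2_torus (\<lambda>x. G (t, x))" "\<And>t. wave_grad (\<lambda>x. D (t, x)) (\<lambda>x. G (t, x))"
    and Gi: "set_integrable lborel {0<..T} (\<lambda>t. L2_norm (\<lambda>x. G (t, x)))"
    and df: "AE t in lborel. t \<in> {0<..T} \<longrightarrow> wave_div_free (\<lambda>x. U (t, x))"
    and ode: "\<And>m. m \<in> UNIV \<times> {0, - pi / 2} \<Longrightarrow>
      AE t in lborel. t \<in> {0<..T} \<longrightarrow> amplitude D m t = primitive (amplitude_rate \<nu> U D m) t"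
  shows "AE t in lborel. t \<in> {0<..T} \<longrightarrow>
     (\<forall>\<phi> C. \<phi> \<in> borel_measurable borel \<longrightarrow> periodic \<phi> \<longrightarrow> (\<forall>x. \<bar>\<phi> x\<bar> \<le> C) \<longrightarrow> (\<integral>x. D (t, x) * \<phi> x \<partial>torus) = 0)"
proof -
  define e where "e N = (LINT s:{0<..T}|lborel. sqrt (defect N (\<lambda>x. U (s, x))) * L2_norm (\<lambda>x. G (s, x)))" for N
  have e0: "e \<longlonglongrightarrow> 0" unfolding e_def[abs_def] by (rule defect_integral_tendsto[OF Um Gm U Gi])
  have "countable (UNIV \<times> {0, - pi / 2} :: ((int^3) \<times> real) set)"
    by (intro countable_SIGMA countableI_type) auto
  then have "AE t in lborel. \<forall>m\<in>UNIV \<times> {0, - pi / 2}. t \<in> {0<..T} \<longrightarrow> amplitude D m t = primitive (amplitude_rate \<nu> U D m) t"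
    using ode by (subst AE_ball_countable) auto
  then show ?thesis
  proof eventually_elim
    case (elim t)
    show ?case
    proof (intro impI allI)
      fix \<phi> :: "real^3 \<Rightarrow> real" and C
      assume t: "t \<in> {0<..T}" and \<phi>: "\<phi> \<in> borel_measurable borel" "periodic \<phi>" "\<forall>x. \<bar>\<phi> x\<bar> \<le> C"
      note [measurable] = \<phi>(1)
      have \<phi>2: "L2_torus \<phi>" by (rule L2_torus_bounded[OF \<phi>(1) _ \<phi>(2), of C]) (use \<phi> in auto)
      note Di = L2_torus_integrable[OF D(1)[of t]]
      have small: "\<bar>\<integral>x. \<phi> x \<bullet> mol N (\<lambda>y. D (t, y)) x \<partial>torus\<bar> \<le> C * (sqrt (e N) * sqrt (e N + 2))" for N
      proof -
        have "mol N (\<lambda>y. D (t, y)) x = (\<Sum>m\<in>modes N. coef N m * wave m x * primitive (amplitude_rate \<nu> U D m) t)" for x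
          unfolding mol_expansion[OF Di]
        proof (intro sum.cong refl)
          fix m assume "m \<in> modes N"
          then have "m \<in> UNIV \<times> {0, - pi / 2}" using modes_subset by blast
          then show "(coef N m * wave m x) *\<^sub>R (\<integral>y. wave m y *\<^sub>R D (t, y) \<partial>torus) = coef N m * wave m x * primitive (amplitude_rate \<nu> U D m) t"
            using elim t by (force simp: amplitude_def)
        qed
        then have "(\<integral>x. beta (mol N (\<lambda>y. D (t, y)) x) - 1 \<partial>torus) \<le> e N"
          unfolding e_def using energy_estimate[OF nu _ _ Um Dm Gm U D G Gi df ode, of t N] t modes_subset[of N] by auto
        then have *: "(\<integral>x. \<bar>mol N (\<lambda>y. D (t, y)) x\<bar> \<partial>torus) \<le> sqrt (e N) * sqrt (e N + 2)"
          by (intro integral_abs_le_beta continuous_mol[OF Di])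
        have mi: "integrable torus (\<lambda>x. C * \<bar>mol N (\<lambda>y. D (t, y)) x\<bar>)"
          by (intro integrable_torus_continuous continuous_intros continuous_mol[OF Di])
        have C0: "0 \<le> C" using \<phi>(3) abs_ge_zero order_trans by blast
        have "\<bar>\<integral>x. \<phi> x \<bullet> mol N (\<lambda>y. D (t, y)) x \<partial>torus\<bar> \<le> (\<integral>x. C * \<bar>mol N (\<lambda>y. D (t, y)) x\<bar> \<partial>torus)"
          by (rule abs_integral_le_integral[OF L2_torus_inner[OF \<phi>2 L2_torus_mol[OF Di]] mi])
            (use \<phi>(3) in \<open>auto simp: abs_mult intro: mult_right_mono\<close>)
        also have "\<dots> \<le> C * (sqrt (e N) * sqrt (e N + 2))"
          using * C0 by (simp add: mult_left_mono)
        finally show ?thesis .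
      qed
      have "(\<lambda>N. C * (sqrt (e N) * sqrt (e N + 2))) \<longlonglongrightarrow> C * (sqrt 0 * sqrt (0 + 2))"
        by (intro tendsto_intros e0)
      then have lim: "(\<lambda>N. C * (sqrt (e N) * sqrt (e N + 2))) \<longlonglongrightarrow> 0" by simp
      have "(\<lambda>N. \<integral>x. \<phi> x \<bullet> mol N (\<lambda>y. D (t, y)) x \<partial>torus) \<longlonglongrightarrow> 0"
        by (rule Lim_null_comparison[OF _ lim]) (use small in auto)
      moreover have "(\<lambda>N. \<integral>x. \<phi> x \<bullet> mol N (\<lambda>y. D (t, y)) x \<partial>torus) \<longlonglongrightarrow> (\<integral>x. \<phi> x \<bullet> D (t, x) \<partial>torus)"
        by (rule mol_weak_tendsto[OF D(1) \<phi>2])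
      ultimately have "(\<integral>x. \<phi> x \<bullet> D (t, x) \<partial>torus) = 0"
        by (rule LIMSEQ_unique[symmetric])
      then show "(\<integral>x. D (t, x) * \<phi> x \<partial>torus) = 0"
        by (simp add: mult.commute)
    qed
  qed
qed

section \<open>Waves as test functions\<close>

lemma grad_eqI:
  assumes "(f has_derivative f') (at x)" shows "grad f x = (\<chi> i. f' (axis i 1))"
  using frechet_derivative_at[OF assms] by (simp add: grad_def)

lemma grad_wave_eq: "grad (wave m) x = grad_wave m x"
  by (simp add: grad_eqI[OF wave_has_derivative] vec_eq_iff inner_axis)

lemma smooth_torus_wave: "smooth_torus (wave m)"
  by (simp add: smooth_torus_def smooth_def Ck_wave periodic_wave)

lemma test_fun_product:
  assumes z: "time_test T \<zeta>"
  shows "test_fun T (\<lambda>(t, x). (\<zeta> t * wave m x) *\<^sub>R c)"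
proof -
  obtain a b where ab: "0 < a" "a < b" "b < T" "\<And>t. t \<notin> {a..b} \<Longrightarrow> \<zeta> t = 0" and sm: "smooth \<zeta>"
    using z unfolding time_test_def by blast
  have "Ck k (\<lambda>z. (\<zeta> (fst z + 0) * wave m (snd z + 0)) *\<^sub>R c)" for k
    using sm Ck_wave unfolding smooth_def
    by (intro Ck_scaleR_const Ck_mult Ck_affine bounded_linear_fst bounded_linear_snd) auto
  then have "smooth (\<lambda>(t, x). (\<zeta> t * wave m x) *\<^sub>R c)"
    by (simp add: smooth_def case_prod_beta')
  moreover have "periodic (\<lambda>x. (\<zeta> t * wave m x) *\<^sub>R c)" for t
    using periodic_wave[of m] by (simp add: periodic_def)
  ultimately show ?thesis
    unfolding test_fun_def prod.case
  proof (intro conjI allI)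
    show "\<exists>a b. 0 < a \<and> a < b \<and> b < T \<and> (\<forall>t x. t \<notin> {a..b} \<longrightarrow> (\<zeta> t * wave m x) *\<^sub>R c = 0)"
      by (rule exI[of _ a], rule exI[of _ b]) (use ab in auto)
  qed auto
qed

lemma grad_x_product:
  "grad_x (\<lambda>(t, x). (\<zeta> t * wave m x) *\<^sub>R c) (t, x) = (\<chi> i. (\<zeta> t * grad_wave m x $ i) *\<^sub>R c)"
proof -
  have "((\<lambda>y. (\<zeta> t * wave m y) *\<^sub>R c) has_derivative (\<lambda>h. (\<zeta> t * (grad_wave m x \<bullet> h)) *\<^sub>R c)) (at x)"
    by (intro has_derivative_scaleR_left has_derivative_mult_right wave_has_derivative)
  from grad_eqI[OF this] show ?thesis by (simp add: grad_x_def inner_axis)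
qed

lemma deriv_t_product:
  assumes "(\<zeta> has_real_derivative \<zeta>' t) (at t)"
  shows "deriv_t (\<lambda>(t, x). (\<zeta> t * wave m x) *\<^sub>R c) (t, x) = (\<zeta>' t * wave m x) *\<^sub>R c"
proof -
  have "((\<lambda>s. \<zeta> s * wave m x) has_real_derivative (\<zeta>' t * wave m x)) (at t)"
    by (rule DERIV_cmult_right[OF assms])
  then have "((\<lambda>s. (\<zeta> s * wave m x) *\<^sub>R c) has_vector_derivative (\<zeta>' t * wave m x) *\<^sub>R c) (at t)"
    by (intro has_vector_derivative_scaleR[THEN has_vector_derivative_eq_rhs])
      (auto intro: has_vector_derivative_const)
  then show ?thesis by (simp add: deriv_t_def vector_derivative_at)
qed

section \<open>Restriction to good times\<close>

text \<open>Functions on the space-time slab are only controlled for almost every time. Setting them to zero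
  at the exceptional times and outside the slab yields Borel functions for which linear conditions
  and norm bounds hold at every time.\<close>

definition restrict_time :: "real set \<Rightarrow> (real \<times> (real^3) \<Rightarrow> 'b::real_vector) \<Rightarrow> real \<times> (real^3) \<Rightarrow> 'b" where
  "restrict_time S f z = indicator S (fst z) *\<^sub>R f z"

lemma restrict_time_in: "t \<in> S \<Longrightarrow> restrict_time S f (t, x) = f (t, x)"
  and restrict_time_out: "t \<notin> S \<Longrightarrow> restrict_time S f (t, x) = 0"
  by (simp_all add: restrict_time_def)

lemma restrict_time_borel:
  fixes f :: "real \<times> (real^3) \<Rightarrow> 'b::euclidean_space"
  assumes f: "meas_L2 T f" and S: "S \<in> sets borel" "S \<subseteq> {0<..<T}"
  shows "restrict_time S f \<in> borel_measurable borel"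
proof -
  have [measurable]: "(\<lambda>z. indicator ({0<..<T} \<times> UNIV) z *\<^sub>R f z) \<in> borel_measurable borel"
    using f by (simp add: meas_L2_def set_borel_measurable_def)
  have [measurable]: "fst \<in> borel_measurable (borel :: (real \<times> (real^3)) measure)"
    by (intro borel_measurable_continuous_onI continuous_intros)
  note S(1)[measurable]
  have "restrict_time S f = (\<lambda>z. indicator S (fst z) *\<^sub>R (indicator ({0<..<T} \<times> UNIV) z *\<^sub>R f z))"
    using S(2) by (auto simp: restrict_time_def fun_eq_iff indicator_def)
  also have "\<dots> \<in> borel_measurable borel" by measurable
  finally show ?thesis .
qed

lemma restrict_time_L2:
  fixes f :: "real \<times> (real^3) \<Rightarrow> 'b::euclidean_space"
  assumes "\<And>t. t \<in> S \<Longrightarrow> L2_torus (\<lambda>x. f (t, x))"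
  shows "L2_torus (\<lambda>x. restrict_time S f (t, x))"
  by (cases "t \<in> S") (simp_all add: restrict_time_in restrict_time_out assms L2_torus_const)

lemma restrict_time_L2_norm:
  fixes f :: "real \<times> (real^3) \<Rightarrow> 'b::euclidean_space"
  shows "L2_norm (\<lambda>x. restrict_time S f (t, x)) = indicator S t * L2_norm (\<lambda>x. f (t, x))"
  by (cases "t \<in> S") (simp_all add: restrict_time_in restrict_time_out L2_norm_torus)

text \<open>The end point \<open>T\<close> is a bad time as well, which is harmless because it is a single point.\<close>

lemma AE_good_times:
  assumes "AE t in lborel. t \<in> {0<..<T} \<longrightarrow> P t"
  obtains S where "S \<in> sets borel" "S \<subseteq> {0<..<T::real}" "\<And>t. t \<in> S \<Longrightarrow> P t"
    "AE t in lborel. t \<in> {0<..T} \<longrightarrow> t \<in> S"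
proof -
  from AE_E[OF assms] obtain N where N: "{t \<in> space lborel. \<not> (t \<in> {0<..<T} \<longrightarrow> P t)} \<subseteq> N"
    "emeasure lborel N = 0" "N \<in> sets lborel" .
  have "AE t in lborel. t \<notin> N"
    using N by (intro AE_I'[of N]) (auto simp: null_sets_def)
  then have "AE t in lborel. t \<in> {0<..T} \<longrightarrow> t \<in> {0<..<T} - N"
    using AE_lborel_singleton[of T] by eventually_elim auto
  moreover have "{0<..<T} - N \<in> sets borel" using N by simp
  ultimately show ?thesis using that[of "{0<..<T} - N"] N(1) by auto
qed

text \<open>The integral over the slab as an iterated integral over good times. The three functions are the
  integrand \<open>F0\<close> as it occurs in the definition of a weak solution, a Borel function \<open>F1\<close> that agrees
  with it for all times in \<open>(0, T)\<close>, and the version \<open>F\<close> that is restricted to good times.\<close>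

lemma lint_Q_slices:
  fixes F F0 F1 :: "real \<times> (real^3) \<Rightarrow> real"
  assumes F: "F \<in> borel_measurable borel" and F1: "F1 \<in> borel_measurable borel"
    and S: "AE t in lborel. t \<in> {0<..T} \<longrightarrow> t \<in> S" "S \<subseteq> {0<..<T}"
    and F0F1: "\<And>t x. t \<in> {0<..<T} \<Longrightarrow> F0 (t, x) = F1 (t, x)" and F1F: "\<And>t x. t \<in> S \<Longrightarrow> F1 (t, x) = F (t, x)"
    and slices: "\<And>t. integrable torus (\<lambda>x. F (t, x))"
    and bound: "\<And>t. t \<in> {0<..T} \<Longrightarrow> (\<integral>x. \<bar>F (t, x)\<bar> \<partial>torus) \<le> K t" "set_integrable lborel {0<..T} K"
  shows "(LINT z:Q T|lborel. F0 z) = (LINT t:{0<..T}|lborel. \<integral>x. F (t, x) \<partial>torus)"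
proof -
  note [measurable] = F F1 borel_pairI[OF F]
  have [measurable]: "Q T \<in> sets borel" by (intro borel_Times) auto
  have [measurable]: "fst \<in> borel_measurable (borel :: (real \<times> (real^3)) measure)" "snd \<in> borel_measurable (borel :: (real \<times> (real^3)) measure)"
    by (intro borel_measurable_continuous_onI continuous_intros)+
  let ?F = "\<lambda>(t, x). indicator {0<..T} t * (indicator cube x * F (t, x))"
  have inner: "integrable lborel (\<lambda>x. indicator cube x * F (t, x))"
    "(\<integral>x. indicator cube x * F (t, x) \<partial>lborel) = (\<integral>x. F (t, x) \<partial>torus)"
    "(\<integral>x. \<bar>indicator cube x * F (t, x)\<bar> \<partial>lborel) = (\<integral>x. \<bar>F (t, x)\<bar> \<partial>torus)" for t
    using slices[of t] by (simp_all add: integrable_restrict_space integral_restrict_space abs_mult)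
  have Fint: "integrable (lborel \<Otimes>\<^sub>M lborel) ?F"
  proof (rule lborel_pair.Fubini_integrable)
    show "?F \<in> borel_measurable (lborel \<Otimes>\<^sub>M lborel)" by measurable
    have m: "(\<lambda>t. \<integral>x. \<bar>F (t, x)\<bar> \<partial>torus) \<in> borel_measurable borel"
      using integral_torus_measurable[of "\<lambda>(t, x). \<bar>F (t, x)\<bar>"] by simp
    show "integrable lborel (\<lambda>t. \<integral>x. norm (?F (t, x)) \<partial>lborel)"
    proof (rule Bochner_Integration.integrable_bound)
      show "integrable lborel (\<lambda>t. indicator {0<..T} t * K t)" using bound(2) by (simp add: set_integrable_def)
      have eq: "(\<integral>x. norm (?F (t, x)) \<partial>lborel) = indicator {0<..T} t * (\<integral>x. \<bar>F (t, x)\<bar> \<partial>torus)" for t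
        using inner(3)[of t] by (simp add: abs_mult)
      show "(\<lambda>t. \<integral>x. norm (?F (t, x)) \<partial>lborel) \<in> borel_measurable lborel"
        unfolding eq using m by measurable
      show "AE t in lborel. norm (\<integral>x. norm (?F (t, x)) \<partial>lborel) \<le> norm (indicator {0<..T} t * K t)"
        unfolding eq using bound(1) by (intro AE_I2) (auto simp: indicator_def intro: order_trans[OF _ abs_ge_self])
    qed
    show "AE t in lborel. integrable lborel (\<lambda>x. ?F (t, x))" using inner(1) by simp
  qed
  have "(LINT z:Q T|lborel. F0 z) = (\<integral>z. indicator (Q T) z * F1 z \<partial>lborel)"
    unfolding set_lebesgue_integral_def
    by (intro Bochner_Integration.integral_cong refl) (auto simp: indicator_def F0F1)
  also have "\<dots> = (\<integral>z. ?F z \<partial>lborel)"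
  proof (rule integral_cong_AE)
    obtain N where N: "{t \<in> space lborel. \<not> (t \<in> {0<..T} \<longrightarrow> t \<in> S)} \<subseteq> N" "emeasure lborel N = 0" "N \<in> sets lborel"
      using AE_E[OF S(1)] .
    have "N \<times> UNIV \<in> null_sets (lborel \<Otimes>\<^sub>M (lborel :: (real^3) measure))"
      using N lborel.emeasure_pair_measure_Times[of N lborel "UNIV :: (real^3) set"] by (auto simp: null_sets_def)
    then have "AE z in lborel \<Otimes>\<^sub>M (lborel :: (real^3) measure). fst z \<notin> N"
      by (rule AE_I') auto
    then have "AE z in (lborel :: (real \<times> (real^3)) measure). fst z \<notin> N"
      unfolding lborel_prod .
    then show "AE z in lborel. indicator (Q T) z * F1 z = ?F z"
    proof eventually_elim
      case (elim z)
      obtain t x where z: "z = (t, x)" by (cases z)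
      have "t \<in> {0<..T} \<Longrightarrow> t \<in> S" using elim N(1) by (auto simp: z)
      then show ?case using S(2) F1F by (auto simp: z indicator_def)
    qed
    show "?F \<in> borel_measurable lborel"
      unfolding case_prod_beta' by measurable
  qed measurable
  also have "\<dots> = (\<integral>z. ?F z \<partial>(lborel \<Otimes>\<^sub>M lborel))" by (simp add: lborel_prod)
  also have "\<dots> = (\<integral>t. \<integral>x. ?F (t, x) \<partial>lborel \<partial>lborel)"
    by (rule lborel_pair.integral_fst'[OF Fint, symmetric])
  also have "\<dots> = (LINT t:{0<..T}|lborel. \<integral>x. F (t, x) \<partial>torus)"
    by (simp add: inner(2) set_lebesgue_integral_def)
  finally show ?thesis .
qed

lemma weak_grad_imp_wave_grad:
  fixes f :: "real^3 \<Rightarrow> real"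
  assumes w: "weak_grad f G" and f: "L2_torus f" and G: "L2_torus G"
  shows "wave_grad f G"
  unfolding wave_grad_def
proof
  fix m
  note fi = integrable_grad_wave_mult[OF L2_torus_integrable[OF f], of m]
  note Gi = integrable_wave_mult[OF L2_torus_integrable[OF G], of m]
  show "(\<integral>x. f x *\<^sub>R grad_wave m x \<partial>torus) = - (\<integral>x. wave m x *\<^sub>R G x \<partial>torus)"
    unfolding vec_eq_iff
  proof
    fix i
    have "(\<integral>x. (grad_wave m x $ i) *\<^sub>R f x \<partial>torus) = - (\<integral>x. wave m x *\<^sub>R (G x $ i) \<partial>torus)"
      using w[unfolded weak_grad_def set_lint_torus, rule_format, OF smooth_torus_wave, of m i]
      by (simp only: grad_wave_eq)
    then show "(\<integral>x. f x *\<^sub>R grad_wave m x \<partial>torus) $ i = (- (\<integral>x. wave m x *\<^sub>R G x \<partial>torus)) $ i"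
      using integral_bounded_linear[OF bounded_linear_vec_nth fi, of i] integral_bounded_linear[OF bounded_linear_vec_nth Gi, of i]
      by (simp add: mult.commute)
  qed
qed

lemma Linf_L2_bound:
  fixes f :: "real \<times> (real^3) \<Rightarrow> 'b::euclidean_space"
  assumes "Linf_L2 T f"
  obtains C where "0 \<le> C" "AE t in lborel. t \<in> {0<..<T} \<longrightarrow> L2_torus (\<lambda>x. f (t, x)) \<and> L2_norm (\<lambda>x. f (t, x)) \<le> C"
proof -
  obtain C where C: "AE t in lborel. t \<in> {0<..<T} \<longrightarrow> L2_norm (\<lambda>x. f (t, x)) \<le> C"
    and L: "AE t in lborel. t \<in> {0<..<T} \<longrightarrow> L2_torus (\<lambda>x. f (t, x))"
    using assms unfolding Linf_L2_def meas_L2_def by blast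
  have "AE t in lborel. t \<in> {0<..<T} \<longrightarrow> L2_torus (\<lambda>x. f (t, x)) \<and> L2_norm (\<lambda>x. f (t, x)) \<le> max C 0"
    using C L by eventually_elim auto
  then show ?thesis by (rule that[rotated]) simp
qed

lemma quad_form_bound: "\<bar>\<Sum>i\<in>UNIV. k $ i * (M $ i \<bullet> k)\<bar> \<le> (\<Sum>i\<in>UNIV. \<bar>k $ i\<bar> * norm k) * norm (M :: real^3^3)"
proof -
  have "\<bar>k $ i * (M $ i \<bullet> k)\<bar> \<le> \<bar>k $ i\<bar> * norm k * norm M" for i
  proof -
    have "\<bar>M $ i \<bullet> k\<bar> \<le> norm (M $ i) * norm k" by (rule Cauchy_Schwarz_ineq2)
    also have "\<dots> \<le> norm M * norm k" by (intro mult_right_mono Finite_Cartesian_Product.norm_nth_le) auto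
    finally have "\<bar>k $ i\<bar> * \<bar>M $ i \<bullet> k\<bar> \<le> \<bar>k $ i\<bar> * (norm M * norm k)" by (rule mult_left_mono) simp
    then show ?thesis by (simp add: abs_mult mult_ac)
  qed
  then have "(\<Sum>i\<in>UNIV. \<bar>k $ i * (M $ i \<bullet> k)\<bar>) \<le> (\<Sum>i\<in>UNIV. \<bar>k $ i\<bar> * norm k * norm M)" by (intro sum_mono)
  also have "\<dots> = (\<Sum>i\<in>UNIV. \<bar>k $ i\<bar> * norm k) * norm M" by (simp add: sum_distrib_right)
  finally show ?thesis by (rule order_trans[OF sum_abs])
qed

text \<open>The first identity is two integrations by parts: the weak gradient of \<open>B\<close> moves onto the wave, and
  since the gradient of a wave is parallel to its frequency vector, the result is a multiple of
  the left-hand side of the second identity.\<close>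

lemma viscous_term:
  assumes B: "L2_torus B" and GB: "L2_torus GB" and w: "weak_grad B GB"
    and D: "L2_torus D" and dv: "weak_div B D"
  shows "(\<integral>x. wave m x * (\<Sum>i\<in>UNIV. intvec (fst m) $ i * (GB x $ i \<bullet> intvec (fst m))) \<partial>torus)
    = (intvec (fst m) \<bullet> intvec (fst m)) * (\<integral>x. wave m x * D x \<partial>torus)"
    and "(\<integral>x. B x \<bullet> grad_wave m x \<partial>torus) = - (\<integral>x. wave m x * D x \<partial>torus)"
proof -
  define k where "k = intvec (fst m)"
  have d: "(\<integral>x. B x \<bullet> grad_wave m x \<partial>torus) = - (\<integral>x. D x * wave m x \<partial>torus)"
    using dv[unfolded weak_div_def set_lint_torus, rule_format, OF smooth_torus_wave, of m]
    by (simp only: grad_wave_eq)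
  then show "(\<integral>x. B x \<bullet> grad_wave m x \<partial>torus) = - (\<integral>x. wave m x * D x \<partial>torus)" by (simp add: mult.commute)
  have [measurable]: "B \<in> borel_measurable borel" "GB \<in> borel_measurable borel"
    using B GB by (auto simp: L2_torus_iff)
  have gi: "(\<integral>x. (grad_wave m x $ i) *\<^sub>R B x \<partial>torus) = - (\<integral>x. wave m x *\<^sub>R (GB x $ i) \<partial>torus)" for i
    using w[unfolded weak_grad_def set_lint_torus, rule_format, OF smooth_torus_wave, of m i]
    by (simp only: grad_wave_eq)
  have GBi: "integrable torus (\<lambda>x. GB x $ i)" for i
    using integrable_bounded_linear[OF bounded_linear_vec_nth L2_torus_integrable[OF GB]] .
  have wGi: "integrable torus (\<lambda>x. wave m x *\<^sub>R (GB x $ i))" for i by (rule integrable_wave_mult[OF GBi])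
  have gw: "\<bar>grad_wave m x $ i\<bar> \<le> 2 * pi * norm (intvec (fst m))" for x i
    using component_le_norm_cart[of "grad_wave m x" i] norm_grad_wave_le[of m x] by linarith
  have gBi: "integrable torus (\<lambda>x. (grad_wave m x $ i) *\<^sub>R B x)" for i
    by (rule integrable_mult_bounded[OF L2_torus_integrable[OF B] _ gw])
      (intro borel_measurable_continuous_onI continuous_intros)
  have "(\<integral>x. wave m x * (\<Sum>i\<in>UNIV. k $ i * (GB x $ i \<bullet> k)) \<partial>torus)
      = (\<integral>x. (\<Sum>i\<in>UNIV. k $ i * ((wave m x *\<^sub>R (GB x $ i)) \<bullet> k)) \<partial>torus)"
    by (simp add: sum_distrib_left mult_ac)
  also have "\<dots> = (\<Sum>i\<in>UNIV. k $ i * ((\<integral>x. wave m x *\<^sub>R (GB x $ i) \<partial>torus) \<bullet> k))"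
    by (subst Bochner_Integration.integral_sum)
      (auto intro!: integrable_mult_right integrable_inner_left wGi simp del: inner_scaleR_left simp: integral_inner_left[OF wGi])
  also have "\<dots> = - (\<Sum>i\<in>UNIV. k $ i * ((\<integral>x. (grad_wave m x $ i) *\<^sub>R B x \<partial>torus) \<bullet> k))"
    by (simp add: gi sum_negf)
  also have "\<dots> = - (\<integral>x. (\<Sum>i\<in>UNIV. k $ i * (((grad_wave m x $ i) *\<^sub>R B x) \<bullet> k)) \<partial>torus)"
    by (subst Bochner_Integration.integral_sum)
      (auto intro!: integrable_mult_right integrable_inner_left gBi simp del: inner_scaleR_left simp: integral_inner_left[OF gBi])
  also have "(\<lambda>x. \<Sum>i\<in>UNIV. k $ i * (((grad_wave m x $ i) *\<^sub>R B x) \<bullet> k)) = (\<lambda>x. (k \<bullet> k) * (B x \<bullet> grad_wave m x))"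
  proof
    fix x
    have "(\<Sum>i\<in>UNIV. k $ i * (((grad_wave m x $ i) *\<^sub>R B x) \<bullet> k)) = (k \<bullet> grad_wave m x) * (B x \<bullet> k)"
      by (simp add: inner_vec_def[of k "grad_wave m x"] sum_distrib_right mult.assoc)
    also have "\<dots> = (k \<bullet> k) * (B x \<bullet> grad_wave m x)"
      by (simp add: grad_wave_def k_def)
    finally show "(\<Sum>i\<in>UNIV. k $ i * (((grad_wave m x $ i) *\<^sub>R B x) \<bullet> k)) = (k \<bullet> k) * (B x \<bullet> grad_wave m x)" .
  qed
  also have "- (\<integral>x. (k \<bullet> k) * (B x \<bullet> grad_wave m x) \<partial>torus) = (k \<bullet> k) * (\<integral>x. wave m x * D x \<partial>torus)"
    by (simp add: d mult.commute)
  finally show "(\<integral>x. wave m x * (\<Sum>i\<in>UNIV. intvec (fst m) $ i * (GB x $ i \<bullet> intvec (fst m))) \<partial>torus)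
    = (intvec (fst m) \<bullet> intvec (fst m)) * (\<integral>x. wave m x * D x \<partial>torus)" by (simp add: k_def)
qed

section \<open>The divergence along Leray--Hopf solutions\<close>

lemma cos_sin_add_pi_half: "cos (a + (b + pi / 2)) = - sin (a + b)" "sin (a + (b + pi / 2)) = cos (a + b)" for a b :: real
  unfolding add.assoc[symmetric] by (simp_all only: cos_add[of "a + b"] sin_add[of "a + b"] cos_pi_half sin_pi_half)

lemma grad_wave_as_wave: "wave (fst m, snd m + pi / 2) x *\<^sub>R ((2 * pi) *\<^sub>R intvec (fst m)) = grad_wave m x"
  by (simp add: wave_def grad_wave_def cos_sin_add_pi_half)

lemma grad_wave_shifted: "grad_wave (fst m, snd m + pi / 2) x $ i = - (2 * pi) * wave m x * intvec (fst m) $ i"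
  by (simp add: wave_def grad_wave_def cos_sin_add_pi_half)

text \<open>The matrix \<open>M\<close> is the gradient of \<open>z\<close> times the gradient of a wave with value \<open>w\<close>. It is symmetric,
  so the two transport terms of the induction equation cancel.\<close>

lemma induction_integrand:
  fixes u B k :: "real^3" and GB :: "real^3^3" and z w :: real
  defines "M \<equiv> (\<chi> i. (z * (- (2 * pi) * w * k $ i)) *\<^sub>R ((2 * pi) *\<^sub>R k)) :: real^3^3"
  shows "b + frob (tensor u B) M - frob (tensor B u) M - d - \<nu> * frob GB M
    = b - d + \<nu> * (z * ((2 * pi)\<^sup>2 * (w * (\<Sum>i\<in>UNIV. k $ i * (GB $ i \<bullet> k)))))"
proof -
  have "frob (tensor u B) M = frob (tensor B u) M"
    unfolding frob_def M_def tensor_def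
    by (subst sum.swap) (simp add: mult_ac)
  moreover have "frob GB M = - (z * ((2 * pi)\<^sup>2 * (w * (\<Sum>i\<in>UNIV. k $ i * (GB $ i \<bullet> k)))))"
  proof -
    have "frob GB M = (\<Sum>i\<in>UNIV. - (z * (2 * pi)\<^sup>2 * w) * (k $ i * (GB $ i \<bullet> k)))"
      unfolding frob_def M_def inner_vec_def sum_distrib_left
      by (intro sum.cong refl) (simp add: power2_eq_square mult_ac)
    then have "frob GB M = - (z * (2 * pi)\<^sup>2 * w) * (\<Sum>i\<in>UNIV. k $ i * (GB $ i \<bullet> k))"
      by (simp only: sum_distrib_left)
    then show ?thesis by (simp add: mult_ac)
  qed
  ultimately show ?thesis by simp
qed

lemma integral_norm_le_L2_norm:
  fixes f :: "real^3 \<Rightarrow> 'b::euclidean_space"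
  assumes "L2_torus f" shows "(\<integral>x. norm (f x) \<partial>torus) \<le> L2_norm f"
  using L2_torus_product(2)[OF assms L2_torus_const[of "1::real"]] by (simp add: L2_norm_torus)

lemma L2_norm_restrict_integrable:
  fixes f :: "real \<times> (real^3) \<Rightarrow> 'b::euclidean_space"
  assumes f: "L2_L2 T f" and S: "S \<in> sets borel" "S \<subseteq> {0<..<T}"
  shows "set_integrable lborel {0<..T} (\<lambda>t. L2_norm (\<lambda>x. restrict_time S f (t, x)))"
  unfolding set_integrable_def
proof (rule Bochner_Integration.integrable_bound)
  have m: "meas_L2 T f" using f by (simp add: L2_L2_def)
  have "integrable lborel (\<lambda>t. indicator {0<..<T} t *\<^sub>R (L2_norm (\<lambda>x. f (t, x)))\<^sup>2)"
    using f by (simp add: L2_L2_def set_integrable_def)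
  moreover have "integrable lborel (\<lambda>t. indicator {0<..T} t * 1 :: real)"
    using set_integrable_interval_bounded[of "\<lambda>_. 1" 0 T 1] by (simp add: set_integrable_def)
  ultimately show "integrable lborel (\<lambda>t. indicator {0<..T} t * 1 + indicator {0<..<T} t *\<^sub>R (L2_norm (\<lambda>x. f (t, x)))\<^sup>2)"
    by (intro Bochner_Integration.integrable_add)
  note [measurable] = L2_norm_slice_borel[OF restrict_time_borel[OF m S]]
  show "(\<lambda>t. indicator {0<..T} t *\<^sub>R L2_norm (\<lambda>x. restrict_time S f (t, x))) \<in> borel_measurable lborel"
    by measurable
  show "AE t in lborel. norm (indicator {0<..T} t *\<^sub>R L2_norm (\<lambda>x. restrict_time S f (t, x)))
     \<le> norm (indicator {0<..T} t * 1 + indicator {0<..<T} t *\<^sub>R (L2_norm (\<lambda>x. f (t, x)))\<^sup>2)"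
  proof (rule AE_I2)
    fix t
    have "L2_norm (\<lambda>x. f (t, x)) \<le> 1 + (L2_norm (\<lambda>x. f (t, x)))\<^sup>2"
      using sum_squares_bound[of 1 "L2_norm (\<lambda>x. f (t, x))"] L2_norm_nonneg[of "\<lambda>x. f (t, x)"] by simp
    then show "norm (indicator {0<..T} t *\<^sub>R L2_norm (\<lambda>x. restrict_time S f (t, x)))
       \<le> norm (indicator {0<..T} t * 1 + indicator {0<..<T} t *\<^sub>R (L2_norm (\<lambda>x. f (t, x)))\<^sup>2)"
      using S(2) L2_norm_nonneg[of "\<lambda>x. f (t, x)"]
      by (auto simp: restrict_time_L2_norm indicator_def)
  qed
qed

lemma fst_snd_borel [measurable]:
  "fst \<in> borel_measurable (borel :: ('a::second_countable_topology \<times> 'b::second_countable_topology) measure)"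
  "snd \<in> borel_measurable (borel :: ('a::second_countable_topology \<times> 'b::second_countable_topology) measure)"
  by (intro borel_measurable_continuous_onI continuous_intros)+

text \<open>Testing with products of a function of time and a wave yields, for each wave, the orthogonality
  at almost every time. As only countably many waves are needed, the exceptional times form one
  null set.\<close>

lemma div_free_slices:
  fixes u :: "real \<times> (real^3) \<Rightarrow> real^3"
  assumes u: "meas_L2 T u" and S: "S \<in> sets borel" "S \<subseteq> {0<..<T}" "AE t in lborel. t \<in> {0<..T} \<longrightarrow> t \<in> S"
    and uS: "\<And>t. t \<in> S \<Longrightarrow> L2_torus (\<lambda>x. u (t, x)) \<and> L2_norm (\<lambda>x. u (t, x)) \<le> C" and C: "0 \<le> C"
    and weak: "\<And>\<phi> :: real \<times> (real^3) \<Rightarrow> real. test_fun T \<phi> \<Longrightarrow> (LINT z:Q T|lborel. u z \<bullet> grad_x \<phi> z) = 0"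
  shows "AE t in lborel. t \<in> {0<..T} \<longrightarrow> wave_div_free (\<lambda>x. restrict_time S u (t, x))"
proof -
  let ?u = "restrict_time S u"
  note ub [measurable] = restrict_time_borel[OF u S(1,2)]
  have u0 [measurable]: "restrict_time {0<..<T} u \<in> borel_measurable borel"
    by (rule restrict_time_borel[OF u]) auto
  have uL: "L2_torus (\<lambda>x. ?u (t, x))" for t by (rule restrict_time_L2) (use uS in auto)
  have un: "L2_norm (\<lambda>x. ?u (t, x)) \<le> C" for t
    unfolding restrict_time_L2_norm using uS C by (auto simp: indicator_def)
  have zero: "AE t in lborel. t \<in> {0<..T} \<longrightarrow> (\<integral>x. ?u (t, x) \<bullet> grad_wave m x \<partial>torus) = 0" for m
  proof (rule AE_zero_if_tests_zero)
    show "(\<lambda>t. \<integral>x. ?u (t, x) \<bullet> grad_wave m x \<partial>torus) \<in> borel_measurable borel"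
      using integral_torus_measurable[of "\<lambda>(t, x). ?u (t, x) \<bullet> grad_wave m x"] borel_pairI[OF ub] by simp
    let ?K = "C * L2_norm (grad_wave m)"
    show "\<bar>\<integral>x. ?u (t, x) \<bullet> grad_wave m x \<partial>torus\<bar> \<le> ?K" for t
      using abs_integral_inner_le[OF uL L2_norm_grad_wave(1), of t m] mult_right_mono[OF un L2_norm_nonneg, of t "grad_wave m"]
      by linarith
    fix \<zeta> assume z: "time_test T \<zeta>"
    note [measurable] = time_test_borel[OF z]
    obtain c where c: "\<And>s. \<bar>\<zeta> s\<bar> \<le> c" "0 \<le> c" using time_test_bounded[OF z] by blast
    have "0 = (LINT z:Q T|lborel. u z \<bullet> grad_x (\<lambda>(t, x). (\<zeta> t * wave m x) *\<^sub>R (1::real)) z)"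
      by (rule weak[OF test_fun_product[OF z], symmetric])
    also have "\<dots> = (LINT t:{0<..T}|lborel. \<integral>x. (\<lambda>z. \<zeta> (fst z) * (?u z \<bullet> grad_wave m (snd z))) (t, x) \<partial>torus)"
    proof (rule lint_Q_slices[where S = S and K = "\<lambda>_. c * ?K" and ?F1.0 = "\<lambda>z. \<zeta> (fst z) * (restrict_time {0<..<T} u z \<bullet> grad_wave m (snd z))"])
      show "(\<lambda>z. \<zeta> (fst z) * (?u z \<bullet> grad_wave m (snd z))) \<in> borel_measurable borel" by measurable
      show "(\<lambda>z. \<zeta> (fst z) * (restrict_time {0<..<T} u z \<bullet> grad_wave m (snd z))) \<in> borel_measurable borel" by measurable
      show "u (t, x) \<bullet> grad_x (\<lambda>(t, x). (\<zeta> t * wave m x) *\<^sub>R (1::real)) (t, x)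
          = \<zeta> (fst (t, x)) * (restrict_time {0<..<T} u (t, x) \<bullet> grad_wave m (snd (t, x)))" if "t \<in> {0<..<T}" for t x
        unfolding grad_x_product restrict_time_in[OF that]
        by (simp add: inner_vec_def sum_distrib_left mult_ac)
      show "\<zeta> (fst (t, x)) * (restrict_time {0<..<T} u (t, x) \<bullet> grad_wave m (snd (t, x)))
          = \<zeta> (fst (t, x)) * (?u (t, x) \<bullet> grad_wave m (snd (t, x)))" if "t \<in> S" for t x
        using that S(2) by (auto simp: restrict_time_in)
      show "integrable torus (\<lambda>x. \<zeta> (fst (t, x)) * (?u (t, x) \<bullet> grad_wave m (snd (t, x))))" for t
        using L2_torus_inner[OF uL L2_norm_grad_wave(1)] by simp
      show "(\<integral>x. \<bar>\<zeta> (fst (t, x)) * (?u (t, x) \<bullet> grad_wave m (snd (t, x)))\<bar> \<partial>torus) \<le> c * ?K" for t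
      proof -
        have "(\<integral>x. \<bar>?u (t, x) \<bullet> grad_wave m x\<bar> \<partial>torus) \<le> (\<integral>x. norm (?u (t, x)) * norm (grad_wave m x) \<partial>torus)"
          by (rule integral_mono) (auto intro: integrable_abs L2_torus_inner[OF uL L2_norm_grad_wave(1)]
              L2_torus_product[OF uL L2_norm_grad_wave(1)] Cauchy_Schwarz_ineq2)
        also have "\<dots> \<le> ?K"
          using L2_torus_product(2)[OF uL L2_norm_grad_wave(1), of t m] mult_right_mono[OF un L2_norm_nonneg, of t "grad_wave m"] by linarith
        finally have "\<bar>\<zeta> t\<bar> * (\<integral>x. \<bar>?u (t, x) \<bullet> grad_wave m x\<bar> \<partial>torus) \<le> c * ?K"
          using c by (intro mult_mono) auto
        then show ?thesis by (simp add: abs_mult)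
      qed
      show "set_integrable lborel {0<..T} (\<lambda>_. c * ?K)"
        by (rule set_integrable_interval_bounded[where C = "\<bar>c * ?K\<bar>"]) auto
    qed (use S in auto)
    finally show "(LINT t:{0<..T}|lborel. (\<integral>x. ?u (t, x) \<bullet> grad_wave m x \<partial>torus) * \<zeta> t) = 0"
      by (simp add: mult.commute)
  qed
  have "countable (UNIV \<times> {0, - pi / 2} :: ((int^3) \<times> real) set)"
    by (intro countable_SIGMA countableI_type) auto
  then have "AE t in lborel. \<forall>m\<in>UNIV \<times> {0, - pi / 2}. t \<in> {0<..T} \<longrightarrow> (\<integral>x. ?u (t, x) \<bullet> grad_wave m x \<partial>torus) = 0"
    using zero by (subst AE_ball_countable) auto
  then show ?thesis
    by eventually_elim (auto simp: wave_div_free_def)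
qed

text \<open>Testing the induction equation with \<open>\<zeta> t *\<^sub>R grad_wave m x\<close> gives the weak equation for the amplitude of
  \<open>D\<close>; the strong attainment of the initial data gives its initial value.\<close>

lemma leray_hopf_div_zero:
  fixes u B :: "real \<times> (real^3) \<Rightarrow> real^3"
  assumes T: "0 < T" and nu: "0 < \<nu>2"
    and LH: "leray_hopf_mhd_solution T \<nu>1 \<nu>2 u B u0 B0" and B0: "weakly_div_free B0"
  shows "AE t in lborel. t \<in> {0<..T} \<longrightarrow> (\<forall>\<phi>. smooth_torus \<phi> \<longrightarrow> (\<integral>x. B (t, x) \<bullet> grad \<phi> x \<partial>torus) = 0)"
proof -
  obtain D Gu GB GD where ui: "Linf_L2 T u" and Bi: "Linf_L2 T B" and Di: "Linf_L2 T D" and div: "has_div T B D"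
    and H1: "L2_H1 T B GB" "L2_H1 T D GD"
    and ind: "\<And>\<psi>::real \<times> (real^3) \<Rightarrow> real^3. test_fun T \<psi> \<Longrightarrow>
          (LINT z:Q T|lborel. B z \<bullet> deriv_t \<psi> z
             + frob (tensor (u z) (B z)) (grad_x \<psi> z)
             - frob (tensor (B z) (u z)) (grad_x \<psi> z)
             - D z * (u z \<bullet> \<psi> z)
             - \<nu>2 * frob (GB z) (grad_x \<psi> z)) = 0"
    and inc: "\<And>\<phi>::real \<times> (real^3) \<Rightarrow> real. test_fun T \<phi> \<Longrightarrow> (LINT z:Q T|lborel. u z \<bullet> grad_x \<phi> z) = 0"
    and att: "attains_strongly T B B0"
    using LH unfolding leray_hopf_mhd_solution_def by blast
  have meas: "meas_L2 T u" "meas_L2 T B" "meas_L2 T D" "meas_L2 T GB" "meas_L2 T GD"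
    using ui Bi Di H1 by (simp_all add: Linf_L2_def L2_H1_def L2_L2_def)
  obtain Cu where Cu: "0 \<le> Cu" "AE t in lborel. t \<in> {0<..<T} \<longrightarrow> L2_torus (\<lambda>x. u (t, x)) \<and> L2_norm (\<lambda>x. u (t, x)) \<le> Cu"
    using Linf_L2_bound[OF ui] .
  obtain CB where CB: "0 \<le> CB" "AE t in lborel. t \<in> {0<..<T} \<longrightarrow> L2_torus (\<lambda>x. B (t, x)) \<and> L2_norm (\<lambda>x. B (t, x)) \<le> CB"
    using Linf_L2_bound[OF Bi] .
  obtain CD where CD: "0 \<le> CD" "AE t in lborel. t \<in> {0<..<T} \<longrightarrow> L2_torus (\<lambda>x. D (t, x)) \<and> L2_norm (\<lambda>x. D (t, x)) \<le> CD"
    using Linf_L2_bound[OF Di] .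
  define good where "good t \<longleftrightarrow> (L2_torus (\<lambda>x. u (t, x)) \<and> L2_norm (\<lambda>x. u (t, x)) \<le> Cu) \<and>
     (L2_torus (\<lambda>x. B (t, x)) \<and> L2_norm (\<lambda>x. B (t, x)) \<le> CB) \<and> (L2_torus (\<lambda>x. D (t, x)) \<and> L2_norm (\<lambda>x. D (t, x)) \<le> CD) \<and>
     L2_torus (\<lambda>x. GB (t, x)) \<and> L2_torus (\<lambda>x. GD (t, x)) \<and> weak_grad (\<lambda>x. B (t, x)) (\<lambda>x. GB (t, x)) \<and>
     weak_grad (\<lambda>x. D (t, x)) (\<lambda>x. GD (t, x)) \<and> weak_div (\<lambda>x. B (t, x)) (\<lambda>x. D (t, x))" for t
  have GL: "AE t in lborel. t \<in> {0<..<T} \<longrightarrow> L2_torus (\<lambda>x. GB (t, x))" "AE t in lborel. t \<in> {0<..<T} \<longrightarrow> L2_torus (\<lambda>x. GD (t, x))"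
    using meas(4,5) by (simp_all add: meas_L2_def)
  have wg: "AE t in lborel. t \<in> {0<..<T} \<longrightarrow> weak_grad (\<lambda>x. B (t, x)) (\<lambda>x. GB (t, x))"
    "AE t in lborel. t \<in> {0<..<T} \<longrightarrow> weak_grad (\<lambda>x. D (t, x)) (\<lambda>x. GD (t, x))"
    using H1 by (simp_all add: L2_H1_def)
  have "AE t in lborel. t \<in> {0<..<T} \<longrightarrow> good t"
    using Cu(2) CB(2) CD(2) GL wg div[unfolded has_div_def]
    by eventually_elim (simp add: good_def)
  then obtain S where S: "S \<in> sets borel" "S \<subseteq> {0<..<T}" "\<And>t. t \<in> S \<Longrightarrow> good t" "AE t in lborel. t \<in> {0<..T} \<longrightarrow> t \<in> S"
    by (rule AE_good_times) blast
  define u' where "u' = restrict_time S u"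
  define B' where "B' = restrict_time S B"
  define D' where "D' = restrict_time S D"
  define GB' where "GB' = restrict_time S GB"
  define GD' where "GD' = restrict_time S GD"
  note defs = u'_def B'_def D'_def GB'_def GD'_def
  have borel [measurable]: "u' \<in> borel_measurable borel" "B' \<in> borel_measurable borel" "D' \<in> borel_measurable borel"
    "GB' \<in> borel_measurable borel" "GD' \<in> borel_measurable borel"
    unfolding defs by (intro restrict_time_borel[where T = T] meas S)+
  have L2: "L2_torus (\<lambda>x. u' (t, x))" "L2_torus (\<lambda>x. B' (t, x))" "L2_torus (\<lambda>x. D' (t, x))"
    "L2_torus (\<lambda>x. GB' (t, x))" "L2_torus (\<lambda>x. GD' (t, x))" for t
    unfolding defs using S(3) by (auto intro!: restrict_time_L2 simp: good_def)
  have nb: "L2_norm (\<lambda>x. u' (t, x)) \<le> Cu" "L2_norm (\<lambda>x. B' (t, x)) \<le> CB" "L2_norm (\<lambda>x. D' (t, x)) \<le> CD" for t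
    unfolding defs restrict_time_L2_norm using S(3)[of t] Cu(1) CB(1) CD(1) by (auto simp: indicator_def good_def)
  have wgD: "wave_grad (\<lambda>x. D' (t, x)) (\<lambda>x. GD' (t, x))" for t
  proof (cases "t \<in> S")
    case True
    then show ?thesis using S(3)[OF True] L2(3,5)[of t] weak_grad_imp_wave_grad
      unfolding D'_def GD'_def by (simp add: restrict_time_in good_def)
  next
    case False
    then show ?thesis by (simp add: D'_def GD'_def restrict_time_out wave_grad_def)
  qed
  have GDi: "set_integrable lborel {0<..T} (\<lambda>t. L2_norm (\<lambda>x. GD' (t, x)))"
    and GBi: "set_integrable lborel {0<..T} (\<lambda>t. L2_norm (\<lambda>x. GB' (t, x)))"
    unfolding defs using H1 S(1,2) by (auto intro!: L2_norm_restrict_integrable simp: L2_H1_def)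
  have df: "AE t in lborel. t \<in> {0<..T} \<longrightarrow> wave_div_free (\<lambda>x. u' (t, x))"
    unfolding u'_def by (rule div_free_slices[OF meas(1) S(1,2,4) _ Cu(1) inc]) (use S(3) in \<open>auto simp: good_def\<close>)
  have ode: "AE t in lborel. t \<in> {0<..T} \<longrightarrow> amplitude D' m t = primitive (amplitude_rate \<nu>2 u' D' m) t" for m
  proof (rule weak_derivative_primitive_zero[OF T])
    show "amplitude D' m \<in> borel_measurable borel" by (rule amplitude_borel[OF borel(3)])
    show "amplitude_rate \<nu>2 u' D' m \<in> borel_measurable borel" by (rule amplitude_rate_borel[OF borel(3,1)])
    show ab: "\<bar>amplitude D' m s\<bar> \<le> CD" for s by (rule amplitude_bound[OF L2(3) nb(3)])
    define CR where "CR = 2 * pi * norm (intvec (fst m)) * (CD * Cu) + \<bar>\<nu>2 * eigen m\<bar> * CD"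
    show rb: "\<bar>amplitude_rate \<nu>2 u' D' m s\<bar> \<le> CR" for s
      unfolding CR_def by (rule amplitude_rate_bound[OF L2(3) nb(3) L2(1) nb(1)])
    define k where "k = intvec (fst m)"
    define Kw where "Kw = 2 * pi * norm k"
    have Kw: "norm (grad_wave m x) \<le> Kw" "0 \<le> Kw" for x using norm_grad_wave_le[of m x] by (simp_all add: Kw_def k_def)
    have Bdiv: "(\<integral>x. B (t, x) \<bullet> grad_wave m x \<partial>torus) = - amplitude D' m t" if "t \<in> S" for t
      using viscous_term(2)[of "\<lambda>x. B (t, x)" "\<lambda>x. GB (t, x)" "\<lambda>x. D (t, x)" m] S(3)[OF that] that
      by (simp add: good_def amplitude_def D'_def restrict_time_in)
    show "ess_lim0 T (amplitude D' m) 0"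
      unfolding ess_lim0_def
    proof (intro allI impI)
      fix e :: real assume e: "e > 0"
      have B0L: "L2_torus B0" using att by (simp add: attains_strongly_def)
      have "e / (Kw + 1) > 0" using e Kw by simp
      then obtain d where d: "d > 0"
        "AE t in lborel. 0 < t \<and> t < d \<and> t < T \<longrightarrow> \<bar>L2_norm (\<lambda>x. B (t, x) - B0 x) - 0\<bar> < e / (Kw + 1)"
        using att unfolding attains_strongly_def ess_lim0_def by blast
      have "AE t in lborel. 0 < t \<and> t < d \<and> t < T \<longrightarrow> \<bar>amplitude D' m t - 0\<bar> < e"
        using d(2) S(4)
      proof eventually_elim
        case (elim t)
        show ?case
        proof
          assume t: "0 < t \<and> t < d \<and> t < T"
          then have tS: "t \<in> S" using elim by auto
          have BL: "L2_torus (\<lambda>x. B (t, x))" using S(3)[OF tS] by (simp add: good_def)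
          have z0: "(\<integral>x. B0 x \<bullet> grad_wave m x \<partial>torus) = 0"
            using B0[unfolded weakly_div_free_def weak_div_def set_lint_torus, rule_format, OF smooth_torus_wave, of m]
            by (simp add: grad_wave_eq)
          have "(\<integral>x. (B (t, x) - B0 x) \<bullet> grad_wave m x \<partial>torus) = (\<integral>x. B (t, x) \<bullet> grad_wave m x \<partial>torus)"
            unfolding inner_diff_left using L2_torus_inner[OF BL L2_norm_grad_wave(1)[of m]] L2_torus_inner[OF B0L L2_norm_grad_wave(1)[of m]] z0
            by (simp add: Bochner_Integration.integral_diff)
          then have "\<bar>amplitude D' m t\<bar> = \<bar>\<integral>x. (B (t, x) - B0 x) \<bullet> grad_wave m x \<partial>torus\<bar>"
            using Bdiv[OF tS] by simp
          also have "\<dots> \<le> L2_norm (\<lambda>x. B (t, x) - B0 x) * L2_norm (grad_wave m)"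
            by (rule abs_integral_inner_le[OF L2_torus_diff[OF BL B0L] L2_norm_grad_wave(1)])
          also have "\<dots> \<le> e / (Kw + 1) * Kw"
            using elim(1) t L2_norm_grad_wave(2)[of m] e Kw
            by (intro mult_mono) (auto simp: Kw_def k_def L2_norm_nonneg)
          also have "\<dots> < e" using e Kw by (simp add: field_simps)
          finally show "\<bar>amplitude D' m t - 0\<bar> < e" by simp
        qed
      qed
      then show "\<exists>d>0. AE t in lborel. 0 < t \<and> t < d \<and> t < T \<longrightarrow> \<bar>amplitude D' m t - 0\<bar> < e"
        using d(1) by blast
    qed
    fix \<zeta> \<zeta>' assume z: "time_test T \<zeta>" and dz: "\<And>t. (\<zeta> has_real_derivative \<zeta>' t) (at t)"
    note z' = time_test_derivative[OF z dz]
    note zb [measurable] = time_test_borel[OF z] time_test_borel[OF z']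
    obtain c where c: "\<And>s. \<bar>\<zeta> s\<bar> \<le> c" "0 \<le> c" using time_test_bounded[OF z] by blast
    obtain c' where c': "\<And>s. \<bar>\<zeta>' s\<bar> \<le> c'" "0 \<le> c'" using time_test_bounded[OF z'] by blast
    define quad where "quad M = (\<Sum>i\<in>UNIV. k $ i * (M $ i \<bullet> k))" for M :: "real^3^3"
    define Kq where "Kq = (\<Sum>i\<in>UNIV. \<bar>k $ i\<bar> * norm k)"
    have Kq: "\<bar>quad M\<bar> \<le> Kq * norm M" "0 \<le> Kq" for M
      using quad_form_bound[of k M] by (auto simp: quad_def Kq_def intro!: sum_nonneg)
    have [measurable]: "quad \<in> borel_measurable borel"
      unfolding quad_def by (intro borel_measurable_continuous_onI continuous_intros)
    define I where "I t x bv uv dv gv = \<zeta>' t * (bv \<bullet> grad_wave m x) - \<zeta> t * (dv * (uv \<bullet> grad_wave m x))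
        + \<nu>2 * (\<zeta> t * ((2 * pi)\<^sup>2 * (wave m x * quad gv)))" for t x bv uv dv gv
    define F where "F = (\<lambda>z. I (fst z) (snd z) (B' z) (u' z) (D' z) (GB' z))"
    define F1 where "F1 = (\<lambda>z. I (fst z) (snd z) (restrict_time {0<..<T} B z) (restrict_time {0<..<T} u z)
        (restrict_time {0<..<T} D z) (restrict_time {0<..<T} GB z))"
    have [measurable]: "restrict_time {0<..<T} B \<in> borel_measurable borel" "restrict_time {0<..<T} u \<in> borel_measurable borel"
      "restrict_time {0<..<T} D \<in> borel_measurable borel" "restrict_time {0<..<T} GB \<in> borel_measurable borel"
      by (intro restrict_time_borel[where T = T] meas; simp)+
    have Fm: "F \<in> borel_measurable borel" "F1 \<in> borel_measurable borel"
      unfolding F_def F1_def I_def by measurable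
    \<comment> \<open>This is \<open>\<zeta> t *\<^sub>R grad_wave m x\<close>, written as a wave with shifted phase times a constant vector.\<close>
    define \<psi> where "\<psi> = (\<lambda>(t, x). (\<zeta> t * wave (fst m, snd m + pi / 2) x) *\<^sub>R ((2 * pi) *\<^sub>R k))"
    have psi: "\<psi> (t, x) = \<zeta> t *\<^sub>R grad_wave m x" "deriv_t \<psi> (t, x) = \<zeta>' t *\<^sub>R grad_wave m x"
      "grad_x \<psi> (t, x) = (\<chi> i. (\<zeta> t * (- (2 * pi) * wave m x * k $ i)) *\<^sub>R ((2 * pi) *\<^sub>R k))" for t x
    proof -
      show "\<psi> (t, x) = \<zeta> t *\<^sub>R grad_wave m x"
        unfolding \<psi>_def prod.case grad_wave_as_wave[symmetric] k_def by (simp only: scaleR_scaleR mult.assoc)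
      show "deriv_t \<psi> (t, x) = \<zeta>' t *\<^sub>R grad_wave m x"
        unfolding \<psi>_def deriv_t_product[where \<zeta>' = \<zeta>', OF dz] grad_wave_as_wave[symmetric] k_def by (simp only: scaleR_scaleR mult.assoc)
      show "grad_x \<psi> (t, x) = (\<chi> i. (\<zeta> t * (- (2 * pi) * wave m x * k $ i)) *\<^sub>R ((2 * pi) *\<^sub>R k))"
        unfolding \<psi>_def grad_x_product grad_wave_shifted k_def ..
    qed
    have bd: "integrable torus (\<lambda>x. B' (t, x) \<bullet> grad_wave m x)"
      "integrable torus (\<lambda>x. D' (t, x) * (u' (t, x) \<bullet> grad_wave m x))"
      "integrable torus (\<lambda>x. wave m x * quad (GB' (t, x)))" for t
    proof -
      show "integrable torus (\<lambda>x. B' (t, x) \<bullet> grad_wave m x)" by (rule L2_torus_inner[OF L2(2) L2_norm_grad_wave(1)])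
      show "integrable torus (\<lambda>x. D' (t, x) * (u' (t, x) \<bullet> grad_wave m x))" by (rule abs_integral_flux_le(2)[OF L2(3) L2(1)])
      have "L2_torus (\<lambda>x. quad (GB' (t, x)))"
        by (rule L2_torus_bounded_mult[OF L2(4)[of t], where C = Kq])
          (use L2(4)[of t] Kq in \<open>auto simp: L2_torus_iff intro: periodicI_comp\<close>)
      then show "integrable torus (\<lambda>x. wave m x * quad (GB' (t, x)))"
        using integrable_wave_mult[OF L2_torus_integrable] by fastforce
    qed
    have Fi: "integrable torus (\<lambda>x. F (t, x))" for t
      unfolding F_def I_def fst_conv snd_conv
      by (intro Bochner_Integration.integrable_add Bochner_Integration.integrable_diff integrable_mult_right bd)
    have Fs: "(\<integral>x. F (t, x) \<partial>torus) = - (\<zeta>' t * amplitude D' m t) - \<zeta> t * amplitude_rate \<nu>2 u' D' m t" for t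
    proof -
      have "(\<integral>x. F (t, x) \<partial>torus) = \<zeta>' t * (\<integral>x. B' (t, x) \<bullet> grad_wave m x \<partial>torus)
          - \<zeta> t * (\<integral>x. D' (t, x) * (u' (t, x) \<bullet> grad_wave m x) \<partial>torus)
          + \<nu>2 * (\<zeta> t * ((2 * pi)\<^sup>2 * (\<integral>x. wave m x * quad (GB' (t, x)) \<partial>torus)))"
        unfolding F_def I_def fst_conv snd_conv
        by (subst Bochner_Integration.integral_add Bochner_Integration.integral_diff;
            (intro Bochner_Integration.integrable_add Bochner_Integration.integrable_diff integrable_mult_right bd)?)+ simp
      moreover have "(\<integral>x. B' (t, x) \<bullet> grad_wave m x \<partial>torus) = - amplitude D' m t"
        using Bdiv[of t] by (cases "t \<in> S") (simp_all add: B'_def D'_def amplitude_def restrict_time_in restrict_time_out)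
      moreover have "(\<integral>x. wave m x * quad (GB' (t, x)) \<partial>torus) = (k \<bullet> k) * amplitude D' m t"
      proof (cases "t \<in> S")
        case True
        then show ?thesis
          using viscous_term(1)[of "\<lambda>x. B (t, x)" "\<lambda>x. GB (t, x)" "\<lambda>x. D (t, x)" m] S(3)[OF True]
          by (simp add: good_def amplitude_def D'_def GB'_def restrict_time_in quad_def k_def)
      next
        case False
        then show ?thesis by (simp add: GB'_def D'_def amplitude_def restrict_time_out quad_def)
      qed
      ultimately show ?thesis
        by (simp add: amplitude_rate_def eigen_def k_def algebra_simps)
    qed
    \<comment> \<open>An integrable bound for the slices of the integrand, from the norms of the four fields.\<close>
    let ?K = "\<lambda>t. c' * (Kw * CB) + c * (Kw * (CD * Cu)) + \<nu>2 * c * (2 * pi)\<^sup>2 * Kq * L2_norm (\<lambda>x. GB' (t, x))"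
    have FK: "(\<integral>x. \<bar>F (t, x)\<bar> \<partial>torus) \<le> ?K t" for t
    proof -
      let ?E = "\<lambda>x. c' * (Kw * norm (B' (t, x))) + c * (Kw * (norm (D' (t, x)) * norm (u' (t, x)))) + \<nu>2 * c * (2 * pi)\<^sup>2 * Kq * norm (GB' (t, x))"
      have i: "integrable torus (\<lambda>x. norm (B' (t, x)))" "integrable torus (\<lambda>x. norm (D' (t, x)) * norm (u' (t, x)))"
        "integrable torus (\<lambda>x. norm (GB' (t, x)))"
        using L2_torus_integrable[OF L2(2)[of t]] L2_torus_product(1)[OF L2(3) L2(1), of t t] L2_torus_integrable[OF L2(4)[of t]] by auto
      have "(\<integral>x. \<bar>F (t, x)\<bar> \<partial>torus) \<le> (\<integral>x. ?E x \<partial>torus)"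
      proof (rule integral_mono)
        show "integrable torus (\<lambda>x. \<bar>F (t, x)\<bar>)" using Fi by simp
        show "integrable torus ?E" using i by simp
        fix x
        have 1: "\<bar>\<zeta>' t * (B' (t, x) \<bullet> grad_wave m x)\<bar> \<le> c' * (Kw * norm (B' (t, x)))"
        proof -
          have "\<bar>B' (t, x) \<bullet> grad_wave m x\<bar> \<le> norm (B' (t, x)) * Kw"
            using order_trans[OF Cauchy_Schwarz_ineq2 mult_left_mono[OF Kw(1) norm_ge_zero]] .
          then show ?thesis unfolding abs_mult using c' by (intro mult_mono) (auto simp: mult.commute)
        qed
        have 2: "\<bar>\<zeta> t * (D' (t, x) * (u' (t, x) \<bullet> grad_wave m x))\<bar> \<le> c * (Kw * (norm (D' (t, x)) * norm (u' (t, x))))"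
        proof -
          have "\<bar>u' (t, x) \<bullet> grad_wave m x\<bar> \<le> norm (u' (t, x)) * Kw"
            using order_trans[OF Cauchy_Schwarz_ineq2 mult_left_mono[OF Kw(1) norm_ge_zero]] .
          from mult_left_mono[OF this abs_ge_zero[of "D' (t, x)"]]
          have "\<bar>D' (t, x) * (u' (t, x) \<bullet> grad_wave m x)\<bar> \<le> Kw * (norm (D' (t, x)) * norm (u' (t, x)))"
            by (simp add: abs_mult mult_ac)
          then show ?thesis unfolding abs_mult[of "\<zeta> t"] using c by (intro mult_mono) auto
        qed
        have 3: "\<bar>\<nu>2 * (\<zeta> t * ((2 * pi)\<^sup>2 * (wave m x * quad (GB' (t, x)))))\<bar> \<le> \<nu>2 * c * (2 * pi)\<^sup>2 * Kq * norm (GB' (t, x))"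
        proof -
          have "\<bar>wave m x * quad (GB' (t, x))\<bar> \<le> 1 * (Kq * norm (GB' (t, x)))"
            unfolding abs_mult by (intro mult_mono wave_le_1 Kq) auto
          then have "\<bar>\<zeta> t\<bar> * \<bar>wave m x * quad (GB' (t, x))\<bar> \<le> c * (Kq * norm (GB' (t, x)))"
            using c by (intro mult_mono) auto
          then have "(\<nu>2 * (2 * pi)\<^sup>2) * (\<bar>\<zeta> t\<bar> * \<bar>wave m x * quad (GB' (t, x))\<bar>) \<le> (\<nu>2 * (2 * pi)\<^sup>2) * (c * (Kq * norm (GB' (t, x))))"
            using nu by (intro mult_left_mono) auto
          then show ?thesis using nu by (simp add: abs_mult mult_ac)
        qed
        show "\<bar>F (t, x)\<bar> \<le> ?E x"
          unfolding F_def I_def fst_conv snd_conv using 1 2 3 by linarith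
      qed
      also have "\<dots> = c' * (Kw * (\<integral>x. norm (B' (t, x)) \<partial>torus)) + c * (Kw * (\<integral>x. norm (D' (t, x)) * norm (u' (t, x)) \<partial>torus))
          + \<nu>2 * c * (2 * pi)\<^sup>2 * Kq * (\<integral>x. norm (GB' (t, x)) \<partial>torus)"
        using i by simp
      also have "\<dots> \<le> ?K t"
      proof (intro add_mono mult_left_mono)
        show "(\<integral>x. norm (B' (t, x)) \<partial>torus) \<le> CB" using integral_norm_le_L2_norm[OF L2(2)[of t]] nb(2)[of t] by linarith
        show "(\<integral>x. norm (D' (t, x)) * norm (u' (t, x)) \<partial>torus) \<le> CD * Cu"
          using order_trans[OF L2_torus_product(2)[OF L2(3) L2(1), of t t] mult_mono[OF nb(3) nb(1) CD(1) L2_norm_nonneg]] .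
        show "(\<integral>x. norm (GB' (t, x)) \<partial>torus) \<le> L2_norm (\<lambda>x. GB' (t, x))" by (rule integral_norm_le_L2_norm[OF L2(4)])
      qed (use c c' Kw Kq nu in auto)
      finally show ?thesis .
    qed
    have Ki: "set_integrable lborel {0<..T} ?K"
    proof (rule set_integral_add(1))
      show "set_integrable lborel {0<..T} (\<lambda>_. c' * (Kw * CB) + c * (Kw * (CD * Cu)))"
        by (rule set_integrable_interval_bounded[where C = "\<bar>c' * (Kw * CB) + c * (Kw * (CD * Cu))\<bar>"]) auto
      show "set_integrable lborel {0<..T} (\<lambda>t. \<nu>2 * c * (2 * pi)\<^sup>2 * Kq * L2_norm (\<lambda>x. GB' (t, x)))"
        by (intro set_integrable_mult_right GBi)
    qed
    have "0 = (LINT z:Q T|lborel. B z \<bullet> deriv_t \<psi> z + frob (tensor (u z) (B z)) (grad_x \<psi> z)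
             - frob (tensor (B z) (u z)) (grad_x \<psi> z) - D z * (u z \<bullet> \<psi> z) - \<nu>2 * frob (GB z) (grad_x \<psi> z))"
      by (rule ind[symmetric]) (unfold \<psi>_def, rule test_fun_product[OF z])
    also have "\<dots> = (LINT t:{0<..T}|lborel. \<integral>x. F (t, x) \<partial>torus)"
    proof (rule lint_Q_slices[OF Fm S(4,2) _ _ Fi FK Ki])
      fix t x assume t: "t \<in> {0<..<T}"
      show "B (t, x) \<bullet> deriv_t \<psi> (t, x) + frob (tensor (u (t, x)) (B (t, x))) (grad_x \<psi> (t, x))
             - frob (tensor (B (t, x)) (u (t, x))) (grad_x \<psi> (t, x)) - D (t, x) * (u (t, x) \<bullet> \<psi> (t, x)) - \<nu>2 * frob (GB (t, x)) (grad_x \<psi> (t, x)) = F1 (t, x)"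
        unfolding psi induction_integrand F1_def I_def fst_conv snd_conv restrict_time_in[OF t] quad_def by simp
    next
      fix t x assume t: "t \<in> S"
      then show "F1 (t, x) = F (t, x)"
        using S(2) unfolding F_def F1_def defs by (auto simp: restrict_time_in)
    qed
    also have "\<dots> = (LINT t:{0<..T}|lborel. - (\<zeta>' t * amplitude D' m t) - \<zeta> t * amplitude_rate \<nu>2 u' D' m t)"
      by (simp only: Fs)
    also have "\<dots> = - (LINT t:{0<..T}|lborel. \<zeta>' t * amplitude D' m t) - (LINT t:{0<..T}|lborel. \<zeta> t * amplitude_rate \<nu>2 u' D' m t)"
    proof -
      note [measurable] = amplitude_borel[OF borel(3)] amplitude_rate_borel[OF borel(3,1)]
      have 1: "set_integrable lborel {0<..T} (\<lambda>t. \<zeta>' t * amplitude D' m t)"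
      proof (rule set_integrable_interval_bounded[where C = "c' * CD"])
        show "\<bar>\<zeta>' s * amplitude D' m s\<bar> \<le> c' * CD" for s
          unfolding abs_mult by (intro mult_mono c' ab) auto
      qed measurable
      have 2: "set_integrable lborel {0<..T} (\<lambda>t. \<zeta> t * amplitude_rate \<nu>2 u' D' m t)"
      proof (rule set_integrable_interval_bounded[where C = "c * CR"])
        show "\<bar>\<zeta> s * amplitude_rate \<nu>2 u' D' m s\<bar> \<le> c * CR" for s
          unfolding abs_mult by (intro mult_mono c rb) auto
      qed measurable
      have 3: "set_integrable lborel {0<..T} (\<lambda>t. (- 1) * (\<zeta>' t * amplitude D' m t))"
        using 1 by (intro set_integrable_mult_right) simp
      have 4: "(LINT t:{0<..T}|lborel. (- 1) * (\<zeta>' t * amplitude D' m t)) = (- 1) * (LINT t:{0<..T}|lborel. \<zeta>' t * amplitude D' m t)"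
        by (rule set_integral_mult_right)
      show ?thesis using set_integral_diff(2)[OF 3 2, unfolded 4] by (simp only: mult_minus1)
    qed
    finally show "(LINT t:{0<..T}|lborel. \<zeta>' t * amplitude D' m t) = - (LINT t:{0<..T}|lborel. \<zeta> t * amplitude_rate \<nu>2 u' D' m t)"
      by simp
  qed
  have "AE t in lborel. t \<in> {0<..T} \<longrightarrow>
     (\<forall>\<phi> C. \<phi> \<in> borel_measurable borel \<longrightarrow> periodic \<phi> \<longrightarrow> (\<forall>x. \<bar>\<phi> x\<bar> \<le> C) \<longrightarrow> (\<integral>x. D' (t, x) * \<phi> x \<partial>torus) = 0)"
    by (rule advection_diffusion_unique[OF less_imp_le[OF nu] borel(1,3,5) L2(1) nb(1) L2(3) nb(3) L2(5) wgD GDi df ode])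
  then show ?thesis
    using S(4)
  proof eventually_elim
    case (elim t)
    show ?case
    proof (intro impI allI)
      fix \<phi> :: "real^3 \<Rightarrow> real" assume t: "t \<in> {0<..T}" and \<phi>: "smooth_torus \<phi>"
      have per: "periodic \<phi>" and cont: "continuous_on UNIV \<phi>"
        using \<phi> Ck_continuous[of 0 \<phi>] by (auto simp: smooth_torus_def smooth_def)
      obtain C where C: "\<And>x. norm (\<phi> x) \<le> C" using periodic_continuous_bounded[OF per cont] by blast
      have tS: "t \<in> S" using elim t by simp
      have "(\<integral>x. D' (t, x) * \<phi> x \<partial>torus) = 0"
        using elim(1) t borel_measurable_continuous_onI[OF cont] per C by auto
      moreover have "(\<integral>x. B (t, x) \<bullet> grad \<phi> x \<partial>torus) = - (\<integral>x. D (t, x) * \<phi> x \<partial>torus)"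
        using S(3)[OF tS] \<phi> unfolding good_def weak_div_def set_lint_torus by blast
      ultimately show "(\<integral>x. B (t, x) \<bullet> grad \<phi> x \<partial>torus) = 0"
        using tS by (simp add: D'_def restrict_time_in)
    qed
  qed
qed

section \<open>Space-time test functions and the limit\<close>

lemma bounded_linear_embed: "bounded_linear (\<lambda>y::real^3. (0::real, y))"
  by (intro bounded_linear_Pair bounded_linear_zero bounded_linear_ident)

lemma test_fun_slice:
  fixes \<Phi> :: "real \<times> (real^3) \<Rightarrow> real"
  assumes "test_fun T \<Phi>" shows "smooth_torus (\<lambda>x. \<Phi> (t, x))"
proof -
  have "Ck k (\<lambda>x. \<Phi> ((0, x) + (t, 0)))" for k
    using assms by (intro Ck_affine[OF bounded_linear_embed]) (simp add: test_fun_def smooth_def)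
  then show ?thesis using assms by (simp add: smooth_torus_def smooth_def test_fun_def)
qed

text \<open>The spatial gradient of a test function is continuous and periodic and vanishes outside a compact
  interval of times, hence is bounded and admissible in the weak-* convergence.\<close>

lemma grad_x_L1_L2:
  fixes \<Phi> :: "real \<times> (real^3) \<Rightarrow> real"
  assumes T: "0 < T" and \<Phi>: "test_fun T \<Phi>"
  shows "L1_L2 T (grad_x \<Phi>)" and "grad_x \<Phi> \<in> borel_measurable borel"
    and "\<exists>C. \<forall>z. norm (grad_x \<Phi> z) \<le> C" and "\<And>t. periodic (\<lambda>x. grad_x \<Phi> (t, x))"
proof -
  have C1: "Ck 1 \<Phi>" using \<Phi> by (simp add: test_fun_def smooth_def)
  have der: "(\<Phi> has_derivative frechet_derivative \<Phi> (at z)) (at z)" for z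
    using C1 Ck_has_derivative[of 0 \<Phi>] by simp
  have eq: "grad_x \<Phi> = (\<lambda>z. \<chi> i. frechet_derivative \<Phi> (at z) (0, axis i 1))"
  proof
    fix z :: "real \<times> (real^3)"
    obtain t x where z: "z = (t, x)" by (cases z)
    have "((\<lambda>y. (t, y)) has_derivative (\<lambda>h. (0, h))) (at x)"
      by (auto intro!: derivative_eq_intros)
    from has_derivative_compose[OF this, of \<Phi> "frechet_derivative \<Phi> (at (t, x))"] der
    have "((\<lambda>y. \<Phi> (t, y)) has_derivative (\<lambda>h. frechet_derivative \<Phi> (at (t, x)) (0, h))) (at x)" by simp
    from grad_eqI[OF this] show "grad_x \<Phi> z = (\<chi> i. frechet_derivative \<Phi> (at z) (0, axis i 1))"
      by (simp add: grad_x_def z)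
  qed
  have cont: "continuous_on UNIV (grad_x \<Phi>)"
    unfolding eq using C1 by (intro continuous_on_vec_lambda) simp
  then show gb [measurable]: "grad_x \<Phi> \<in> borel_measurable borel" by (rule borel_measurable_continuous_onI)
  obtain a b where ab: "0 < a" "a < b" "b < T" "\<And>t x. t \<notin> {a..b} \<Longrightarrow> \<Phi> (t, x) = 0"
    using \<Phi> unfolding test_fun_def by blast
  have per: "periodic (\<lambda>x. \<Phi> (t, x))" for t using \<Phi> by (simp add: test_fun_def)
  have sl: "((\<lambda>y. \<Phi> (t, y)) has_derivative (\<lambda>h. grad_x \<Phi> (t, x) \<bullet> h)) (at x)" for t x
  proof -
    have "Ck 1 (\<lambda>y. \<Phi> (t, y))" using test_fun_slice[OF \<Phi>, of t] by (simp add: smooth_torus_def smooth_def)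
    then have d: "((\<lambda>y. \<Phi> (t, y)) has_derivative frechet_derivative (\<lambda>y. \<Phi> (t, y)) (at x)) (at x)"
      using Ck_has_derivative[of 0] by simp
    have "frechet_derivative (\<lambda>y. \<Phi> (t, y)) (at x) h = grad_x \<Phi> (t, x) \<bullet> h" for h
    proof -
      have lin: "linear (frechet_derivative (\<lambda>y. \<Phi> (t, y)) (at x))" using d by (rule has_derivative_linear)
      have "h = (\<Sum>i\<in>UNIV. (h $ i) *\<^sub>R axis i 1)"
        using basis_expansion[of h] by (simp add: scalar_mult_eq_scaleR)
      then have "frechet_derivative (\<lambda>y. \<Phi> (t, y)) (at x) h = (\<Sum>i\<in>UNIV. (h $ i) *\<^sub>R frechet_derivative (\<lambda>y. \<Phi> (t, y)) (at x) (axis i 1))"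
        using linear_sum[OF lin, of "\<lambda>i. (h $ i) *\<^sub>R axis i 1" UNIV] linear_cmul[OF lin] by simp
      then show ?thesis by (simp add: grad_x_def grad_def inner_vec_def mult.commute)
    qed
    then have "frechet_derivative (\<lambda>y. \<Phi> (t, y)) (at x) = (\<lambda>h. grad_x \<Phi> (t, x) \<bullet> h)" by (rule ext)
    then show ?thesis using d by (simp only:)
  qed
  show gper: "periodic (\<lambda>x. grad_x \<Phi> (t, x))" for t
    by (rule periodic_gradient[OF per sl])
  have zero: "grad_x \<Phi> (t, x) = 0" if "t \<notin> {a..b}" for t x
  proof -
    have "(\<lambda>y. \<Phi> (t, y)) = (\<lambda>y. 0)" using ab(4)[OF that] by auto
    then show ?thesis by (simp add: grad_x_def grad_def vec_eq_iff)
  qed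
  have "compact (grad_x \<Phi> ` ({a..b} \<times> cube))"
    by (intro compact_continuous_image continuous_on_subset[OF cont] compact_Times) auto
  then obtain C where C: "\<And>y. y \<in> grad_x \<Phi> ` ({a..b} \<times> cube) \<Longrightarrow> norm y \<le> C"
    using compact_imp_bounded bounded_iff by metis
  have bd: "norm (grad_x \<Phi> z) \<le> max C 0" for z
  proof -
    obtain t x where z: "z = (t, x)" by (cases z)
    show ?thesis
    proof (cases "t \<in> {a..b}")
      case True
      let ?w = "x + intvec (\<chi> i. - \<lfloor>x $ i\<rfloor>)"
      have "0 \<le> r + of_int (- \<lfloor>r\<rfloor>) \<and> r + of_int (- \<lfloor>r\<rfloor>) \<le> 1" for r :: real by linarith
      then have "?w \<in> cube" by (auto simp: mem_box_cart)
      then have "norm (grad_x \<Phi> (t, ?w)) \<le> C" using True by (intro C imageI) auto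
      then show ?thesis using periodic_intvec[OF gper, of t x] by (simp add: z)
    qed (simp add: z zero)
  qed
  then show "\<exists>C. \<forall>z. norm (grad_x \<Phi> z) \<le> C" by blast
  have slb: "(\<lambda>x. grad_x \<Phi> (t, x)) \<in> borel_measurable borel" for t
    by (intro borel_measurable_continuous_onI continuous_on_compose2[OF cont] continuous_intros) auto
  have L2: "L2_torus (\<lambda>x. grad_x \<Phi> (t, x))" for t
    by (rule L2_torus_bounded[OF slb bd gper])
  have "meas_L2 T (grad_x \<Phi>)"
    unfolding meas_L2_def
  proof (intro conjI ballI)
    have "({0<..<T} \<times> UNIV :: (real \<times> (real^3)) set) \<in> sets borel" by (intro borel_Times) auto
    then show "set_borel_measurable borel ({0<..<T} \<times> UNIV) (grad_x \<Phi>)"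
      unfolding set_borel_measurable_def by measurable
  qed (use L2 gper in auto)
  moreover have "set_integrable lborel {0<..<T} (\<lambda>t. L2_norm (\<lambda>x. grad_x \<Phi> (t, x)))"
  proof (rule set_integrable_subset[of _ "{0<..T}"])
    have "L2_norm (\<lambda>x. grad_x \<Phi> (t, x)) \<le> max C 0" for t
    proof -
      have "(\<integral>x. (norm (grad_x \<Phi> (t, x)))\<^sup>2 \<partial>torus) \<le> (\<integral>x. (max C 0)\<^sup>2 \<partial>torus)"
        by (rule integral_mono) (use L2[of t] bd in \<open>auto simp: L2_torus_iff intro!: power_mono\<close>)
      then show ?thesis unfolding L2_norm_torus by (intro real_le_lsqrt) auto
    qed
    then have "\<bar>L2_norm (\<lambda>x. grad_x \<Phi> (t, x))\<bar> \<le> max C 0" for t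
      by (simp only: abs_of_nonneg[OF L2_norm_nonneg])
    then show "set_integrable lborel {0<..T} (\<lambda>t. L2_norm (\<lambda>x. grad_x \<Phi> (t, x)))"
      by (rule set_integrable_interval_bounded[OF L2_norm_slice_borel[OF gb]])
  qed auto
  ultimately show "L1_L2 T (grad_x \<Phi>)" by (simp add: L1_L2_def)
qed

lemma space_time_div_zero:
  fixes B :: "real \<times> (real^3) \<Rightarrow> real^3" and \<Phi> :: "real \<times> (real^3) \<Rightarrow> real"
  assumes T: "0 < T" and B: "Linf_L2 T B" and \<Phi>: "test_fun T \<Phi>"
    and zero: "AE t in lborel. t \<in> {0<..T} \<longrightarrow> (\<forall>\<phi>. smooth_torus \<phi> \<longrightarrow> (\<integral>x. B (t, x) \<bullet> grad \<phi> x \<partial>torus) = 0)"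
  shows "(LINT z:Q T|lborel. B z \<bullet> grad_x \<Phi> z) = 0"
proof -
  obtain C where C: "0 \<le> C" "AE t in lborel. t \<in> {0<..<T} \<longrightarrow> L2_torus (\<lambda>x. B (t, x)) \<and> L2_norm (\<lambda>x. B (t, x)) \<le> C"
    using Linf_L2_bound[OF B] .
  obtain K where K: "\<And>z. norm (grad_x \<Phi> z) \<le> K" using grad_x_L1_L2(3)[OF T \<Phi>] by blast
  have K0: "0 \<le> K" using K[of 0] norm_ge_zero order_trans by blast
  have "AE t in lborel. t \<in> {0<..<T} \<longrightarrow> (L2_torus (\<lambda>x. B (t, x)) \<and> L2_norm (\<lambda>x. B (t, x)) \<le> C) \<and>
     (\<forall>\<phi>. smooth_torus \<phi> \<longrightarrow> (\<integral>x. B (t, x) \<bullet> grad \<phi> x \<partial>torus) = 0)"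
    using C(2) zero by eventually_elim auto
  then obtain S where S: "S \<in> sets borel" "S \<subseteq> {0<..<T}"
    "\<And>t. t \<in> S \<Longrightarrow> (L2_torus (\<lambda>x. B (t, x)) \<and> L2_norm (\<lambda>x. B (t, x)) \<le> C) \<and>
       (\<forall>\<phi>. smooth_torus \<phi> \<longrightarrow> (\<integral>x. B (t, x) \<bullet> grad \<phi> x \<partial>torus) = 0)"
    "AE t in lborel. t \<in> {0<..T} \<longrightarrow> t \<in> S"
    by (rule AE_good_times) blast
  have Bm: "meas_L2 T B" using B by (simp add: Linf_L2_def)
  have [measurable]: "restrict_time S B \<in> borel_measurable borel" by (rule restrict_time_borel[OF Bm S(1,2)])
  have [measurable]: "restrict_time {0<..<T} B \<in> borel_measurable borel" by (rule restrict_time_borel[OF Bm]) auto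
  note gm [measurable] = grad_x_L1_L2(2)[OF T \<Phi>]
  have L2B: "L2_torus (\<lambda>x. restrict_time S B (t, x))" for t by (rule restrict_time_L2) (use S(3) in auto)
  have nB: "L2_norm (\<lambda>x. restrict_time S B (t, x)) \<le> C" for t
    unfolding restrict_time_L2_norm using S(3)[of t] C(1) by (auto simp: indicator_def)
  have slb: "(\<lambda>x. grad_x \<Phi> (t, x)) \<in> borel_measurable borel" for t
    using gm by measurable
  have L2g: "L2_torus (\<lambda>x. grad_x \<Phi> (t, x))" for t
    by (rule L2_torus_bounded[OF slb K grad_x_L1_L2(4)[OF T \<Phi>]])
  have "(LINT z:Q T|lborel. B z \<bullet> grad_x \<Phi> z) = (LINT t:{0<..T}|lborel. \<integral>x. (\<lambda>z. restrict_time S B z \<bullet> grad_x \<Phi> z) (t, x) \<partial>torus)"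
  proof (rule lint_Q_slices[where S = S and K = "\<lambda>_. C * K" and ?F1.0 = "\<lambda>z. restrict_time {0<..<T} B z \<bullet> grad_x \<Phi> z"])
    show "(\<lambda>z. restrict_time S B z \<bullet> grad_x \<Phi> z) \<in> borel_measurable borel" by measurable
    show "(\<lambda>z. restrict_time {0<..<T} B z \<bullet> grad_x \<Phi> z) \<in> borel_measurable borel" by measurable
    show "B (t, x) \<bullet> grad_x \<Phi> (t, x) = restrict_time {0<..<T} B (t, x) \<bullet> grad_x \<Phi> (t, x)" if "t \<in> {0<..<T}" for t x
      using that by (simp add: restrict_time_in)
    show "restrict_time {0<..<T} B (t, x) \<bullet> grad_x \<Phi> (t, x) = restrict_time S B (t, x) \<bullet> grad_x \<Phi> (t, x)" if "t \<in> S" for t x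
      using that S(2) by (auto simp: restrict_time_in)
    show "integrable torus (\<lambda>x. restrict_time S B (t, x) \<bullet> grad_x \<Phi> (t, x))" for t
      by (rule L2_torus_inner[OF L2B L2g])
    show "set_integrable lborel {0<..T} (\<lambda>_. C * K)"
      by (rule set_integrable_interval_bounded[where C = "\<bar>C * K\<bar>"]) auto
    show "(\<integral>x. \<bar>restrict_time S B (t, x) \<bullet> grad_x \<Phi> (t, x)\<bar> \<partial>torus) \<le> C * K" for t
    proof -
      have "(\<integral>x. \<bar>restrict_time S B (t, x) \<bullet> grad_x \<Phi> (t, x)\<bar> \<partial>torus) \<le> (\<integral>x. norm (restrict_time S B (t, x)) * K \<partial>torus)"
      proof (rule integral_mono)
        show "integrable torus (\<lambda>x. \<bar>restrict_time S B (t, x) \<bullet> grad_x \<Phi> (t, x)\<bar>)"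
          by (intro integrable_abs L2_torus_inner[OF L2B L2g])
        show "integrable torus (\<lambda>x. norm (restrict_time S B (t, x)) * K)"
          using L2_torus_integrable[OF L2B[of t]] by simp
        show "\<bar>restrict_time S B (t, x) \<bullet> grad_x \<Phi> (t, x)\<bar> \<le> norm (restrict_time S B (t, x)) * K" for x
          using order_trans[OF Cauchy_Schwarz_ineq2 mult_left_mono[OF K norm_ge_zero]] .
      qed
      also have "\<dots> = (\<integral>x. norm (restrict_time S B (t, x)) \<partial>torus) * K" by simp
      also have "\<dots> \<le> C * K"
        using integral_norm_le_L2_norm[OF L2B[of t]] nB[of t] K0 by (intro mult_right_mono) auto
      finally show ?thesis .
    qed
  qed (use S in auto)
  also have "\<dots> = (LINT t:{0<..T}|lborel. 0)"
  proof -
    have "(\<integral>x. restrict_time S B (t, x) \<bullet> grad_x \<Phi> (t, x) \<partial>torus) = 0" for t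
    proof (cases "t \<in> S")
      case True
      then show ?thesis
        using S(3)[OF True] test_fun_slice[OF \<Phi>, of t] by (simp add: restrict_time_in grad_x_def)
    next
      case False
      then show ?thesis by (simp add: restrict_time_out)
    qed
    then show ?thesis by simp
  qed
  finally show ?thesis by (simp add: set_lebesgue_integral_def)
qed

theorem corollary7p10:
  fixes T :: real
    and u B :: "real \<times> (real^3) \<Rightarrow> real^3"
    and u0 B0 :: "real^3 \<Rightarrow> real^3"
    and \<nu>1 \<nu>2 :: "nat \<Rightarrow> real"
    and un Bn :: "nat \<Rightarrow> real \<times> (real^3) \<Rightarrow> real^3"
    and u0n B0n :: "nat \<Rightarrow> real^3 \<Rightarrow> real^3"
  assumes "T > 0"
    and "ideal_mhd_weak_solution T u B"
    and "attains_weakly T u u0" and "attains_weakly T B B0"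
    and "weakly_div_free u0" and "weakly_div_free B0"
    and "\<And>n. \<nu>1 n > 0" and "\<And>n. \<nu>2 n > 0"
    and "\<nu>1 \<longlonglongrightarrow> 0" and "\<nu>2 \<longlonglongrightarrow> 0"
    and "\<And>n. leray_hopf_mhd_solution T (\<nu>1 n) (\<nu>2 n) (un n) (Bn n) (u0n n) (B0n n)"
    and "\<And>n. weakly_div_free (B0n n)"
    and "weakstar_lim T un u" and "weakstar_lim T Bn B"
  shows "\<forall>\<Phi>::real \<times> (real^3) \<Rightarrow> real. test_fun T \<Phi> \<longrightarrow>
           (LINT z:Q T|lborel. B z \<bullet> grad_x \<Phi> z) = 0"
proof (intro allI impI)
  fix \<Phi> :: "real \<times> (real^3) \<Rightarrow> real" assume \<Phi>: "test_fun T \<Phi>"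
  have "(LINT z:Q T|lborel. Bn n z \<bullet> grad_x \<Phi> z) = 0" for n
  proof (rule space_time_div_zero[OF assms(1) _ \<Phi>])
    show "Linf_L2 T (Bn n)" using assms(14) by (simp add: weakstar_lim_def)
    show "AE t in lborel. t \<in> {0<..T} \<longrightarrow> (\<forall>\<phi>. smooth_torus \<phi> \<longrightarrow> (\<integral>x. Bn n (t, x) \<bullet> grad \<phi> x \<partial>torus) = 0)"
      by (rule leray_hopf_div_zero[OF assms(1,8,11,12)])
  qed
  moreover have "(\<lambda>n. LINT z:Q T|lborel. Bn n z \<bullet> grad_x \<Phi> z) \<longlonglongrightarrow> (LINT z:Q T|lborel. B z \<bullet> grad_x \<Phi> z)"
    using assms(14) grad_x_L1_L2(1)[OF assms(1) \<Phi>] by (simp add: weakstar_lim_def)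
  ultimately show "(LINT z:Q T|lborel. B z \<bullet> grad_x \<Phi> z) = 0"
    by (simp add: LIMSEQ_const_iff)
qed

end
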